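(* Let $D$ be the unit disk in the plane. For $A\in(0,\pi)$ and an integer $n\ge 3$, let $\mathcal P_n(A)$ be the class of simple convex polygons contained in $D$ with at most $n$ vertices and with area at most $A$, and consider the two problems $$\text{(I)}\quad \max_{\Omega\in\mathcal P_n(A)}\operatorname{Per}(\Omega),\qquad\qquad \text{(II)}\quad \max\{\operatorname{Per}(\Omega):\ \Omega\subset D \text{ convex},\ |\Omega|=A\}.$$ Then: (1) Solutions to problem (I) are uniquely characterized by $n$ and $A$, up to a permutation of the sides. (2) Given $A\in(0,\pi)$, there exists $m$ such that for all $n\ge m$ the solution to problem (I) does not change, up to a permutation of the sides. (3) Given $A\in(0,\pi)$, every solution to problem (II) is a polygon inscribed in $D$, having $m$ sides, with $m$ an integer verifying $$(m-1)\sin\frac{2\pi}{m-1}<2A\le m\sin\frac{2\pi}{m}.$$ The angles subtended by the sides at the center of $D$, suitably ordered, have the form $0<\theta_1\le\theta_2=\theta_3=\dots=\theta_m$, where $\theta_1\in(0,\frac{2\pi}{m}]$ solves $$\sin\theta_1+(m-1)\sin\frac{2\pi-\theta_1}{m-1}=2A.$$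
   Context: $|\Omega|$ denotes the area and $\operatorname{Per}(\Omega)$ the perimeter of a planar convex set $\Omega$. $D$ is the closed unit disk. A polygon is inscribed in $D$ if all its vertices belong to $\partial D$. Polygons are described by their non-redundant vertices (distinct vertices, no three collinear). "Up to a permutation of the sides" means that the multiset of side lengths (equivalently, for inscribed polygons containing the center of $D$, the multiset of central angles subtended by the sides) is determined, the order of the sides along $\partial D$ being arbitrary (rigid motions of $D$ are not distinguished either). "The solution does not change for $n\ge m$" means that the solutions for all $n\ge m$ coincide in this sense. *)

theory Defs
  imports "HOL-Analysis.Analysis"
begin

text \<open>The plane is \<^typ>\<open>complex\<close>; the closed unit disk $D$ is \<^term>\<open>cball (0::complex) 1\<close>.\<close>

abbreviation unit_disk :: "complex set" where
  "unit_disk \<equiv> cball 0 1"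

definition area :: "complex set \<Rightarrow> real" where
  "area S = measure lebesgue S"

definition convex_polygon :: "complex set \<Rightarrow> bool" where
  "convex_polygon P \<longleftrightarrow> polytope P \<and> aff_dim P = 2"

text \<open>Extreme points are the non-redundant vertices: no three of them are collinear.\<close>

definition vertices :: "complex set \<Rightarrow> complex set" where
  "vertices P = {v. v extreme_point_of P}"

definition sides :: "complex set \<Rightarrow> complex set set" where
  "sides P = {e. e edge_of P}"

text \<open>A side is a closed segment, so its diameter is its length.\<close>

definition side_lengths :: "complex set \<Rightarrow> real multiset" where
  "side_lengths P = image_mset diameter (mset_set (sides P))"

text \<open>
  The perimeter of a bounded convex set with nonempty interior is the length of its boundary
  curve, that is, the supremum of the lengths of the closed polygons inscribed in that curve.
  A polygon whose successive vertices are taken in order along a convex curve is convex, and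
  conversely the vertices of a convex polygon with vertices on a convex curve occur in order.
  The only other inscribed polygons are doubled chords, which do not affect the supremum.
  The definition is not meant for degenerate or unbounded sets.
\<close>

definition perimeter :: "complex set \<Rightarrow> real" where
  "perimeter S =
     Sup {sum_mset (side_lengths P) | P. convex_polygon P \<and> vertices P \<subseteq> frontier S}"

definition inscribed_in_disk :: "complex set \<Rightarrow> bool" where
  "inscribed_in_disk P \<longleftrightarrow> convex_polygon P \<and> vertices P \<subseteq> sphere 0 1"

text \<open>
  The angle in $[0,\pi]$ that a segment with endpoints $a, b \neq 0$ subtends at the origin; it
  does not depend on the order of the endpoints.
\<close>

definition central_angle :: "complex set \<Rightarrow> real" where
  "central_angle e =
     (THE t. \<exists>a b. e = closed_segment a b \<and> t = arccos (a \<bullet> b / (norm a * norm b)))"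

definition central_angles :: "complex set \<Rightarrow> real multiset" where
  "central_angles P = image_mset central_angle (mset_set (sides P))"

definition polygon_class :: "nat \<Rightarrow> real \<Rightarrow> complex set \<Rightarrow> bool" where
  "polygon_class n A P \<longleftrightarrow>
     convex_polygon P \<and> P \<subseteq> unit_disk \<and> card (vertices P) \<le> n \<and> area P \<le> A"

definition convex_class :: "real \<Rightarrow> complex set \<Rightarrow> bool" where
  "convex_class A S \<longleftrightarrow> convex S \<and> S \<subseteq> unit_disk \<and> area S = A"

definition solution_I :: "nat \<Rightarrow> real \<Rightarrow> complex set \<Rightarrow> bool" where
  "solution_I n A P \<longleftrightarrow> is_arg_max perimeter (polygon_class n A) P"

text \<open>
  Competitors need not be closed. Area and perimeter do not see which boundary points belong to
  the set, so solutions are determined only up to closure.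
\<close>

definition solution_II :: "real \<Rightarrow> complex set \<Rightarrow> bool" where
  "solution_II A S \<longleftrightarrow> is_arg_max perimeter (convex_class A) S"

end

theory Submission
  imports Defs
begin

text \<open>
  Perimeter is the mean width, so it is monotone and a valuation. Moving vertices to the circle
  without changing the area reduces problem (I) to maximizing \<open>\<Sum>i<n. sin (x i)\<close> over half
  central angles \<open>x i \<ge> 0\<close> with sum \<open>pi\<close> and \<open>(\<Sum>i<n. sin (2 * x i)) \<le> 2 * A\<close>. Local perturbations show
  that a maximizer has at most two distinct positive values, the smaller one occurring once; this
  leaves a single candidate, which no longer depends on \<open>n\<close> once \<open>n \<ge> m\<close>.

  By approximation the optimal value also bounds the perimeter in problem (II). A convex body
  attaining it has its extreme points on the circle: interior extreme points cannot accumulate,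
  because a flat cap can be replaced by a triangle of at most the same area and larger perimeter,
  and an isolated one can slide parallel to the chord below it. There are finitely many extreme
  points, since merging very short sides while shrinking a fixed one increases the perimeter at
  constant area. So every solution of (II) is a polygon that solves (I).
\<close>

section \<open>Perimeter as mean width\<close>

text \<open>A supremum over inscribed polygons says little about cutting and gluing, whereas support
  functions make inclusions and chord cuts immediate; hence all surgery is done with
  \<open>mw\<close>, and \<open>perimeter\<close> returns only at the ends. The main obstacle is
  problem (II): approximation by polygons yields the bound \<open>2 * V\<close> but not its equality
  case, because strict inequalities are lost in the limit. Each exclusion therefore needs a gain
  that survives: a strict improvement of the body itself, as for interior extreme points, or a
  deficit that is uniform over all sufficiently fine finite sets of vertices, as for clusters on the
  circle. Competitors are compared under area at most \<open>A\<close>, so a replacement only has to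
  avoid increasing the area.\<close>

definition supp :: "complex set \<Rightarrow> complex \<Rightarrow> real" where
  "supp K e = (SUP x\<in>K. x \<bullet> e)"

text \<open>By Cauchy's formula \<open>mw K\<close> is the perimeter of \<open>K\<close>; a segment counts twice.\<close>

definition mw :: "complex set \<Rightarrow> real" where
  "mw K = integral {0..pi} (\<lambda>t. supp K (cis t) + supp K (- cis t))"

lemma bdd_above_inner_image:
  fixes K :: "complex set"
  assumes "bounded K" shows "bdd_above ((\<lambda>x. x \<bullet> e) ` K)"
proof -
  obtain B where B: "\<And>x. x \<in> K \<Longrightarrow> norm x \<le> B" using assms bounded_iff by blast
  have "x \<bullet> e \<le> B * norm e" if "x \<in> K" for x
    using B[OF that] norm_cauchy_schwarz[of x e] by (meson mult_right_mono norm_ge_zero order_trans)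
  then show ?thesis by (auto intro!: bdd_aboveI2)
qed

lemma supp_ge: "bounded K \<Longrightarrow> x \<in> K \<Longrightarrow> x \<bullet> e \<le> supp K e"
  unfolding supp_def by (rule cSUP_upper) (auto intro: bdd_above_inner_image)

lemma supp_le: "K \<noteq> {} \<Longrightarrow> (\<And>x. x \<in> K \<Longrightarrow> x \<bullet> e \<le> c) \<Longrightarrow> supp K e \<le> c"
  unfolding supp_def by (rule cSUP_least)

lemma supp_attained:
  assumes "compact K" "K \<noteq> {}"
  obtains x where "x \<in> K" "supp K e = x \<bullet> e"
proof -
  have "continuous_on K (\<lambda>x. x \<bullet> e)" by (intro continuous_intros)
  then obtain x where x: "x \<in> K" "\<And>y. y \<in> K \<Longrightarrow> y \<bullet> e \<le> x \<bullet> e"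
    using continuous_attains_sup[OF assms] by blast
  have "supp K e = x \<bullet> e"
    using x supp_le[OF assms(2)] supp_ge[OF compact_imp_bounded[OF assms(1)] x(1)] by (metis order_antisym)
  with x(1) that show ?thesis by blast
qed

lemma supp_mono: "bounded L \<Longrightarrow> K \<noteq> {} \<Longrightarrow> K \<subseteq> L \<Longrightarrow> supp K e \<le> supp L e"
  by (rule supp_le) (auto intro: supp_ge)

lemma supp_convex_hull:
  assumes "bounded V" "V \<noteq> {}"
  shows "supp (convex hull V) e = supp V e"
proof (rule antisym)
  have "V \<subseteq> {x. x \<bullet> e \<le> supp V e}" using assms supp_ge by auto
  moreover have "convex {x. x \<bullet> e \<le> supp V e}"
    using convex_halfspace_le[of e "supp V e"] by (simp add: inner_commute)
  ultimately have "convex hull V \<subseteq> {x. x \<bullet> e \<le> supp V e}" by (rule hull_minimal)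
  then show "supp (convex hull V) e \<le> supp V e" using assms by (intro supp_le) auto
  show "supp V e \<le> supp (convex hull V) e"
    using assms by (intro supp_mono bounded_convex_hull) (auto simp: hull_subset)
qed

lemma supp_Un:
  assumes "bounded X" "bounded Y" "X \<noteq> {}" "Y \<noteq> {}"
  shows "supp (X \<union> Y) e = max (supp X e) (supp Y e)"
proof (rule antisym)
  show "supp (X \<union> Y) e \<le> max (supp X e) (supp Y e)"
    using assms supp_ge[of X _ e] supp_ge[of Y _ e] by (intro supp_le) (auto simp: le_max_iff_disj)
  show "max (supp X e) (supp Y e) \<le> supp (X \<union> Y) e"
    using assms by (simp add: supp_mono)
qed

text \<open>Join the two maximizers by a segment. It stays in the convex union and is connected, so
  some point of it lies in both closed sets; there the linear functional takes a value between the
  two maxima, hence at least their minimum.\<close>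

lemma supp_Int:
  assumes "compact X" "compact Y" "X \<noteq> {}" "Y \<noteq> {}" "convex (X \<union> Y)"
  shows "X \<inter> Y \<noteq> {}" "supp (X \<inter> Y) e = min (supp X e) (supp Y e)"
proof -
  obtain x where x: "x \<in> X" "supp X e = x \<bullet> e" using supp_attained assms by metis
  obtain y where y: "y \<in> Y" "supp Y e = y \<bullet> e" using supp_attained assms by metis
  have sub: "closed_segment x y \<subseteq> X \<union> Y" using assms(5) x y by (simp add: closed_segment_subset)
  have "closed_segment x y \<inter> (X \<inter> Y) \<noteq> {}"
  proof
    assume E: "closed_segment x y \<inter> (X \<inter> Y) = {}"
    have "connected (closed_segment x y)" by simp
    moreover have "closed X" "closed Y" using assms compact_imp_closed by auto
    moreover have "X \<inter> closed_segment x y \<noteq> {}" "Y \<inter> closed_segment x y \<noteq> {}" using x y by auto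
    ultimately show False using sub E unfolding connected_closed by (metis Int_assoc Int_commute)
  qed
  then obtain z where z: "z \<in> closed_segment x y" "z \<in> X \<inter> Y" by blast
  from z(2) show "X \<inter> Y \<noteq> {}" by blast
  obtain u where u: "0 \<le> u" "u \<le> 1" "z = (1 - u) *\<^sub>R x + u *\<^sub>R y"
    using z(1) by (auto simp: closed_segment_def)
  have "z \<bullet> e = (1-u) * supp X e + u * supp Y e" using u x y by (simp add: inner_simps)
  also have "\<dots> \<ge> (1-u) * min (supp X e) (supp Y e) + u * min (supp X e) (supp Y e)"
    using u by (intro add_mono mult_left_mono) auto
  finally have "z \<bullet> e \<ge> min (supp X e) (supp Y e)" by (simp add: algebra_simps)
  moreover have "z \<bullet> e \<le> supp (X \<inter> Y) e"
    using z assms by (intro supp_ge) (auto simp: compact_imp_bounded bounded_Int)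
  moreover have "supp (X \<inter> Y) e \<le> supp X e" "supp (X \<inter> Y) e \<le> supp Y e"
    using z(2) assms by (auto intro!: supp_mono simp: compact_imp_bounded)
  ultimately show "supp (X \<inter> Y) e = min (supp X e) (supp Y e)" by linarith
qed

lemma continuous_on_supp:
  assumes "bounded K" "K \<noteq> {}"
  shows "continuous_on UNIV (supp K)"
proof -
  obtain B where B: "B > 0" "\<And>x. x \<in> K \<Longrightarrow> norm x \<le> B" using assms bounded_pos by blast
  have le: "supp K e \<le> supp K f + B * norm (e - f)" for e f
  proof (rule supp_le[OF assms(2)])
    fix x assume x: "x \<in> K"
    have "x \<bullet> e = x \<bullet> f + x \<bullet> (e - f)" by (simp add: inner_simps)
    also have "\<dots> \<le> supp K f + norm x * norm (e - f)"
      using supp_ge[OF assms(1) x] norm_cauchy_schwarz by (meson add_mono)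
    also have "\<dots> \<le> supp K f + B * norm (e - f)" using B(2)[OF x] by (simp add: mult_right_mono)
    finally show "x \<bullet> e \<le> supp K f + B * norm (e - f)" .
  qed
  have "B-lipschitz_on UNIV (supp K)"
  proof (rule lipschitz_onI)
    fix e f show "dist (supp K e) (supp K f) \<le> B * dist e f"
      using le[of e f] le[of f e] by (simp add: dist_norm norm_minus_commute abs_le_iff)
  qed (use B in simp)
  then show ?thesis by (rule lipschitz_on_continuous_on)
qed

lemma integrable_supp:
  assumes "bounded K" "K \<noteq> {}"
  shows "(\<lambda>t. supp K (cis t) + supp K (- cis t)) integrable_on {0..pi}"
proof (rule integrable_continuous_interval)
  have c: "continuous_on {0..pi} cis" unfolding cis_conv_exp by (intro continuous_intros)
  then have c': "continuous_on {0..pi} (\<lambda>t. - cis t)" by (intro continuous_intros)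
  show "continuous_on {0..pi} (\<lambda>t. supp K (cis t) + supp K (- cis t))"
    using continuous_on_compose2[OF continuous_on_supp[OF assms] c] 
      continuous_on_compose2[OF continuous_on_supp[OF assms] c'] by (intro continuous_on_add) auto
qed

lemma mw_mono:
  assumes "bounded L" "K \<noteq> {}" "K \<subseteq> L"
  shows "mw K \<le> mw L"
  unfolding mw_def using assms
  by (intro integral_le integrable_supp add_mono supp_mono) (auto intro: bounded_subset)

lemma mw_convex_hull: "bounded V \<Longrightarrow> V \<noteq> {} \<Longrightarrow> mw (convex hull V) = mw V"
  unfolding mw_def by (simp add: supp_convex_hull)

text \<open>In each direction the support values satisfy max + min = sum. Convexity of the union
  enters through \<open>supp_Int\<close>.\<close>

lemma mw_valuation:
  assumes "compact X" "compact Y" "X \<noteq> {}" "Y \<noteq> {}" "convex (X \<union> Y)"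
  shows "mw (X \<union> Y) + mw (X \<inter> Y) = mw X + mw Y"
proof -
  note b = assms(1,2)[THEN compact_imp_bounded]
  have b': "bounded (X \<inter> Y)" "bounded (X \<union> Y)" using b by auto
  have "(supp (X \<union> Y) e + supp (X \<union> Y) (-e)) + (supp (X \<inter> Y) e + supp (X \<inter> Y) (-e))
     = (supp X e + supp X (-e)) + (supp Y e + supp Y (-e))" for e
    using supp_Int(2)[OF assms] supp_Un[OF b assms(3,4)] by (simp add: max_def min_def)
  then show ?thesis unfolding mw_def
    using assms supp_Int(1)[OF assms] b b'
    by (subst (1 2) integral_add[symmetric]) (auto intro!: integrable_supp)
qed

section \<open>Cauchy's formula for segments and triangles\<close>

lemma integral_abs_sin_shift:
  assumes "0 \<le> a" "a \<le> pi"
  shows "((\<lambda>t. \<bar>sin (t - a)\<bar>) has_integral 2) {0..pi}"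
proof -
  have "((\<lambda>t. \<bar>sin (t - a)\<bar>) has_integral (cos 0 - cos a)) {0..a}"
  proof -
    have "((\<lambda>t. sin (a - t)) has_integral (cos (a - a) - cos (a - 0))) {0..a}"
      using assms by (intro fundamental_theorem_of_calculus)
        (auto intro!: derivative_eq_intros simp flip: has_real_derivative_iff_has_vector_derivative)
    moreover have "\<bar>sin (t - a)\<bar> = sin (a - t)" if "t \<in> {0..a}" for t
      using that assms sin_ge_zero[of "a - t"] sin_minus[of "a - t"] by simp
    ultimately show ?thesis 
      by (subst has_integral_cong[of _ _ "\<lambda>t. sin (a - t)"]) auto
  qed
  moreover have "((\<lambda>t. \<bar>sin (t - a)\<bar>) has_integral (- cos (pi - a) + cos 0)) {a..pi}"
  proof -
    have "((\<lambda>t. sin (t - a)) has_integral (- cos (pi - a) - - cos (a - a))) {a..pi}"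
      using assms by (intro fundamental_theorem_of_calculus)
        (auto intro!: derivative_eq_intros simp flip: has_real_derivative_iff_has_vector_derivative)
    moreover have "\<bar>sin (t - a)\<bar> = sin (t - a)" if "t \<in> {a..pi}" for t
      using that assms sin_ge_zero[of "t - a"] by simp
    ultimately show ?thesis 
      by (subst has_integral_cong[of _ _ "\<lambda>t. sin (t - a)"]) auto
  qed
  ultimately have "((\<lambda>t. \<bar>sin (t - a)\<bar>) has_integral ((cos 0 - cos a) + (- cos (pi - a) + cos 0))) {0..pi}"
    using assms by (intro has_integral_combine[of 0 a pi]) auto
  then show ?thesis by simp
qed

text \<open>The width of a segment in direction \<open>cis t\<close>, integrated over a half turn.
  Widths of segments and of triangles are combinations of such terms.\<close>

lemma integral_abs_inner_cis:
  "((\<lambda>t. \<bar>z \<bullet> cis t\<bar>) has_integral (2 * norm z)) {0..pi}"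
proof -
  define p where "p = Arg z"
  have z: "z = norm z * cis p" unfolding p_def
    using rcis_cmod_Arg[of z] by (simp add: rcis_def)
  \<comment> \<open>Turns the cosine with phase \<open>p\<close> into a sine with a shift in
    \<open>[0, pi]\<close>. As \<open>Arg\<close> takes values in \<open>(-pi, pi]\<close>, the
    shift is \<open>p + pi/2\<close>, \<open>p + 3*pi/2\<close> or \<open>p - pi/2\<close>.\<close>
  have "\<exists>a\<ge>0. a \<le> pi \<and> (\<forall>t. \<bar>cos (t - p)\<bar> = \<bar>sin (t - a)\<bar>)"
  proof (cases "p \<le> pi / 2")
    case True
    then have "p + pi/2 \<ge> 0 \<or> p + 3*pi/2 \<ge> 0" using Arg_bounded[of z] p_def by linarith
    show ?thesis
    proof (cases "p + pi/2 \<ge> 0")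
      case True
      have "\<bar>cos (t - p)\<bar> = \<bar>sin (t - (p + pi/2))\<bar>" for t
        using cos_sin_eq[of "t-p"] by (simp add: sin_diff cos_diff algebra_simps sin_add cos_add)
      then show ?thesis using True \<open>p \<le> pi / 2\<close> by (intro exI[of _ "p + pi/2"]) auto
    next
      case False
      have e: "p + 3*pi/2 = p + pi/2 + pi" by simp
      have "\<bar>cos (t - p)\<bar> = \<bar>sin (t - (p + 3*pi/2))\<bar>" for t
      proof -
        have "sin (x - (pi/2 + pi)) = cos x" for x :: real
          by (simp only: sin_diff sin_add cos_add) simp
        from this[of "t - p"] show ?thesis by (simp add: e algebra_simps)
      qed
      then show ?thesis using False Arg_bounded[of z] p_def
        by (intro exI[of _ "p + 3*pi/2"]) auto
    qed
  next
    case False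
    have "\<bar>cos (t - p)\<bar> = \<bar>sin (t - (p - pi/2))\<bar>" for t
      by (simp add: sin_diff cos_diff sin_add cos_add algebra_simps)
    then show ?thesis using False Arg_bounded[of z] p_def by (intro exI[of _ "p - pi/2"]) auto
  qed
  then obtain a where a: "0 \<le> a" "a \<le> pi" "\<And>t. \<bar>cos (t - p)\<bar> = \<bar>sin (t - a)\<bar>" by blast
  have "\<bar>z \<bullet> cis t\<bar> = norm z * \<bar>sin (t - a)\<bar>" for t
  proof -
    have "z \<bullet> cis t = norm z * cos (t - p)"
      by (subst z) (simp add: inner_complex_def cos_diff algebra_simps)
    then show ?thesis using a(3) by (simp add: abs_mult)
  qed
  then show ?thesis using has_integral_mult_right[OF integral_abs_sin_shift[OF a(1,2)], of "norm z"]
    by (simp add: mult.commute)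
qed

lemma supp_insert:
  assumes "finite V" "V \<noteq> {}"
  shows "supp (insert x V) e = max (x \<bullet> e) (supp V e)"
proof -
  have "supp {x} e = x \<bullet> e" unfolding supp_def by simp
  then show ?thesis using supp_Un[of "{x}" V e] assms finite_imp_bounded by auto
qed

lemma supp_singleton [simp]: "supp {x} e = x \<bullet> e" unfolding supp_def by simp

lemma width_two: "max x y + max (-x) (-y) = \<bar>x - y\<bar>" for x y :: real
  by linarith

text \<open>The largest of the three pairwise distances is the spread and also the sum of the other
  two, so the distances add up to twice the spread.\<close>

lemma width_three:
  "max x (max y z) + max (-x) (max (-y) (-z)) = 1/2 * (\<bar>x - y\<bar> + \<bar>y - z\<bar> + \<bar>z - x\<bar>)" for x y z :: real
proof -
  consider "x \<le> y" "y \<le> z" | "x \<le> z" "z \<le> y" | "y \<le> x" "x \<le> z" | "y \<le> z" "z \<le> x" | "z \<le> x" "x \<le> y" | "z \<le> y" "y \<le> x"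
    by linarith
  then show ?thesis by cases simp_all
qed

lemma mw_segment: "mw (closed_segment a b) = 2 * dist a b"
proof -
  have "supp {a,b} (cis t) + supp {a,b} (- cis t) = \<bar>(a-b) \<bullet> cis t\<bar>" for t
    using width_two[of "a \<bullet> cis t" "b \<bullet> cis t"] by (simp add: supp_insert inner_simps)
  then have "mw {a,b} = integral {0..pi} (\<lambda>t. \<bar>(a-b) \<bullet> cis t\<bar>)" unfolding mw_def by simp
  also have "\<dots> = 2 * dist a b" using integral_unique[OF integral_abs_inner_cis[of "a-b"]] by (simp add: dist_norm)
  finally show ?thesis by (simp add: segment_convex_hull mw_convex_hull)
qed

lemma mw_triangle: "mw (convex hull {a,b,c}) = dist a b + dist b c + dist c a"
proof -
  have e: "supp {a,b,c} (cis t) + supp {a,b,c} (- cis t)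
      = 1/2 * (\<bar>(a-b) \<bullet> cis t\<bar> + \<bar>(b-c) \<bullet> cis t\<bar> + \<bar>(c-a) \<bullet> cis t\<bar>)" for t
    using width_three[of "a \<bullet> cis t" "b \<bullet> cis t" "c \<bullet> cis t"] by (simp add: supp_insert inner_simps)
  have "((\<lambda>t. 1/2 * (\<bar>(a-b) \<bullet> cis t\<bar> + \<bar>(b-c) \<bullet> cis t\<bar> + \<bar>(c-a) \<bullet> cis t\<bar>))
     has_integral 1/2 * (2 * norm (a-b) + 2 * norm (b-c) + 2 * norm (c-a))) {0..pi}"
    by (intro has_integral_mult_right has_integral_add integral_abs_inner_cis)
  then have "mw {a,b,c} = dist a b + dist b c + dist c a"
    unfolding mw_def e by (subst integral_unique, assumption) (simp add: dist_norm)
  then show ?thesis by (simp add: mw_convex_hull)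
qed

text \<open>A finite \<open>d\<close>-net changes each support value by at most \<open>d\<close>,
  hence the integral of the width by at most \<open>2 * d * pi\<close>. The prescribed points
  \<open>V0\<close> let later arguments keep chosen vertices in the approximation.\<close>

lemma mw_finite_approx:
  assumes "compact Z" "Z \<noteq> {}" "finite V0" "V0 \<subseteq> Z" "\<epsilon> > 0"
  obtains V where "finite V" "V \<noteq> {}" "V0 \<subseteq> V" "V \<subseteq> Z" "mw (convex hull Z) \<le> mw (convex hull V) + \<epsilon>"
proof -
  define d where "d = \<epsilon> / (2 * pi)"
  have d: "d > 0" using assms unfolding d_def by simp
  obtain W where W: "finite W" "W \<subseteq> Z" "Z \<subseteq> (\<Union>x\<in>W. ball x d)"
    using compact_eq_totally_bounded[THEN iffD1, OF assms(1)] d assms(1)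
    by (metis compactE_image[OF assms(1), of Z "\<lambda>x. ball x d"] UN_I centre_in_ball open_ball subsetI)
  define V where "V = W \<union> V0"
  have V: "finite V" "V0 \<subseteq> V" "V \<subseteq> Z" "V \<noteq> {}" using W assms by (auto simp: V_def)
  have bZ: "bounded Z" "bounded V" using assms V by (auto simp: compact_imp_bounded finite_imp_bounded)
  have le: "supp Z e \<le> supp V e + d" if "norm e = 1" for e
  proof (rule supp_le[OF assms(2)])
    fix x assume "x \<in> Z"
    then obtain y where y: "y \<in> W" "dist y x < d" using W by auto
    have "x \<bullet> e = y \<bullet> e + (x - y) \<bullet> e" by (simp add: inner_simps)
    also have "\<dots> \<le> supp V e + norm (x-y) * norm e"
      using y bZ by (intro add_mono supp_ge norm_cauchy_schwarz) (auto simp: V_def)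
    also have "\<dots> \<le> supp V e + d" using y that by (simp add: dist_norm norm_minus_commute)
    finally show "x \<bullet> e \<le> supp V e + d" .
  qed
  have "mw Z \<le> integral {0..pi} (\<lambda>t. (supp V (cis t) + supp V (- cis t)) + 2 * d)"
    unfolding mw_def
  proof (intro integral_le integrable_supp integrable_add)
    show "supp Z (cis t) + supp Z (- cis t) \<le> supp V (cis t) + supp V (- cis t) + 2 * d" for t
      using le[of "cis t"] le[of "- cis t"] by simp
  qed (use assms V bZ in auto)
  also have "\<dots> = mw V + 2 * d * pi"
    unfolding mw_def using integrable_supp[of V] bZ V
    by (subst integral_add) auto
  also have "2 * d * pi = \<epsilon>" unfolding d_def by simp
  finally show ?thesis using V assms bZ by (intro that[of V]) (auto simp: mw_convex_hull)
qed

section \<open>Orientation and gluing along a chord\<close>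

definition det2 :: "complex \<Rightarrow> complex \<Rightarrow> real" where
  "det2 a b = Re a * Im b - Im a * Re b"

text \<open>Twice the signed area of the triangle \<open>a b c\<close>, positive when it is
  traversed counterclockwise; the sign tells on which side of the directed line \<open>a b\<close>
  the point \<open>c\<close> lies.\<close>

definition orient :: "complex \<Rightarrow> complex \<Rightarrow> complex \<Rightarrow> real" where
  "orient a b c = det2 (b - a) (c - a)"

lemmas orient_simps = orient_def det2_def

lemma det2_simps [simp]:
  "det2 a a = 0" "det2 0 a = 0" "det2 a 0 = 0"
  "det2 a (b + c) = det2 a b + det2 a c" "det2 a (b - c) = det2 a b - det2 a c"
  "det2 (b + c) a = det2 b a + det2 c a" "det2 (b - c) a = det2 b a - det2 c a"
  "det2 a (r *\<^sub>R b) = r * det2 a b" "det2 (r *\<^sub>R a) b = r * det2 a b"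
  "det2 a (- b) = - det2 a b" "det2 (- a) b = - det2 a b"
  by (simp_all add: det2_def algebra_simps)

lemma det2_swap: "det2 a b = - det2 b a" by (simp add: det2_def)

lemma det2_eq_inner: "det2 a b = (\<i> * a) \<bullet> b"
  by (simp add: det2_def inner_complex_def)

lemma orient_degenerate [simp]: "orient a a b = 0" "orient a b a = 0" "orient a b b = 0"
  by (simp_all add: orient_simps)

lemma orient_cyclic: "orient a b c = orient b c a"
  by (simp add: orient_simps algebra_simps)

lemma orient_swap: "orient a b c = - orient b a c"
  by (simp add: orient_simps algebra_simps)

lemma orient_swap_right: "orient a b c = - orient a c b"
  by (simp add: orient_simps algebra_simps)

lemma orient_affine:
  "u + v = 1 \<Longrightarrow> orient a b (u *\<^sub>R x + v *\<^sub>R y) = u * orient a b x + v * orient a b y"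
proof -
  assume "u + v = 1"
  then have v: "v = 1 - u" by simp
  show ?thesis unfolding v by (simp add: orient_simps algebra_simps)
qed

text \<open>For \<open>c = 0\<close> this is the half-plane to the left of the line through
  \<open>p\<close> with direction \<open>a\<close>; support lines are recorded in this form
  throughout.\<close>

lemma convex_det2_ge: "convex {x. c \<le> det2 a (x - p)}" and closed_det2_ge: "closed {x. c \<le> det2 a (x - p)}"
proof -
  have "{x. c \<le> det2 a (x - p)} = {x. (\<i> * a) \<bullet> x \<ge> c + (\<i> * a) \<bullet> p}"
    by (auto simp: det2_eq_inner inner_diff_right)
  then show "convex {x. c \<le> det2 a (x - p)}" "closed {x. c \<le> det2 a (x - p)}"
    by (simp_all add: convex_halfspace_ge closed_halfspace_ge)
qed

lemma convex_orient_ge: "convex {x. 0 \<le> orient a b x}" and closed_orient_ge: "closed {x. 0 \<le> orient a b x}"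
  unfolding orient_def by (rule convex_det2_ge closed_det2_ge)+

lemma convex_orient_le: "convex {x. orient a b x \<le> 0}" and closed_orient_le: "closed {x. orient a b x \<le> 0}"
proof -
  have "{x. orient a b x \<le> 0} = {x. 0 \<le> orient b a x}" by (auto simp: orient_swap[of a b])
  then show "convex {x. orient a b x \<le> 0}" "closed {x. orient a b x \<le> 0}"
    using convex_orient_ge closed_orient_ge by auto
qed

lemma convex_hull_subset_det2: "V \<subseteq> {x. c \<le> det2 a (x - p)} \<Longrightarrow> convex hull V \<subseteq> {x. c \<le> det2 a (x - p)}"
  by (intro hull_minimal convex_det2_ge)

lemma orient_eq_0_iff:
  assumes "a \<noteq> b"
  shows "orient a b x = 0 \<longleftrightarrow> (\<exists>s. x = a + s *\<^sub>R (b - a))"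
proof
  assume o: "orient a b x = 0"
  define s where "s = ((x - a) \<bullet> (b - a)) / (norm (b - a))\<^sup>2"
  have n: "(norm (b-a))\<^sup>2 = (Re b - Re a)\<^sup>2 + (Im b - Im a)\<^sup>2" by (simp add: cmod_power2)
  have nz: "(Re b - Re a)\<^sup>2 + (Im b - Im a)\<^sup>2 \<noteq> 0"
    using assms by (auto simp: sum_power2_eq_zero_iff complex_eq_iff)
  define X where "X = Re x - Re a" define Y where "Y = Im x - Im a"
  define U where "U = Re b - Re a" define W where "W = Im b - Im a"
  have o': "U * Y = W * X" using o by (simp add: orient_simps X_def Y_def U_def W_def)
  have nz': "U\<^sup>2 + W\<^sup>2 \<noteq> 0" using nz by (simp add: U_def W_def)
  have s: "s = (X * U + Y * W) / (U\<^sup>2 + W\<^sup>2)"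
    unfolding s_def n by (simp add: inner_complex_def X_def Y_def U_def W_def)
  have "(X * U + Y * W) * U = X * (U\<^sup>2 + W\<^sup>2)" "(X * U + Y * W) * W = Y * (U\<^sup>2 + W\<^sup>2)" using o' by algebra+
  then have "s * U = X" "s * W = Y" unfolding s times_divide_eq_left using nz' by simp_all
  then have "x = a + s *\<^sub>R (b - a)"
    by (simp add: complex_eq_iff X_def Y_def U_def W_def)
  then show "\<exists>s. x = a + s *\<^sub>R (b - a)" ..
next
  assume "\<exists>s. x = a + s *\<^sub>R (b - a)"
  then obtain s where "x = a + s *\<^sub>R (b - a)" ..
  then show "orient a b x = 0" by (simp only: orient_def add_diff_cancel_left' det2_simps)
qed

lemma in_segment_param: "0 \<le> s \<Longrightarrow> s \<le> 1 \<Longrightarrow> a + s *\<^sub>R (b - a) \<in> closed_segment a b"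
  unfolding closed_segment_def by (auto intro!: exI[of _ s] simp: algebra_simps)

text \<open>Parametrize the line by \<open>a + s *\<^sub>R (b - a)\<close>. The half-plane at
  \<open>a\<close> forces \<open>0 \<le> s\<close>, the one at \<open>b\<close> forces
  \<open>s \<le> 1\<close>.\<close>

lemma line_wedge:
  assumes "orient a b z = 0" "0 < det2 \<alpha> (b - a)" "0 < det2 \<beta> (a - b)"
    and "0 \<le> det2 \<alpha> (z - a)" "0 \<le> det2 \<beta> (z - b)"
  shows "z \<in> closed_segment a b"
proof -
  have "a \<noteq> b" using assms(2) by auto
  then obtain s where s: "z = a + s *\<^sub>R (b - a)" using assms(1) orient_eq_0_iff by blast
  have "0 \<le> s * det2 \<alpha> (b - a)" using assms(4) unfolding s by simp
  then have "0 \<le> s" using assms(2) by (simp add: zero_le_mult_iff)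
  have e: "z - b = (1 - s) *\<^sub>R (a - b)" unfolding s by (simp add: algebra_simps)
  have "0 \<le> (1 - s) * det2 \<beta> (a - b)" using assms(5) unfolding e by simp
  then have "s \<le> 1" using assms(3) by (simp add: zero_le_mult_iff)
  with \<open>0 \<le> s\<close> show ?thesis unfolding s by (rule in_segment_param)
qed

text \<open>The two lines through \<open>a\<close> and \<open>b\<close> keep every segment from \<open>X\<close> to \<open>Y\<close> inside the common
  chord, which makes the union convex.\<close>

lemma convex_glue:
  assumes X: "convex X" and Y: "convex Y"
    and sX: "closed_segment a b \<subseteq> X" and sY: "closed_segment a b \<subseteq> Y"
    and oX: "\<And>x. x \<in> X \<Longrightarrow> 0 \<le> orient a b x" and oY: "\<And>y. y \<in> Y \<Longrightarrow> orient a b y \<le> 0"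
    and \<alpha>: "0 < det2 \<alpha> (b - a)" "\<And>z. z \<in> X \<union> Y \<Longrightarrow> 0 \<le> det2 \<alpha> (z - a)"
    and \<beta>: "0 < det2 \<beta> (a - b)" "\<And>z. z \<in> X \<union> Y \<Longrightarrow> 0 \<le> det2 \<beta> (z - b)"
  shows "convex (X \<union> Y)" "X \<inter> Y = closed_segment a b"
proof -
  show "X \<inter> Y = closed_segment a b"
  proof
    show "X \<inter> Y \<subseteq> closed_segment a b"
      using oX oY \<alpha> \<beta> line_wedge[of a b _ \<alpha> \<beta>] by (metis IntE UnI1 antisym subsetI)
  qed (use sX sY in auto)
  have seg: "closed_segment x y \<subseteq> X \<union> Y" if x: "x \<in> X" and y: "y \<in> Y" for x y
  proof -
    let ?f = "orient a b"
    define u where "u = (if ?f x = ?f y then 0 else ?f x / (?f x - ?f y))"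
    have fx: "?f x \<ge> 0" "?f y \<le> 0" using oX oY x y by auto
    have u: "0 \<le> u" "u \<le> 1" "(1-u) * ?f x + u * ?f y = 0"
      using fx by (auto simp: u_def field_simps)
    define z where "z = (1-u) *\<^sub>R x + u *\<^sub>R y"
    have "z \<in> closed_segment a b"
    proof (rule line_wedge)
      show "?f z = 0" unfolding z_def using u(3) orient_affine[of "1-u" u] by simp
      have e: "z - c = (1-u) *\<^sub>R (x - c) + u *\<^sub>R (y - c)" for c unfolding z_def by (simp add: algebra_simps)
      show "0 \<le> det2 \<alpha> (z - a)" "0 \<le> det2 \<beta> (z - b)"
        unfolding e det2_simps using \<alpha>(2) \<beta>(2) x y u by auto
    qed (use \<alpha> \<beta> in auto)
    then have "z \<in> X" "z \<in> Y" using sX sY by auto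
    moreover have "z \<in> closed_segment x y" unfolding z_def using u by (auto simp: closed_segment_def)
    ultimately have "closed_segment x z \<subseteq> X" "closed_segment z y \<subseteq> Y"
        "closed_segment x y = closed_segment x z \<union> closed_segment z y"
      using X Y x y by (auto simp: closed_segment_subset Un_closed_segment)
    then show ?thesis by blast
  qed
  show "convex (X \<union> Y)"
    unfolding convex_contains_segment
  proof (intro ballI)
    fix x y assume "x \<in> X \<union> Y" "y \<in> X \<union> Y"
    then consider "x \<in> X" "y \<in> X" | "x \<in> Y" "y \<in> Y" | "x \<in> X" "y \<in> Y" | "x \<in> Y" "y \<in> X" by blast
    then show "closed_segment x y \<subseteq> X \<union> Y"
    proof cases
      case 1 then show ?thesis using closed_segment_subset[OF _ _ X] by blast
    next
      case 2 then show ?thesis using closed_segment_subset[OF _ _ Y] by blast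
    next
      case 3 then show ?thesis by (rule seg)
    next
      case 4 then show ?thesis using seg[of y x] by (simp add: closed_segment_commute)
    qed
  qed
qed

section \<open>Area and perimeter of glued sets\<close>

lemma negligible_segment: "negligible (closed_segment a (b::complex))"
proof (rule negligible_convex_interior[THEN iffD2])
  show "interior (closed_segment a b) = {}" by (simp add: interior_closed_segment_ge2)
qed simp

lemma area_glue:
  assumes "compact X" "compact Y" "X \<inter> Y = closed_segment a b"
  shows "area (X \<union> Y) = area X + area Y"
  unfolding area_def using assms negligible_imp_measure0[OF negligible_segment[of a b]] measure_Un3[of X lebesgue Y]
  by (simp add: lmeasurable_compact)

lemma area_mono: "compact X \<Longrightarrow> compact Y \<Longrightarrow> X \<subseteq> Y \<Longrightarrow> area X \<le> area Y"
  unfolding area_def by (intro measure_mono_fmeasurable) (auto simp: lmeasurable_compact fmeasurableD)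

lemma mw_glue:
  assumes "compact X" "compact Y" "convex (X \<union> Y)" "X \<inter> Y = closed_segment a b"
  shows "mw (X \<union> Y) = mw X + mw Y - 2 * dist a b"
proof -
  have "X \<noteq> {}" "Y \<noteq> {}" using assms(4) by auto
  from mw_valuation[OF assms(1,2) this assms(3)] show ?thesis
    unfolding assms(4) mw_segment by simp
qed

text \<open>Identifies Lebesgue measure on the complex plane with that on \<open>real^2\<close>,
  where \<open>content_triangle\<close> gives the area of a triangle. Comparing the two on boxes
  suffices.\<close>

lemma lborel_complex: "lborel = distr lborel borel (\<lambda>v::real^2. Complex (v$1) (v$2))" (is "_ = distr _ _ ?f")
proof (rule lborel_eqI)
  have [measurable]: "?f \<in> borel \<rightarrow>\<^sub>M borel"
    unfolding Complex_eq by (intro borel_measurable_continuous_onI continuous_intros)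
  show "sets (distr lborel borel ?f) = sets borel" by simp
  fix l u :: complex assume lu: "\<And>b. b \<in> Basis \<Longrightarrow> l \<bullet> b \<le> u \<bullet> b"
  have le: "Re l \<le> Re u" "Im l \<le> Im u" using lu[of 1] lu[of \<i>] by (auto simp: Basis_complex_def)
  define l' u' where "l' = (vector [Re l, Im l] :: real^2)" and "u' = (vector [Re u, Im u] :: real^2)"
  have b2: "(Basis :: (real^2) set) = {axis 1 1, axis 2 1}"
    by (auto simp: Basis_vec_def UNIV_2)
  have "?f -` box l u = box l' u'"
    by (auto simp: mem_box b2 Basis_complex_def l'_def u'_def inner_axis)
  then have "emeasure (distr lborel borel ?f) (box l u) = emeasure lborel (box l' u')"
    by (subst emeasure_distr) auto
  also have "\<dots> = (\<Prod>b\<in>Basis. (u' - l') \<bullet> b)"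
    using le by (intro emeasure_lborel_box) (auto simp: b2 l'_def u'_def inner_axis)
  also have "(\<Prod>b\<in>Basis. (u' - l') \<bullet> b) = (Re u - Re l) * (Im u - Im l)"
    by (simp add: b2 l'_def u'_def inner_axis axis_eq_axis)
  also have "\<dots> = (\<Prod>b\<in>Basis. (u - l) \<bullet> b)" by (simp add: Basis_complex_def)
  finally show "emeasure (distr lborel borel ?f) (box l u) = ennreal (\<Prod>b\<in>Basis. (u - l) \<bullet> b)" .
qed

lemma area_triangle: "area (convex hull {a,b,c}) = \<bar>orient a b c\<bar> / 2"
proof -
  let ?f = "\<lambda>v::real^2. Complex (v$1) (v$2)"
  let ?g = "\<lambda>z::complex. vector [Re z, Im z] :: real^2"
  have lin: "linear ?f" by (intro linearI) (auto simp: complex_eq_iff)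
  have gf: "?f (?g z) = z" "?g (?f v) = v" for z v by (auto simp: vec_eq_iff forall_2)
  have [measurable]: "?f \<in> borel \<rightarrow>\<^sub>M borel"
    unfolding Complex_eq by (intro borel_measurable_continuous_onI continuous_intros)
  have cl: "compact (convex hull {a,b,c})" by (intro finite_imp_compact_convex_hull) auto
  have "area (convex hull {a,b,c}) = measure lborel (convex hull {a,b,c})"
    unfolding area_def using cl by (intro measure_completion) (auto dest: compact_imp_closed)
  also have "\<dots> = measure lborel (?f -` (convex hull {a,b,c}))"
    using cl by (subst lborel_complex, subst measure_distr) (auto dest: compact_imp_closed)
  also have "?f -` (convex hull {a,b,c}) = convex hull {?g a, ?g b, ?g c}"
  proof -
    have "?f ` (convex hull {?g a, ?g b, ?g c}) = convex hull {a,b,c}"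
      using convex_hull_linear_image[OF lin, of "{?g a, ?g b, ?g c}"] by (simp add: gf)
    moreover have "inj ?f" by (rule injI) (metis gf(2))
    then have "?f -` (?f ` (convex hull {?g a, ?g b, ?g c})) = convex hull {?g a, ?g b, ?g c}"
      by (rule inj_vimage_image_eq)
    ultimately show ?thesis by argo
  qed
  also have "measure lborel (convex hull {?g a, ?g b, ?g c}) = \<bar>orient a b c\<bar> / 2"
  proof (subst content_triangle)
    have "(Re c - Re a) * (Im b - Im a) - (Re b - Re a) * (Im c - Im a) = - orient a b c"
      by (simp add: orient_simps algebra_simps)
    then show "\<bar>(?g c $ 1 - ?g a $ 1) * (?g b $ 2 - ?g a $ 2) - (?g b $ 1 - ?g a $ 1) * (?g c $ 2 - ?g a $ 2)\<bar> / 2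
      = \<bar>orient a b c\<bar> / 2" by simp
  qed
  finally show ?thesis .
qed

lemma convex_hull_triangle_subset:
  assumes "a \<in> {x. c \<le> det2 \<alpha> (x - p)}" "q \<in> {x. c \<le> det2 \<alpha> (x - p)}" "b \<in> {x. c \<le> det2 \<alpha> (x - p)}"
  shows "convex hull {a,q,b} \<subseteq> {x. c \<le> det2 \<alpha> (x - p)}"
  using assms by (intro convex_hull_subset_det2) auto

text \<open>\<open>X\<close> and the apex \<open>q\<close> lie on opposite sides of the chord
  \<open>a b\<close> and both in the wedge of the support directions \<open>\<alpha>\<close> and
  \<open>\<beta>\<close>, so by \<open>convex_glue\<close> the union of \<open>X\<close> with the
  triangle is already convex. Two sides then replace the chord, which counts twice in
  \<open>mw_glue\<close> and once in the triangle.\<close>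

lemma triangle_glue:
  assumes X: "compact X" "convex X" "a \<in> X" "b \<in> X"
    and oX: "\<And>x. x \<in> X \<Longrightarrow> 0 \<le> orient a b x" and q: "orient a b q \<le> 0"
    and \<alpha>: "0 < det2 \<alpha> (b - a)" "\<And>x. x \<in> X \<Longrightarrow> 0 \<le> det2 \<alpha> (x - a)" "0 \<le> det2 \<alpha> (q - a)"
    and \<beta>: "0 < det2 \<beta> (a - b)" "\<And>x. x \<in> X \<Longrightarrow> 0 \<le> det2 \<beta> (x - b)" "0 \<le> det2 \<beta> (q - b)"
  shows "convex hull (insert q X) = X \<union> convex hull {a,q,b}" 
    and "mw (convex hull (insert q X)) = mw X + dist a q + dist q b - dist a b"
    and "area (convex hull (insert q X)) = area X + \<bar>orient a b q\<bar> / 2"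
proof -
  let ?Y = "convex hull {a,q,b}"
  have cY: "compact ?Y" by (intro finite_imp_compact_convex_hull) auto
  have s: "closed_segment a b \<subseteq> X" "closed_segment a b \<subseteq> ?Y"
    using X by (simp_all add: closed_segment_subset hull_inc)
  have oY: "?Y \<subseteq> {x. orient a b x \<le> 0}" using q by (intro hull_minimal convex_orient_le) auto
  have Y1: "?Y \<subseteq> {x. 0 \<le> det2 \<alpha> (x - a)}" and Y2: "?Y \<subseteq> {x. 0 \<le> det2 \<beta> (x - b)}"
    using \<alpha> \<beta> by (intro convex_hull_triangle_subset; simp)+
  have cvx: "convex (X \<union> ?Y)" and int: "X \<inter> ?Y = closed_segment a b"
  proof -
    have 1: "0 \<le> det2 \<alpha> (z - a)" if "z \<in> X \<union> ?Y" for z using that Y1 \<alpha>(2) by blast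
    have 2: "0 \<le> det2 \<beta> (z - b)" if "z \<in> X \<union> ?Y" for z using that Y2 \<beta>(2) by blast
    have 3: "orient a b y \<le> 0" if "y \<in> ?Y" for y using that oY by blast
    note g = convex_glue[OF X(2) convex_convex_hull s oX 3 \<alpha>(1) 1 \<beta>(1) 2]
    show "convex (X \<union> ?Y)" "X \<inter> ?Y = closed_segment a b" by (rule g; assumption)+
  qed
  show e: "convex hull (insert q X) = X \<union> ?Y"
  proof
    show "convex hull (insert q X) \<subseteq> X \<union> ?Y"
      using cvx by (intro hull_minimal) (auto intro: hull_inc)
    show "X \<union> ?Y \<subseteq> convex hull (insert q X)"
      using X hull_mono[of "{a,q,b}" "insert q X" convex] hull_subset[of "insert q X" convex] by blast
  qed
  show "mw (convex hull (insert q X)) = mw X + dist a q + dist q b - dist a b"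
    unfolding e mw_glue[OF X(1) cY cvx int] mw_triangle by (simp add: dist_commute)
  show "area (convex hull (insert q X)) = area X + \<bar>orient a b q\<bar> / 2"
    unfolding e area_glue[OF X(1) cY int] area_triangle
    by (simp add: orient_swap_right[of a q b])
qed

section \<open>Convex polygons as cyclic sequences of vertices\<close>

text \<open>Cramer's rule: the areas of the three subtriangles at \<open>x\<close> are its
  unnormalized barycentric coordinates.\<close>

lemma orient_barycentric:
  "orient a b c *\<^sub>R x = orient x b c *\<^sub>R a + orient a x c *\<^sub>R b + orient a b x *\<^sub>R c"
  "orient a b c = orient x b c + orient a x c + orient a b x"
  by (simp_all add: complex_eq_iff orient_simps algebra_simps)

lemma in_triangleI:
  assumes "0 < orient a b c" "0 \<le> orient x b c" "0 \<le> orient a x c" "0 \<le> orient a b x"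
  shows "x \<in> convex hull {a,b,c}"
proof -
  let ?S = "orient a b c"
  have "x = (1 / ?S) *\<^sub>R (?S *\<^sub>R x)" using assms(1) by simp
  also have "\<dots> = (orient x b c / ?S) *\<^sub>R a + (orient a x c / ?S) *\<^sub>R b + (orient a b x / ?S) *\<^sub>R c"
    unfolding orient_barycentric(1)[of a b c x] by (simp add: scaleR_add_right)
  finally have "x = (orient x b c / ?S) *\<^sub>R a + (orient a x c / ?S) *\<^sub>R b + (orient a b x / ?S) *\<^sub>R c" .
  moreover have "orient x b c / ?S + orient a x c / ?S + orient a b x / ?S = 1"
    using assms(1) orient_barycentric(2)[of a b c x, symmetric] by (simp flip: add_divide_distrib)
  ultimately show ?thesis unfolding convex_hull_3
    using assms by (intro CollectI exI[of _ "orient x b c / ?S"] exI[of _ "orient a x c / ?S"] exI[of _ "orient a b x / ?S"]) auto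
qed

text \<open>Four points in the plane satisfy one affine relation, whose coefficients are triangle
  areas (\<open>id\<close>). Here all of them are positive; dividing by \<open>S\<close>, twice the
  area of the quadrilateral, turns both sides into convex combinations of opposite vertices.\<close>

lemma diagonals_cross:
  assumes "0 < orient a b c" "0 < orient a c d" "0 < orient a b d" "0 < orient b c d"
  obtains z where "z \<in> open_segment b d" "z \<in> closed_segment a c"
proof -
  define S where "S = orient a b d + orient b c d"
  have S: "S = orient a b c + orient a c d" "S > 0" using assms by (auto simp: S_def orient_simps algebra_simps)
  define u where "u = orient b c d / S" define t where "t = orient a b c / S"
  have id: "orient b c d *\<^sub>R a + orient a b d *\<^sub>R c = orient a c d *\<^sub>R b + orient a b c *\<^sub>R d"
    by (simp add: complex_eq_iff orient_simps algebra_simps)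
  have u: "0 < u" "u < 1" "1 - u = orient a b d / S" using assms S(2) by (auto simp: u_def S_def field_simps)
  have t: "0 < t" "t < 1" "1 - t = orient a c d / S" using assms S by (auto simp: t_def field_simps)
  have eq: "u *\<^sub>R a + (1 - u) *\<^sub>R c = (1 - t) *\<^sub>R b + t *\<^sub>R d"
    unfolding u(3) t(3) unfolding u_def t_def using arg_cong[OF id, of "\<lambda>z. (1/S) *\<^sub>R z"]
    by (simp add: scaleR_add_right)
  have "b \<noteq> d" using assms(4) by auto
  then have "(1 - t) *\<^sub>R b + t *\<^sub>R d \<in> open_segment b d" using t by (auto simp: in_segment)
  moreover have "(1 - t) *\<^sub>R b + t *\<^sub>R d \<in> closed_segment a c"
    unfolding eq[symmetric] closed_segment_def using u by (auto intro!: exI[of _ "1-u"])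
  ultimately show ?thesis by (rule that)
qed

lemma collinear_orient_0:
  assumes "collinear S" "a \<in> S" "b \<in> S" "c \<in> S"
  shows "orient a b c = 0"
proof -
  obtain u where u: "\<And>x y. x \<in> S \<Longrightarrow> y \<in> S \<Longrightarrow> \<exists>c. x - y = c *\<^sub>R u"
    using assms(1) unfolding collinear_def by blast
  obtain r s where "b - a = r *\<^sub>R u" "c - a = s *\<^sub>R u" using u assms by meson
  then show ?thesis unfolding orient_def by simp
qed

text \<open>All increasing triples are required to turn left, not only consecutive ones: the latter
  would also admit star polygons that wind around more than once.\<close>

definition cpoly :: "nat \<Rightarrow> (nat \<Rightarrow> complex) \<Rightarrow> bool" where
  "cpoly n v \<longleftrightarrow> 3 \<le> n \<and> (\<forall>i j k. i < j \<and> j < k \<and> k < n \<longrightarrow> 0 < orient (v i) (v j) (v k))"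

lemma cpolyD: "cpoly n v \<Longrightarrow> i < j \<Longrightarrow> j < k \<Longrightarrow> k < n \<Longrightarrow> 0 < orient (v i) (v j) (v k)"
  unfolding cpoly_def by blast

lemma hull_insert_hull: "convex hull (insert q (convex hull V)) = convex hull (insert q V)"
  using hull_Un_right[of convex "{q}" V] by simp

text \<open>A fan from \<open>v 0\<close>: each new vertex attaches the triangle over the chord from
  \<open>v r\<close> to \<open>v 0\<close>. The support directions for \<open>triangle_glue\<close>
  are the two new sides, and the last chord closes the prefix to a polygon.\<close>

lemma cpoly_prefix:
  assumes "cpoly n v" "1 \<le> r" "r < n"
  shows "mw (convex hull (v ` {..r})) = (\<Sum>i<r. dist (v i) (v (Suc i))) + dist (v r) (v 0)
    \<and> area (convex hull (v ` {..r})) = ((\<Sum>i<r. det2 (v i) (v (Suc i))) + det2 (v r) (v 0)) / 2"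
  using assms(2,3)
proof (induction r rule: dec_induct)
  case base
  \<comment> \<open>The prefix with two vertices is a segment run out and back: its length counts
    twice and the two determinants cancel.\<close>
  have "v ` {..1} = {v 0, v 1}" by (auto simp: le_Suc_eq)
  then have e: "convex hull (v ` {..1}) = closed_segment (v 0) (v 1)" by (simp only: segment_convex_hull)
  have "area (closed_segment (v 0) (v 1)) = 0"
    unfolding area_def using negligible_imp_measure0[OF negligible_segment] by blast
  then show ?case using det2_swap[of "v 0" "v 1"]
    unfolding e by (simp add: mw_segment dist_commute)
next
  case (step r)
  note o = cpolyD[OF assms(1)]
  let ?V = "v ` {..r}" and ?q = "v (Suc r)"
  let ?X = "convex hull ?V"
  have r: "1 \<le> r" "Suc r < n" using step by auto
  have IH: "mw ?X = (\<Sum>i<r. dist (v i) (v (Suc i))) + dist (v r) (v 0)"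
     "area ?X = ((\<Sum>i<r. det2 (v i) (v (Suc i))) + det2 (v r) (v 0)) / 2" using step by auto
  have pos: "0 < orient (v 0) (v r) ?q" using o[of 0 r "Suc r"] r by simp
  have H1: "?X \<subseteq> {x. 0 \<le> det2 (v 0 - v r) (x - v r)}"
  proof (rule convex_hull_subset_det2, clarify)
    fix i assume "i \<le> r"
    then have "i = 0 \<or> i = r \<or> 0 < orient (v 0) (v i) (v r)"
      using o[of 0 i r] r by (cases "i = 0"; cases "i = r") auto
    then show "0 \<le> det2 (v 0 - v r) (v i - v r)"
      using orient_cyclic[of "v r" "v 0" "v i"] unfolding orient_def by fastforce
  qed
  have H2: "?X \<subseteq> {x. 0 \<le> det2 (?q - v r) (x - v r)}"
  proof (rule convex_hull_subset_det2, clarify)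
    fix i assume "i \<le> r"
    then have "i = r \<or> 0 < orient (v i) (v r) ?q" using o[of i r "Suc r"] r by (cases "i = r") auto
    then show "0 \<le> det2 (?q - v r) (v i - v r)"
      using orient_cyclic[of "v i" "v r" ?q] unfolding orient_def by fastforce
  qed
  have H3: "?X \<subseteq> {x. 0 \<le> det2 (v 0 - ?q) (x - v 0)}"
  proof (rule convex_hull_subset_det2, clarify)
    fix i assume "i \<le> r"
    then have "i = 0 \<or> 0 < orient (v 0) (v i) ?q" using o[of 0 i "Suc r"] r by auto
    moreover have "orient (v 0) (v i) ?q = det2 (v 0 - ?q) (v i - v 0)"
      by (simp add: orient_simps algebra_simps)
    ultimately show "0 \<le> det2 (v 0 - ?q) (v i - v 0)" by fastforce
  qed
  have e: "convex hull (v ` {..Suc r}) = convex hull (insert ?q ?X)"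
    unfolding hull_insert_hull by (simp add: atMost_Suc)
  have in_X: "v r \<in> ?X" "v 0 \<in> ?X" by (auto intro: hull_inc)
  have id: "orient (v r) (v 0) ?q = - orient (v 0) (v r) ?q"
    "det2 (?q - v r) (v 0 - v r) = orient (v 0) (v r) ?q"
    "det2 (v 0 - ?q) (v r - v 0) = orient (v 0) (v r) ?q"
    "det2 (v 0 - ?q) (?q - v 0) = 0"
    "orient (v 0) (v r) ?q = det2 (v 0) (v r) + det2 (v r) ?q + det2 ?q (v 0)"
    by (simp_all add: orient_simps algebra_simps)
  have c: "compact ?X" by (intro finite_imp_compact_convex_hull) auto
  have 1: "0 \<le> orient (v r) (v 0) x" if "x \<in> ?X" for x using H1 that unfolding orient_def by blast
  have 2: "0 \<le> det2 (?q - v r) (x - v r)" if "x \<in> ?X" for x using H2 that by blast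
  have 3: "0 \<le> det2 (v 0 - ?q) (x - v 0)" if "x \<in> ?X" for x using H3 that by blast
  have q0: "orient (v r) (v 0) ?q \<le> 0" using pos id by linarith
  have p1: "0 < det2 (?q - v r) (v 0 - v r)" "0 \<le> det2 (?q - v r) (?q - v r)" using pos id by auto
  have p2: "0 < det2 (v 0 - ?q) (v r - v 0)" "0 \<le> det2 (v 0 - ?q) (?q - v 0)" using pos id by linarith+
  have g: "mw (convex hull (insert ?q ?X)) = mw ?X + dist (v r) ?q + dist ?q (v 0) - dist (v r) (v 0)"
    "area (convex hull (insert ?q ?X)) = area ?X + \<bar>orient (v r) (v 0) ?q\<bar> / 2"
    by (rule triangle_glue[OF c convex_convex_hull in_X 1 q0 p1(1) 2 p1(2) p2(1) 3 p2(2)]; assumption)+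
  show ?case
    unfolding e g IH using pos id(1,5) det2_swap[of "v 0" "v r"] by (simp add: field_simps)
qed

lemma diameter_segment: "diameter (closed_segment a b) = dist a b" for a b :: complex
proof (rule antisym)
  show "diameter (closed_segment a b) \<le> dist a b"
  proof (rule diameter_le)
    fix x y assume "x \<in> closed_segment a b" "y \<in> closed_segment a b"
    then obtain s t where st: "0 \<le> s" "s \<le> 1" "x = (1 - s) *\<^sub>R a + s *\<^sub>R b"
        "0 \<le> t" "t \<le> 1" "y = (1 - t) *\<^sub>R a + t *\<^sub>R b"
      by (auto simp: closed_segment_def)
    have "x - y = (t - s) *\<^sub>R (a - b)" unfolding st by (simp add: algebra_simps)
    then have "norm (x - y) = \<bar>t - s\<bar> * dist a b" by (simp add: dist_norm)
    also have "\<dots> \<le> 1 * dist a b" using st by (intro mult_right_mono) auto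
    finally show "norm (x - y) \<le> dist a b" by simp
  qed simp
  show "dist a b \<le> diameter (closed_segment a b)"
    by (rule diameter_bounded_bound) (auto intro: compact_imp_bounded)
qed

locale convex_cycle =
  fixes n :: nat and v :: "nat \<Rightarrow> complex" and P
  assumes cp: "cpoly n v" and P_def: "P = convex hull (v ` {..<n})"
begin

abbreviation nxt :: "nat \<Rightarrow> nat" where "nxt i \<equiv> Suc i mod n"

lemma n3: "3 \<le> n" using cp by (simp add: cpoly_def)

lemma nxt_cases: "i < n \<Longrightarrow> (Suc i < n \<and> nxt i = Suc i) \<or> (Suc i = n \<and> nxt i = 0)"
  by (cases "Suc i = n") auto

lemma nxt_less: "i < n \<Longrightarrow> nxt i < n" and nxt_neq: "i < n \<Longrightarrow> nxt i \<noteq> i"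
  using nxt_cases[of i] n3 by auto

lemma left_of_side:
  assumes "i < n" "k < n" "k \<noteq> i" "k \<noteq> nxt i"
  shows "0 < orient (v i) (v (nxt i)) (v k)"
proof (cases "Suc i < n")
  case True
  then have "k < i \<or> Suc i < k" "nxt i = Suc i" using assms by auto
  then show ?thesis
    using cpolyD[OF cp, of k i "Suc i"] cpolyD[OF cp, of i "Suc i" k] assms True
      orient_cyclic[of "v k" "v i" "v (Suc i)"] by auto
next
  case False
  then have i: "Suc i = n" "nxt i = 0" using nxt_cases[OF assms(1)] by auto
  then have "0 < orient (v 0) (v k) (v i)" using cpolyD[OF cp, of 0 k i] assms by auto
  then show ?thesis using i orient_cyclic[of "v i" "v 0" "v k"] by simp
qed

lemma left_of_side_le:
  assumes "i < n" "x \<in> P" shows "0 \<le> orient (v i) (v (nxt i)) x"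
proof -
  have "0 \<le> orient (v i) (v (nxt i)) (v k)" if "k < n" for k
    using left_of_side[OF assms(1) that] by fastforce
  then have "P \<subseteq> {x. 0 \<le> orient (v i) (v (nxt i)) x}"
    unfolding P_def by (intro hull_minimal convex_orient_ge) auto
  with assms show ?thesis by blast
qed

lemma inj: "inj_on v {..<n}"
proof (rule linorder_inj_onI)
  fix i j assume "i < j" "i \<in> {..<n}" "j \<in> {..<n}"
  then show "v i \<noteq> v j"
  \<comment> \<open>The triple needs a third index: one between \<open>i\<close> and
    \<open>j\<close>, one after \<open>j\<close>, or \<open>0\<close> when \<open>i\<close> and
    \<open>j\<close> are the last two.\<close>
  proof (cases "Suc i < j \<or> Suc j < n")
    case True
    then show ?thesis using cpolyD[OF cp, of i "Suc i" j] cpolyD[OF cp, of i j "Suc j"] \<open>i < j\<close> \<open>j \<in> {..<n}\<close> by auto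
  next
    case False
    then have "0 < i" using \<open>i < j\<close> n3 \<open>j \<in> {..<n}\<close> by auto
    then show ?thesis using cpolyD[OF cp, of 0 i j] \<open>i < j\<close> \<open>j \<in> {..<n}\<close> by auto
  qed
qed auto

lemma neq_nxt: "i < n \<Longrightarrow> v i \<noteq> v (nxt i)"
  using inj nxt_less nxt_neq by (metis inj_onD lessThan_iff)

text \<open>The line through the side supports \<open>P\<close>, so it cuts out a face. All other
  vertices lie strictly to its left, hence the face is spanned by the two ends.\<close>

lemma side_edge:
  assumes i: "i < n"
  shows "closed_segment (v i) (v (nxt i)) edge_of P"
proof -
  let ?a = "\<i> * (v (nxt i) - v i)"
  have o: "orient (v i) (v (nxt i)) x = ?a \<bullet> x - ?a \<bullet> v i" for x
    by (simp add: orient_def det2_eq_inner inner_diff_right)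
  let ?F = "P \<inter> {x. ?a \<bullet> x = ?a \<bullet> v i}"
  have F: "?F face_of P"
    using left_of_side_le[OF i] by (intro face_of_Int_supporting_hyperplane_ge) (auto simp: o P_def)
  then obtain S where S: "S \<subseteq> v ` {..<n}" "?F = convex hull S"
    using face_of_convex_hull_subset[of "v ` {..<n}"] unfolding P_def
    by (metis finite_imageI finite_imp_compact finite_lessThan)
  have "S \<subseteq> {v i, v (nxt i)}"
  proof
    fix x assume x: "x \<in> S"
    then obtain k where k: "k < n" "x = v k" using S by auto
    have "x \<in> ?F" using x S hull_inc by metis
    then have "orient (v i) (v (nxt i)) x = 0" by (simp add: o)
    then show "x \<in> {v i, v (nxt i)}" using left_of_side[OF i k(1)] k(2) by fastforce
  qed
  then have "?F \<subseteq> closed_segment (v i) (v (nxt i))"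
    unfolding S(2) segment_convex_hull by (rule hull_mono)
  moreover have "v i \<in> ?F" "v (nxt i) \<in> ?F"
    using i nxt_less[OF i] o[of "v (nxt i)"] by (auto simp: P_def hull_inc)
  then have "closed_segment (v i) (v (nxt i)) \<subseteq> ?F"
    using face_of_imp_convex[OF F] by (simp only: closed_segment_subset)
  ultimately have "?F = closed_segment (v i) (v (nxt i))" by blast
  moreover have "aff_dim (closed_segment (v i) (v (nxt i))) = 1"
    using neq_nxt[OF i] by (simp add: segment_convex_hull aff_dim_convex_hull)
  ultimately show ?thesis using F by (simp add: edge_of_def)
qed

text \<open>An edge contains exactly two vertices, as no three are collinear. If they were not
  neighbours, there would be a vertex \<open>k\<close> between them and a vertex \<open>l\<close>
  outside; the diagonal from \<open>k\<close> to \<open>l\<close> crosses the edge, and the face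
  property would put \<open>v k\<close> on it as a third vertex.\<close>

lemma edge_side:
  assumes e: "e edge_of P"
  shows "\<exists>i<n. e = closed_segment (v i) (v (nxt i))"
proof -
  have F: "e face_of P" and d: "aff_dim e = 1" using e by (auto simp: edge_of_def)
  then obtain S where S: "S \<subseteq> v ` {..<n}" "e = convex hull S"
    using face_of_convex_hull_subset[of "v ` {..<n}"] unfolding P_def
    by (metis finite_imageI finite_imp_compact finite_lessThan)
  have col: "collinear e" using d by (simp add: collinear_aff_dim)
  have noncol: False if "x < y" "y < z" "z < n" "v x \<in> e" "v y \<in> e" "v z \<in> e" for x y z
    using cpolyD[OF cp that(1-3)] collinear_orient_0[OF col that(4-6)] by simp
  have "\<not> (\<exists>x. S \<subseteq> {x})"
  proof
    assume "\<exists>x. S \<subseteq> {x}"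
    then obtain x where "S \<subseteq> {x}" by blast
    then have "aff_dim S \<le> 0" using aff_dim_subset[of S "{x}"] by simp
    then show False using d S(2) by (simp add: aff_dim_convex_hull)
  qed
  then obtain x y where xy: "x \<in> S" "y \<in> S" "x \<noteq> y" by blast
  then obtain i0 j0 where ij0: "i0 < n" "j0 < n" "x = v i0" "y = v j0" using S(1) by blast
  obtain i j where ij: "i < j" "j < n" "v i \<in> S" "v j \<in> S"
    using that[of i0 j0] that[of j0 i0] xy ij0 by (metis linorder_neqE_nat)
  have ve: "v i \<in> e" "v j \<in> e" using ij S by (auto intro: hull_inc)
  have two: "S = {v i, v j}"
  proof (rule ccontr)
    assume "S \<noteq> {v i, v j}"
    then obtain k where k: "k < n" "v k \<in> S" "k \<noteq> i" "k \<noteq> j" using S ij by blast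
    have "v k \<in> e" using k S by (auto intro: hull_inc)
    consider "k < i" | "i < k" "k < j" | "j < k" using k by linarith
    then show False using noncol[of k i j] noncol[of i k j] noncol[of i j k] ij k ve \<open>v k \<in> e\<close> by cases auto
  qed
  have seg: "e = closed_segment (v i) (v j)" using S two by (simp add: segment_convex_hull)
  have "j = Suc i \<or> (i = 0 \<and> Suc j = n)"
  proof (rule ccontr)
    assume "\<not> ?thesis"
    then have "Suc i < j" and l: "0 < i \<or> Suc j < n" using ij by auto
    define k where "k = Suc i"
    have k: "i < k" "k < j" using \<open>Suc i < j\<close> k_def by auto
    obtain l where l: "l < n" "l < i \<or> j < l" using l ij by (metis Suc_lessD lessI less_trans)
    obtain z where z: "z \<in> open_segment (v k) (v l)" "z \<in> closed_segment (v i) (v j)"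
    proof (cases "l < i")
      case True
      show ?thesis
        by (rule diagonals_cross[of "v i" "v k" "v j" "v l"])
          (use True k ij cpolyD[OF cp, of i k j] cpolyD[OF cp, of l i j] cpolyD[OF cp, of l i k] cpolyD[OF cp, of l k j]
            orient_cyclic[of "v l"] that in auto)
    next
      case False
      show ?thesis
        by (rule diagonals_cross[of "v i" "v k" "v j" "v l"])
          (use False l k ij cpolyD[OF cp, of i k j] cpolyD[OF cp, of i j l] cpolyD[OF cp, of i k l] cpolyD[OF cp, of k j l]
            that in auto)
    qed
    have "v k \<in> P" using k ij unfolding P_def by (auto intro: hull_inc)
    moreover have "v l \<in> P" using l unfolding P_def by (auto intro: hull_inc)
    ultimately have "v k \<in> e" using F z seg unfolding face_of_def by blast
    then show False using noncol[OF k ij(2)] ve by blast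
  qed
  then show ?thesis
  proof
    assume "j = Suc i"
    then show ?thesis using ij seg by (intro exI[of _ i]) auto
  next
    assume "i = 0 \<and> Suc j = n"
    then show ?thesis using ij seg by (intro exI[of _ j]) (auto simp: closed_segment_commute)
  qed
qed

lemma sides_eq: "sides P = (\<lambda>i. closed_segment (v i) (v (nxt i))) ` {..<n}"
  unfolding sides_def using side_edge edge_side by auto

lemma inj_sides: "inj_on (\<lambda>i. closed_segment (v i) (v (nxt i))) {..<n}"
proof (rule inj_onI)
  fix i j assume ij: "i \<in> {..<n}" "j \<in> {..<n}" "closed_segment (v i) (v (nxt i)) = closed_segment (v j) (v (nxt j))"
  then have "{v i, v (nxt i)} = {v j, v (nxt j)}" by (simp add: closed_segment_eq)
  then have "v ` {i, nxt i} = v ` {j, nxt j}" by simp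
  then have "{i, nxt i} = {j, nxt j}"
    using inj_on_image_eq_iff[OF inj, of "{i, nxt i}" "{j, nxt j}"] ij nxt_less[of i] nxt_less[of j] by auto
  then have "i = j \<or> (i = nxt j \<and> j = nxt i)" by (metis doubleton_eq_iff)
  moreover have False if "i = nxt j" "j = nxt i"
  proof -
    have "(Suc i < n \<and> j = Suc i) \<or> (Suc i = n \<and> j = 0)" using nxt_cases[of i] ij(1) that(2) by (metis lessThan_iff)
    moreover have "(Suc j < n \<and> i = Suc j) \<or> (Suc j = n \<and> i = 0)" using nxt_cases[of j] ij(2) that(1) by (metis lessThan_iff)
    ultimately show False using n3 by auto
  qed
  ultimately show "i = j" by blast
qed

lemma card_sides: "card (sides P) = n"
  unfolding sides_eq using card_image[OF inj_sides] by simp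

lemma mset_sides: "mset_set (sides P) = image_mset (\<lambda>i. closed_segment (v i) (v (nxt i))) (mset_set {..<n})"
  unfolding sides_eq using image_mset_mset_set[OF inj_sides] by simp

lemma vertices_eq: "vertices P = v ` {..<n}"
proof
  show "vertices P \<subseteq> v ` {..<n}"
    unfolding vertices_def P_def using extreme_point_of_convex_hull by blast
  show "v ` {..<n} \<subseteq> vertices P"
  proof clarify
    fix i assume i: "i < n"
    have "v i extreme_point_of closed_segment (v i) (v (nxt i))" by (simp add: extreme_point_of_segment)
    then show "v i \<in> vertices P" unfolding vertices_def
      using side_edge[OF i] extreme_point_of_face unfolding edge_of_def by blast
  qed
qed

lemma card_vertices: "card (vertices P) = n"
  unfolding vertices_eq using card_image[OF inj] by simp

lemma side_lengths_eq: "side_lengths P = image_mset (\<lambda>i. dist (v i) (v (nxt i))) (mset_set {..<n})"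
proof -
  have "diameter (closed_segment a b) = dist a b" for a b :: complex
    by (rule diameter_segment)
  then show ?thesis unfolding side_lengths_def mset_sides by (simp add: image_mset.compositionality comp_def)
qed

lemma convex_polygon: "convex_polygon P"
proof -
  have "\<not> collinear P"
  proof
    assume "collinear P"
    moreover have "v k \<in> P" if "k < n" for k using that unfolding P_def by (auto intro: hull_inc)
    ultimately have "orient (v 0) (v 1) (v 2) = 0" using n3 by (intro collinear_orient_0) auto
    then show False using cpolyD[OF cp, of 0 1 2] n3 by simp
  qed
  then have "\<not> aff_dim P \<le> 1" by (simp add: collinear_aff_dim)
  moreover have "aff_dim P \<le> 2" using aff_dim_le_DIM[of P] by simp
  ultimately have "aff_dim P = 2" by linarith
  moreover have "polytope P" unfolding P_def polytope_def by blast
  ultimately show ?thesis by (simp add: convex_polygon_def)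
qed

lemma sum_nxt: 
  fixes f :: "nat \<Rightarrow> nat \<Rightarrow> real"
  shows "(\<Sum>i<n. f i (nxt i)) = (\<Sum>i<n-1. f i (Suc i)) + f (n - 1) 0"
proof -
  have "{..<n} = insert (n-1) {..<n-1}" using n3 by auto
  then have "(\<Sum>i<n. f i (nxt i)) = f (n-1) (nxt (n-1)) + (\<Sum>i<n-1. f i (nxt i))" by simp
  moreover have "nxt (n-1) = 0" using n3 by simp
  moreover have "(\<Sum>i<n-1. f i (nxt i)) = (\<Sum>i<n-1. f i (Suc i))" by (intro sum.cong) auto
  ultimately show ?thesis by simp
qed

lemma mw_eq: "mw P = (\<Sum>i<n. dist (v i) (v (nxt i)))"
  and area_eq: "area P = (\<Sum>i<n. det2 (v i) (v (nxt i))) / 2"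
proof -
  have "{..<n} = {..n-1}" using n3 by auto
  then show "mw P = (\<Sum>i<n. dist (v i) (v (nxt i)))" "area P = (\<Sum>i<n. det2 (v i) (v (nxt i))) / 2"
    using cpoly_prefix[OF cp, of "n-1"] n3 sum_nxt[of "\<lambda>i j. dist (v i) (v j)"]
      sum_nxt[of "\<lambda>i j. det2 (v i) (v j)"] unfolding P_def by auto
qed

lemma sum_side_lengths: "sum_mset (side_lengths P) = mw P"
  unfolding side_lengths_eq mw_eq by (simp add: sum_unfold_sum_mset)

end

section \<open>Enumerating the vertices of a convex polygon\<close>

lemma extreme_not_in_hull:
  assumes "V = {x. x extreme_point_of (convex hull V)}" "p \<in> V"
  shows "p \<notin> convex hull (V - {p})"
proof
  assume p: "p \<in> convex hull (V - {p})"
  have "insert p (V - {p}) = V" using assms by auto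
  then have "convex hull V = convex hull (V - {p})" using p hull_redundant by metis
  then have "p extreme_point_of convex hull (V - {p})" using assms by auto
  then show False using extreme_point_of_convex_hull by blast
qed

lemma strict_enumeration:
  fixes s :: "'a \<Rightarrow> real"
  assumes "finite W" "inj_on s W"
  obtains f where "bij_betw f {..<card W} W" "\<And>i j. i < j \<Longrightarrow> j < card W \<Longrightarrow> s (f i) < s (f j)"
proof -
  define xs where "xs = sorted_list_of_set (s ` W)"
  have len: "length xs = card W" unfolding xs_def using assms by (simp add: card_image)
  have st: "sorted_wrt (<) xs" unfolding xs_def by simp
  have set: "set xs = s ` W" unfolding xs_def using assms by simp
  define f where "f i = the_inv_into W s (xs ! i)" for i
  have sf: "s (f i) = xs ! i" "f i \<in> W" if "i < card W" for i
  proof -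
    have "xs ! i \<in> s ` W" using that len set nth_mem by metis
    then show "s (f i) = xs ! i" "f i \<in> W" unfolding f_def
      using f_the_inv_into_f[OF assms(2)] the_inv_into_into[OF assms(2)] by auto
  qed
  have lt: "s (f i) < s (f j)" if "i < j" "j < card W" for i j
    using that sf sorted_wrt_nth_less[OF st] len by simp
  have "inj_on f {..<card W}"
    by (rule linorder_inj_onI) (use lt in fastforce)+
  then have "bij_betw f {..<card W} W"
    using sf assms(1) by (simp add: bij_betw_def card_image card_subset_eq image_subset_iff)
  with lt that show ?thesis by blast
qed

text \<open>Seen from the vertex \<open>p\<close>, the other vertices lie in an open half-plane and
  can be sorted by slope. Left turns at \<open>p\<close> are the order of slopes; all remaining left
  turns hold because no vertex lies in the hull of the others.\<close>

lemma cpoly_enumeration: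
  assumes fin: "finite V" and V: "V = {x. x extreme_point_of (convex hull V)}" and p: "p \<in> V"
    and nc: "\<not> collinear V"
  obtains n v where "cpoly n v" "v ` {..<n} = V" "v 0 = p"
proof -
  define W where "W = V - {p}"
  have finW: "finite W" using fin W_def by simp
  have "closed (convex hull W)" using finW by (simp add: finite_imp_compact_convex_hull compact_imp_closed)
  then obtain e b where eb: "e \<bullet> p < b" "\<And>x. x \<in> convex hull W \<Longrightarrow> e \<bullet> x > b"
    using separating_hyperplane_closed_point[of "convex hull W" p] extreme_not_in_hull[OF V p] W_def by auto
  have epos: "e \<bullet> (x - p) > 0" if "x \<in> W" for x
    using eb(1) eb(2)[of x] that by (simp add: inner_diff_right hull_inc)
  \<comment> \<open>The tangent of the angle from \<open>e\<close> to \<open>x - p\<close>; the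
    denominator is positive by separation, so the angle is less than a right angle.\<close>
  define s where "s x = det2 e (x - p) / (e \<bullet> (x - p))" for x
  have id: "(norm e)\<^sup>2 * orient p x y = (e \<bullet> (x-p)) * det2 e (y-p) - det2 e (x-p) * (e \<bullet> (y-p))" for x y
    unfolding cmod_power2 by (simp add: orient_simps inner_complex_def algebra_simps power2_eq_square)
  have "W \<noteq> {}" 
  proof
    assume "W = {}" then have "V = {p}" using p W_def by auto
    then show False using nc by simp
  qed
  then have e0: "e \<noteq> 0" using epos by force
  have sgn: "(0 < orient p x y \<longleftrightarrow> s x < s y) \<and> (orient p x y = 0 \<longleftrightarrow> s x = s y)" if "x \<in> W" "y \<in> W" for x y
  proof -
    have "(norm e)\<^sup>2 * orient p x y = (e \<bullet> (x-p)) * (e \<bullet> (y-p)) * (s y - s x)"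
      unfolding id s_def using epos[OF that(1)] epos[OF that(2)] by (simp add: field_simps)
    moreover have "(norm e)\<^sup>2 > 0" "(e \<bullet> (x-p)) * (e \<bullet> (y-p)) > 0" using e0 epos that by auto
    ultimately show ?thesis by (metis diff_gt_0_iff_gt eq_iff_diff_eq_0 mult_eq_0_iff order_less_irrefl zero_less_mult_pos zero_less_mult_iff)
  qed
  have nin: "x \<notin> convex hull (V - {x})" if "x \<in> V" for x using extreme_not_in_hull[OF V that] .
  have inj: "inj_on s W"
  proof (rule inj_onI, rule ccontr)
    fix x y assume xy: "x \<in> W" "y \<in> W" "s x = s y" "x \<noteq> y"
    then have "orient p x y = 0" using sgn by blast
    moreover have "p \<noteq> x" using xy W_def by auto
    ultimately obtain r where r: "y = p + r *\<^sub>R (x - p)" using orient_eq_0_iff by blast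
    have "e \<bullet> (y - p) = r * (e \<bullet> (x - p))" unfolding r by simp
    then have r0: "r > 0" using epos xy by (metis zero_less_mult_pos2)
    show False
    proof (cases "r \<le> 1")
      case True
      then have "y \<in> closed_segment p x" unfolding r using r0 by (intro in_segment_param) auto
      moreover have "closed_segment p x \<subseteq> convex hull (V - {y})" unfolding segment_convex_hull
        using xy p W_def by (intro hull_mono) auto
      ultimately show False using nin[of y] xy W_def by blast
    next
      case False
      have "x = p + (1/r) *\<^sub>R (y - p)" unfolding r using r0 by simp
      then have "x \<in> closed_segment p y" using False in_segment_param[of "1/r" p y] by simp
      moreover have "closed_segment p y \<subseteq> convex hull (V - {x})" unfolding segment_convex_hull
        using xy p W_def by (intro hull_mono) auto
      ultimately show False using nin[of x] xy W_def by blast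
    qed
  qed
  obtain f where f: "bij_betw f {..<card W} W" "\<And>i j. i < j \<Longrightarrow> j < card W \<Longrightarrow> s (f i) < s (f j)"
    using strict_enumeration[OF finW inj] by blast
  define v where "v i = (case i of 0 \<Rightarrow> p | Suc k \<Rightarrow> f k)" for i
  define n where "n = Suc (card W)"
  have v0: "v 0 = p" and vS: "v (Suc k) = f k" for k by (auto simp: v_def)
  have fW: "f k \<in> W" if "k < card W" for k using f(1) that by (auto simp: bij_betw_def)
  have img: "v ` {..<n} = V"
    using f(1) p unfolding n_def lessThan_Suc_eq_insert_0 image_insert image_image v0 vS W_def bij_betw_def by auto
  have pij: "0 < orient p (f i) (f j)" if "i < j" "j < card W" for i j
    using sgn[OF fW fW] f(2)[OF that] that by simp
  have fijk: "0 < orient (f i) (f j) (f k)" if "i < j" "j < k" "k < card W" for i j k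
  proof (rule ccontr)
    assume "\<not> ?thesis"
    moreover have "orient (f j) (f i) (f k) = - orient (f i) (f j) (f k)" by (rule orient_swap)
    \<comment> \<open>A triple that fails to turn left would put its middle vertex into the triangle
      formed by \<open>p\<close> and the outer two.\<close>
    ultimately have "f j \<in> convex hull {p, f i, f k}"
      using pij[of i k] pij[of j k] pij[of i j] that by (intro in_triangleI) auto
    moreover have "convex hull {p, f i, f k} \<subseteq> convex hull (V - {f j})"
    proof (rule hull_mono)
      have "f i \<noteq> f j" "f k \<noteq> f j" using f(2)[of i j] f(2)[of j k] that by auto
      then show "{p, f i, f k} \<subseteq> V - {f j}" using fW[of i] fW[of j] fW[of k] that p unfolding W_def by auto
    qed
    ultimately show False using nin[of "f j"] fW[of j] that W_def by auto
  qed
  have "card W \<ge> 2"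
  proof (rule ccontr)
    assume "\<not> 2 \<le> card W"
    then obtain x where "W \<subseteq> {x}" using finW
      by (metis One_nat_def Suc_1 card_1_singleton_iff card_eq_0_iff empty_subsetI le_less_Suc_eq not_less_eq_eq order_refl le_zero_eq not_less_iff_gr_or_eq less_Suc_eq_le nat_less_le)
    then have "V \<subseteq> {p, x}" unfolding W_def by auto
    then show False using nc collinear_2 collinear_subset by blast
  qed
  then have "cpoly n v" unfolding cpoly_def n_def
  proof (intro conjI allI impI)
    fix i j k assume "i < j \<and> j < k \<and> k < Suc (card W)"
    then obtain j' k' where "j = Suc j'" "k = Suc k'" "j' < k'" "k' < card W" "i \<le> j'"
      by (metis Suc_less_eq less_Suc_eq_le less_imp_Suc_add lessE)
    then show "0 < orient (v i) (v j) (v k)"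
      using pij[of j' k'] fijk[of _ j' k'] by (cases i) (auto simp: v0 vS)
  qed simp
  then show ?thesis using img v0 that by blast
qed

lemma convex_polygon_vertices:
  assumes "convex_polygon P"
  shows "finite (vertices P)" "P = convex hull (vertices P)" "\<not> collinear (vertices P)" "compact P"
    "vertices P = {x. x extreme_point_of (convex hull (vertices P))}"
proof -
  have pt: "polytope P" and ad: "aff_dim P = 2" using assms by (auto simp: convex_polygon_def)
  show "finite (vertices P)" unfolding vertices_def
    using finite_polyhedron_extreme_points polytope_imp_polyhedron[OF pt] by blast
  show c: "compact P" using pt polytope_imp_compact by blast
  show P: "P = convex hull (vertices P)" unfolding vertices_def
    using Krein_Milman_Minkowski[OF c polytope_imp_convex[OF pt]] .
  show "\<not> collinear (vertices P)"
  proof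
    assume "collinear (vertices P)"
    then have "aff_dim (vertices P) \<le> 1" by (simp add: collinear_aff_dim)
    moreover have "aff_dim P = aff_dim (vertices P)" using P aff_dim_convex_hull by metis
    ultimately show False using ad by simp
  qed
  show "vertices P = {x. x extreme_point_of (convex hull (vertices P))}"
    using P unfolding vertices_def by simp
qed

lemma convex_polygon_cycle:
  assumes "convex_polygon P" "p \<in> vertices P"
  obtains n v where "convex_cycle n v P" "v 0 = p" "vertices P = v ` {..<n}"
proof -
  note P = convex_polygon_vertices[OF assms(1)]
  obtain n v where "cpoly n v" "v ` {..<n} = vertices P" "v 0 = p"
    using cpoly_enumeration[OF P(1,5) assms(2) P(3)] by blast
  then show ?thesis using that P(2) by (metis convex_cycle.intro)
qed

lemma convex_polygon_vertices_nonempty: "convex_polygon P \<Longrightarrow> vertices P \<noteq> {}"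
  using convex_polygon_vertices(3) by fastforce

lemma sum_side_lengths_eq_mw:
  assumes "convex_polygon P" shows "sum_mset (side_lengths P) = mw P"
proof -
  obtain p where "p \<in> vertices P" using convex_polygon_vertices_nonempty[OF assms] by blast
  then obtain n v where "convex_cycle n v P" using convex_polygon_cycle[OF assms] by metis
  then show ?thesis by (rule convex_cycle.sum_side_lengths)
qed

section \<open>Moving vertices to the circle\<close>

text \<open>\<open>P\<close> is one of its own inscribed polygons, and every other one is contained
  in \<open>P\<close>, so monotonicity of \<open>mw\<close> makes \<open>P\<close> the
  maximum.\<close>

lemma perimeter_polygon:
  assumes "convex_polygon P" shows "perimeter P = mw P"
  unfolding perimeter_def
proof (rule cSup_eq_maximum)
  note P = convex_polygon_vertices[OF assms]
  have "vertices P \<subseteq> frontier P"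
    using P(4) extreme_point_not_in_interior
    unfolding vertices_def frontier_def by (auto simp: compact_imp_closed extreme_point_of_def)
  then show "mw P \<in> {sum_mset (side_lengths Q) |Q. convex_polygon Q \<and> vertices Q \<subseteq> frontier P}"
    using sum_side_lengths_eq_mw[OF assms] assms by (intro CollectI exI[of _ P]) auto
  fix x assume "x \<in> {sum_mset (side_lengths Q) |Q. convex_polygon Q \<and> vertices Q \<subseteq> frontier P}"
  then obtain Q where Q: "x = mw Q" "convex_polygon Q" "vertices Q \<subseteq> frontier P"
    using sum_side_lengths_eq_mw by auto
  have "convex P" using P(2) by (metis convex_convex_hull)
  moreover have "frontier P \<subseteq> P" using P(4) by (simp add: compact_imp_closed frontier_subset_closed)
  ultimately have "Q \<subseteq> P" using Q convex_polygon_vertices(2)[OF Q(2)] by (metis hull_minimal subset_trans)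
  moreover have "Q \<noteq> {}" using convex_polygon_vertices_nonempty[OF Q(2)] unfolding vertices_def extreme_point_of_def by auto
  ultimately show "x \<le> mw P" using Q(1) mw_mono P(4) compact_imp_bounded by auto
qed

text \<open>Inscribed polygons are contained in the closure. The polygon \<open>Q\<close> guarantees
  that the supremum ranges over a nonempty set.\<close>

lemma perimeter_le_mw_closure:
  assumes "convex S" "bounded S" "convex_polygon Q" "vertices Q \<subseteq> frontier S"
  shows "perimeter S \<le> mw (closure S)"
  unfolding perimeter_def
proof (rule cSup_least)
  show "{sum_mset (side_lengths Q) |Q. convex_polygon Q \<and> vertices Q \<subseteq> frontier S} \<noteq> {}"
    using assms by blast
  fix x assume "x \<in> {sum_mset (side_lengths Q) |Q. convex_polygon Q \<and> vertices Q \<subseteq> frontier S}"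
  then obtain Q where Q: "x = mw Q" "convex_polygon Q" "vertices Q \<subseteq> frontier S"
    using sum_side_lengths_eq_mw by auto
  have "frontier S \<subseteq> closure S" by (simp add: frontier_def)
  then have "Q \<subseteq> closure S" using Q convex_polygon_vertices(2)[OF Q(2)] convex_closure[OF assms(1)]
    by (metis hull_minimal subset_trans)
  moreover have "Q \<noteq> {}" using convex_polygon_vertices_nonempty[OF Q(2)] unfolding vertices_def extreme_point_of_def by auto
  ultimately show "x \<le> mw (closure S)" unfolding Q(1) by (intro mw_mono bounded_closure assms)
qed

text \<open>The case of \<open>triangle_glue\<close> in which the wedge is bounded by the new sides
  \<open>a q\<close> and \<open>q b\<close> themselves.\<close>

lemma apex_glue:
  assumes X: "compact X" "convex X" "a \<in> X" "b \<in> X"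
    and oX: "\<And>x. x \<in> X \<Longrightarrow> 0 \<le> orient a b x" and q: "orient a b q < 0"
    and aq: "\<And>x. x \<in> X \<Longrightarrow> 0 \<le> orient a q x" and qb: "\<And>x. x \<in> X \<Longrightarrow> 0 \<le> orient q b x"
  shows "convex hull (insert q X) = X \<union> convex hull {a,q,b}"
    and "mw (convex hull (insert q X)) = mw X + dist a q + dist q b - dist a b"
    and "area (convex hull (insert q X)) = area X - orient a b q / 2"
proof -
  have id: "det2 (q - a) (b - a) = - orient a b q" "det2 (b - q) (a - b) = - orient a b q"
     "det2 (b - q) (q - b) = 0" "det2 (b - q) (x - b) = orient q b x" for x
    by (simp_all add: orient_simps algebra_simps)
  have 1: "0 < det2 (q - a) (b - a)" "0 \<le> det2 (q - a) (q - a)" using q id by auto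
  have 2: "0 \<le> det2 (q - a) (x - a)" if "x \<in> X" for x using aq[OF that] by (simp only: orient_def)
  have 3: "0 < det2 (b - q) (a - b)" "0 \<le> det2 (b - q) (q - b)" unfolding id(2,3) using q by auto
  have 4: "0 \<le> det2 (b - q) (x - b)" if "x \<in> X" for x using qb[OF that] unfolding id .
  note g = triangle_glue[OF X oX less_imp_le[OF q] 1(1) 2 1(2) 3(1) 4 3(2)]
  show "convex hull (insert q X) = X \<union> convex hull {a,q,b}" by (rule g; assumption)
  show "mw (convex hull (insert q X)) = mw X + dist a q + dist q b - dist a b" by (rule g; assumption)
  have "area (convex hull (insert q X)) = area X + \<bar>orient a b q\<bar> / 2" by (rule g; assumption)
  then show "area (convex hull (insert q X)) = area X - orient a b q / 2" using q by simp
qed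

section \<open>Sliding a vertex parallel to a chord\<close>

lemma norm_add_strict: "det2 x y \<noteq> 0 \<Longrightarrow> norm (x + y) < norm x + norm y"
proof (rule ccontr)
  assume d: "det2 x y \<noteq> 0" and "\<not> norm (x + y) < norm x + norm y"
  then have "norm (x + y) = norm x + norm y" using norm_triangle_ineq[of x y] by linarith
  then have "norm x *\<^sub>R y = norm y *\<^sub>R x" by (simp add: norm_triangle_eq)
  then have "det2 x (norm x *\<^sub>R y) = det2 x (norm y *\<^sub>R x)" by simp
  then have "norm x * det2 x y = 0" by simp
  then show False using d by auto
qed

text \<open>The sum of the distances to \<open>a\<close> and \<open>b\<close> is strictly convex
  along a line parallel to \<open>a b\<close> other than that line itself. As \<open>p\<close> is
  the mean of \<open>q1\<close> and \<open>q2\<close> with weights \<open>r\<close> and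
  \<open>s\<close>, one of the two exceeds it.\<close>

lemma dist_sum_slide_strict:
  assumes "s > 0" "r > 0" "orient a b p \<noteq> 0"
    "q1 = p + s *\<^sub>R (b - a)" "q2 = p - r *\<^sub>R (b - a)"
  shows "dist a p + dist p b < dist a q1 + dist q1 b \<or> dist a p + dist p b < dist a q2 + dist q2 b"
proof (rule ccontr)
  assume "\<not> ?thesis"
  then have le: "dist a q1 + dist q1 b \<le> dist a p + dist p b" "dist a q2 + dist q2 b \<le> dist a p + dist p b" by auto
  have e: "(r + s) *\<^sub>R (p - c) = r *\<^sub>R (q1 - c) + s *\<^sub>R (q2 - c)" for c
    unfolding assms by (simp add: algebra_simps)
  have d: "det2 (r *\<^sub>R (q1 - a)) (s *\<^sub>R (q2 - a)) = r * s * (r + s) * det2 (p - a) (b - a) * (-1)"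
    unfolding assms by (simp add: algebra_simps det2_def)
  have "det2 (p - a) (b - a) \<noteq> 0" using assms(3) by (simp add: orient_simps algebra_simps)
  then have "det2 (r *\<^sub>R (q1 - a)) (s *\<^sub>R (q2 - a)) \<noteq> 0" unfolding d using assms by simp
  then have "(r + s) * dist a p < r * dist a q1 + s * dist a q2"
    using norm_add_strict[of "r *\<^sub>R (q1 - a)" "s *\<^sub>R (q2 - a)"] e[of a] assms(1,2)
    by (metis abs_of_pos add_pos_pos dist_commute dist_norm norm_scaleR)
  moreover have "(r + s) * dist p b \<le> r * dist q1 b + s * dist q2 b"
    using norm_triangle_ineq[of "r *\<^sub>R (q1 - b)" "s *\<^sub>R (q2 - b)"] e[of b] assms(1,2)
    by (metis abs_of_pos add_pos_pos dist_norm norm_scaleR)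
  moreover have "r * (dist a q1 + dist q1 b) + s * (dist a q2 + dist q2 b) \<le> r * (dist a p + dist p b) + s * (dist a p + dist p b)"
    using mult_left_mono[OF le(1), of r] mult_left_mono[OF le(2), of s] assms(1,2) by linarith
  ultimately show False by (simp add: algebra_simps)
qed

lemma orient_slide: "orient a b (p + s *\<^sub>R (b - a)) = orient a b p"
  by (simp add: orient_simps algebra_simps)

lemma slide_apex:
  assumes X: "compact X" "convex X" "a \<in> X" "b \<in> X"
    and oX: "\<And>x. x \<in> X \<Longrightarrow> 0 \<le> orient a b x" and p: "orient a b p < 0"
    and sr: "s > 0" "r > 0" "q1 = p + s *\<^sub>R (b - a)" "q2 = p - r *\<^sub>R (b - a)"
    and lines: "\<And>q x. q \<in> {p, q1, q2} \<Longrightarrow> x \<in> X \<Longrightarrow> 0 \<le> orient a q x \<and> 0 \<le> orient q b x"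
  obtains q where "q \<in> {q1, q2}" "mw (convex hull (insert p X)) < mw (convex hull (insert q X))"
    "area (convex hull (insert q X)) = area (convex hull (insert p X))"
proof -
  have oq: "orient a b q = orient a b p" if "q \<in> {p, q1, q2}" for q
    using that orient_slide[of a b p s] orient_slide[of a b p "-r"] sr by auto
  have g: "mw (convex hull (insert q X)) = mw X + dist a q + dist q b - dist a b"
    "area (convex hull (insert q X)) = area X - orient a b p / 2" if "q \<in> {p, q1, q2}" for q
    using apex_glue(2,3)[OF X oX, of q] lines[OF that] oq[OF that] p by auto
  obtain q where "q \<in> {q1, q2}" "dist a p + dist p b < dist a q + dist q b"
    using dist_sum_slide_strict[OF sr(1,2) _ sr(3,4)] p by fastforce
  then show ?thesis using g[of q] g[of p] by (intro that[of q]) auto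
qed

lemma continuous_on_Min:
  fixes F :: "'i set" and f :: "'i \<Rightarrow> real \<Rightarrow> real"
  assumes "finite F" "F \<noteq> {}" "\<And>i. i \<in> F \<Longrightarrow> continuous_on UNIV (f i)"
  shows "continuous_on UNIV (\<lambda>t. Min ((\<lambda>i. f i t) ` F))"
  using assms
proof (induction F rule: finite_ne_induct)
  case (insert i F)
  then have "continuous_on UNIV (\<lambda>t. min (f i t) (Min ((\<lambda>i. f i t) ` F)))"
    by (intro continuous_on_min) auto
  then show ?case using insert by simp
qed simp

text \<open>Intermediate values for the minimum of the finitely many constraints: at a zero of the
  minimum all constraints hold and one is active.\<close>

lemma first_exit:
  fixes f :: "'i \<Rightarrow> real \<Rightarrow> real"
  assumes F: "finite F" "\<And>i. i \<in> F \<Longrightarrow> continuous_on UNIV (f i)" "\<And>i. i \<in> F \<Longrightarrow> 0 < f i 0"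
    and out: "B > 0" "j \<in> F" "f j B < 0"
  obtains T where "T > 0" "\<And>i. i \<in> F \<Longrightarrow> 0 \<le> f i T" "\<exists>i\<in>F. f i T = 0"
proof -
  let ?g = "\<lambda>t. Min ((\<lambda>i. f i t) ` F)"
  have ne: "F \<noteq> {}" using out by auto
  have "continuous_on UNIV ?g" using F(1) ne F(2) by (rule continuous_on_Min)
  then have c: "continuous_on {0..B} ?g" by (rule continuous_on_subset) simp
  have "?g B \<le> f j B" using F(1) out by (intro Min_le) auto
  then have "?g B \<le> 0" using out by simp
  moreover have "?g 0 > 0" using F ne by (subst Min_gr_iff) auto
  ultimately obtain T where T: "0 \<le> T" "T \<le> B" "?g T = 0"
    using IVT2'[of ?g B 0 0] c out(1) by auto
  have "T \<noteq> 0" using T \<open>?g 0 > 0\<close> by auto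
  moreover have "0 \<le> f i T" if "i \<in> F" for i using T(3) Min_le[of "(\<lambda>i. f i T) ` F" "f i T"] F(1) that by auto
  moreover have "\<exists>i\<in>F. f i T = 0" using T(3) Min_in[of "(\<lambda>i. f i T) ` F"] F(1) ne by auto
  ultimately show ?thesis using T(1) by (intro that[of T]) auto
qed

lemma opposite_sides_between:
  assumes "orient a q x = 0" "orient a b q < 0" "0 < orient a b x"
  shows "a \<in> closed_segment q x"
proof -
  have "a \<noteq> x" using assms(3) by auto
  moreover have "orient a x q = 0" using assms(1) orient_swap_right[of a q x] by simp
  ultimately obtain s where s: "q = a + s *\<^sub>R (x - a)" using orient_eq_0_iff by blast
  have "orient a b q = s * orient a b x" unfolding s by (simp add: orient_simps algebra_simps)
  then have s0: "s < 0" using assms by (metis mult_less_0_iff not_less_iff_gr_or_eq)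
  have "a = (1 / (1 - s)) *\<^sub>R q + (- s / (1 - s)) *\<^sub>R x"
  proof -
    have "(1 - s) *\<^sub>R a = q - s *\<^sub>R x" unfolding s by (simp add: algebra_simps)
    then have "(1 / (1 - s)) *\<^sub>R ((1 - s) *\<^sub>R a) = (1 / (1 - s)) *\<^sub>R (q - s *\<^sub>R x)" by simp
    then show ?thesis using s0 by (simp add: scaleR_diff_right)
  qed
  moreover have "1 / (1 - s) = 1 - (- s / (1 - s))" using s0 by (simp add: field_simps)
  moreover have "0 \<le> - s / (1 - s)" "- s / (1 - s) \<le> 1" using s0 by (auto simp: field_simps)
  ultimately show ?thesis unfolding closed_segment_def by (metis (mono_tags, lifting) mem_Collect_eq)
qed

lemma vertices_hull_subset: "vertices (convex hull V) \<subseteq> V"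
  unfolding vertices_def using extreme_point_of_convex_hull by blast

lemma convex_polygonI:
  assumes "finite V" "a \<in> V" "b \<in> V" "c \<in> V" "orient a b c \<noteq> 0"
  shows "convex_polygon (convex hull V)"
proof -
  have "\<not> collinear V" using collinear_orient_0 assms by blast
  then have "\<not> aff_dim V \<le> 1" by (simp add: collinear_aff_dim)
  moreover have "aff_dim V \<le> 2" using aff_dim_le_DIM[of V] by simp
  ultimately have "aff_dim (convex hull V) = 2" by (simp add: aff_dim_convex_hull)
  then show ?thesis using assms(1) by (auto simp: convex_polygon_def polytope_def)
qed

text \<open>Slide \<open>p\<close> both ways along the parallel to the chord of its neighbours until
  it meets the circle or a side becomes collinear with another vertex. One of the two end positions
  increases the perimeter, by strict convexity. In the first event \<open>p\<close> stops being
  interior, in the second a neighbour becomes redundant; both lower the sum of the number of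
  vertices and the number of interior vertices.\<close>

lemma push_vertex:
  assumes P: "convex_polygon P" "P \<subseteq> cball 0 1" and p: "p \<in> vertices P" "norm p < 1"
  obtains Q where "convex_polygon Q" "Q \<subseteq> cball 0 1" "area Q = area P" "mw P < mw Q"
    "card (vertices Q) \<le> card (vertices P)"
    "card (vertices Q) + card (vertices Q \<inter> ball 0 1) < card (vertices P) + card (vertices P \<inter> ball 0 1)"
proof -
  obtain n v where cyc: "convex_cycle n v P" and v0: "v 0 = p" and V: "vertices P = v ` {..<n}"
    using convex_polygon_cycle[OF P(1) p(1)] by metis
  interpret convex_cycle n v P by fact
  have finV: "finite (vertices P)" by (simp add: V)
  define W where "W = vertices P - {p}"
  have insW: "insert p W = vertices P" "finite W" "p \<notin> W" using p W_def finV by auto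
  define a b where "a = v (n - 1)" and "b = v 1"
  have W: "W = v ` {1..<n}"
  proof -
    have "{..<n} = insert 0 {1..<n}" using n3 by auto
    then have "vertices P = insert p (v ` {1..<n})" using V v0 by auto
    moreover have "p \<notin> v ` {1..<n}" using inj v0 n3 unfolding inj_on_def by fastforce
    ultimately show ?thesis unfolding W_def by auto
  qed
  have abW: "a \<in> W" "b \<in> W" using n3 unfolding W a_def b_def by auto
  have ab: "a \<noteq> b" using inj n3 unfolding a_def b_def inj_on_def by fastforce
  have oabp: "orient a b p < 0"
  proof -
    have "0 < orient (v 0) (v 1) (v (n-1))" using n3 by (intro cpolyD[OF cp]) auto
    moreover have "orient a b p = - orient (v 0) (v 1) (v (n-1))" unfolding a_def b_def v0[symmetric]
      by (simp add: orient_simps algebra_simps)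
    ultimately show ?thesis by simp
  qed
  have oab: "0 < orient a b x" if x: "x \<in> W" "x \<noteq> a" "x \<noteq> b" for x
  proof -
    obtain i where i: "1 \<le> i" "i < n" "x = v i" using x(1) W by auto
    then have "1 < i" "i < n - 1" using x(2,3) unfolding a_def b_def by (auto simp: nat_less_le)
    then have "0 < orient (v 1) (v i) (v (n-1))" using n3 by (intro cpolyD[OF cp]) auto
    then show ?thesis unfolding a_def b_def i(3) using orient_cyclic by metis
  qed
  have oap: "0 < orient a p x \<and> 0 < orient p b x" if x: "x \<in> W" "x \<noteq> a" "x \<noteq> b" for x
  proof -
    obtain i where i: "1 \<le> i" "i < n" "x = v i" using x(1) W by auto
    then have i': "1 < i" "i < n - 1" using x(2,3) unfolding a_def b_def by (auto simp: nat_less_le)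
    then have "0 < orient (v 0) (v i) (v (n-1))" "0 < orient (v 0) (v 1) (v i)" using n3 by (intro cpolyD[OF cp]; auto)+
    then show ?thesis unfolding a_def b_def i(3) v0[symmetric] using orient_cyclic by metis
  qed
  define X where "X = convex hull W"
  have X: "compact X" "convex X" "a \<in> X" "b \<in> X"
    unfolding X_def using abW insW by (auto intro!: finite_imp_compact_convex_hull hull_inc)
  have oX: "0 \<le> orient a b x" if "x \<in> X" for x
  proof -
    have "W \<subseteq> {x. 0 \<le> orient a b x}" using oab by fastforce
    then have "X \<subseteq> {x. 0 \<le> orient a b x}" unfolding X_def by (intro hull_minimal convex_orient_ge)
    with that show ?thesis by blast
  qed
  have hullq: "convex hull (insert q X) = convex hull (insert q W)" for q
    unfolding X_def by (rule hull_insert_hull)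
  have Pp: "P = convex hull (insert p X)" unfolding hullq insW using P_def V by simp
  \<comment> \<open>\<open>None\<close> stands for the circle; \<open>Some (x, True)\<close> and
    \<open>Some (x, False)\<close> stand for the vertex \<open>x\<close> reaching the line
    \<open>a q\<close> or \<open>q b\<close>.\<close>
  define I where "I = insert None (Some ` ((W - {a,b}) \<times> (UNIV :: bool set)))"
  have finI: "finite I" unfolding I_def using insW by simp
  \<comment> \<open>The constraints met by the apex while it slides parallel to the chord.\<close>
  define f where "f \<sigma> i t = (let q = p + (\<sigma> * t) *\<^sub>R (b - a) in
     case i of None \<Rightarrow> 1 - norm q | Some (x, c) \<Rightarrow> if c then orient a q x else orient q b x)" for \<sigma> :: real and i t
  have exit: "\<exists>T>0. (\<forall>i\<in>I. 0 \<le> f \<sigma> i T) \<and> (\<exists>i\<in>I. f \<sigma> i T = 0)" if \<sigma>: "\<bar>\<sigma>\<bar> = 1" for \<sigma>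
  proof -
    \<comment> \<open>The displacement then has length \<open>norm p + 2\<close>, so the apex is
      outside the disk.\<close>
    define B where "B = (norm p + 2) / norm (b - a)"
    have nz: "norm (b - a) > 0" using ab by simp
    have cont: "continuous_on UNIV (f \<sigma> i)" for i
    proof (cases i)
      case None
      then show ?thesis unfolding f_def Let_def by (auto intro!: continuous_intros)
    next
      case (Some z)
      then show ?thesis unfolding f_def Let_def orient_simps by (cases z; cases "snd z") (auto intro!: continuous_intros)
    qed
    have pos: "0 < f \<sigma> i 0" if i: "i \<in> I" for i
    proof (cases i)
      case None
      then show ?thesis using p(2) by (simp add: f_def)
    next
      case (Some z)
      then obtain x c where "z = (x, c)" "x \<in> W" "x \<noteq> a" "x \<noteq> b" using i unfolding I_def by auto
      then show ?thesis using oap[of x] Some by (simp add: f_def)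
    qed
    have "norm (p + (\<sigma> * B) *\<^sub>R (b - a)) \<ge> norm ((\<sigma> * B) *\<^sub>R (b - a)) - norm p"
      by (metis add.commute norm_diff_ineq)
    moreover have "norm ((\<sigma> * B) *\<^sub>R (b - a)) = norm p + 2"
      unfolding norm_scaleR abs_mult \<sigma> B_def using nz by simp
    ultimately have "f \<sigma> None B < 0" unfolding f_def by simp
    moreover have "B > 0" unfolding B_def using nz by (simp add: add_nonneg_pos)
    moreover have "None \<in> I" unfolding I_def by simp
    ultimately obtain T where "T > 0" "\<And>i. i \<in> I \<Longrightarrow> 0 \<le> f \<sigma> i T" "\<exists>i\<in>I. f \<sigma> i T = 0"
      using first_exit[of I "f \<sigma>" B None] finI cont pos by metis
    then show ?thesis by blast
  qed
  have lines: "0 \<le> orient a q x \<and> 0 \<le> orient q b x" if q: "orient a b q \<le> 0" "\<And>x c. x \<in> W - {a,b} \<Longrightarrow> 0 \<le> orient a q x \<and> 0 \<le> orient q b x" and x: "x \<in> X" for q x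
  proof -
    have id: "orient a q b = - orient a b q" "orient q b a = - orient a b q" by (simp_all add: orient_simps algebra_simps)
    have "W \<subseteq> {x. 0 \<le> orient a q x} \<inter> {x. 0 \<le> orient q b x}"
    proof
      fix x assume "x \<in> W"
      then show "x \<in> {x. 0 \<le> orient a q x} \<inter> {x. 0 \<le> orient q b x}"
        using q(2)[of x] q(1) id by (cases "x = a"; cases "x = b") auto
    qed
    then have "X \<subseteq> {x. 0 \<le> orient a q x} \<inter> {x. 0 \<le> orient q b x}"
      unfolding X_def by (intro hull_minimal convex_Int convex_orient_ge)
    with x show ?thesis by blast
  qed
  obtain T1 where T1: "T1 > 0" "\<forall>i\<in>I. 0 \<le> f 1 i T1" "\<exists>i\<in>I. f 1 i T1 = 0" using exit[of 1] by auto
  obtain T2 where T2: "T2 > 0" "\<forall>i\<in>I. 0 \<le> f (-1) i T2" "\<exists>i\<in>I. f (-1) i T2 = 0" using exit[of "-1"] by auto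
  define q1 q2 where "q1 = p + T1 *\<^sub>R (b - a)" and "q2 = p - T2 *\<^sub>R (b - a)"
  have oq: "orient a b q = orient a b p" if "q \<in> {p, q1, q2}" for q
    using that orient_slide[of a b p T1] orient_slide[of a b p "-T2"] unfolding q1_def q2_def by auto
  have Q: "norm q \<le> 1 \<and> (\<forall>x\<in>W - {a,b}. 0 \<le> orient a q x \<and> 0 \<le> orient q b x) \<and>
     (norm q = 1 \<or> (\<exists>x\<in>W - {a,b}. orient a q x = 0 \<or> orient q b x = 0))" if q: "q \<in> {q1, q2}" for q
  proof -
    obtain \<sigma> T where T: "q = p + (\<sigma> * T) *\<^sub>R (b - a)" "\<forall>i\<in>I. 0 \<le> f \<sigma> i T" "\<exists>i\<in>I. f \<sigma> i T = 0"
    proof (cases "q = q1")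
      case True
      then show ?thesis using T1 by (intro that[of 1 T1]) (auto simp: q1_def)
    next
      case False
      then show ?thesis using q T2 by (intro that[of "-1" T2]) (auto simp: q2_def)
    qed
    have "0 \<le> f \<sigma> None T" using T(2) unfolding I_def by blast
    moreover have "0 \<le> f \<sigma> (Some (x, c)) T" if "x \<in> W - {a,b}" for x c using T(2) that unfolding I_def by blast
    ultimately have "norm q \<le> 1" "\<forall>x\<in>W - {a,b}. 0 \<le> orient a q x \<and> 0 \<le> orient q b x"
      unfolding f_def Let_def T(1)[symmetric] by (auto split: if_splits) (metis (full_types))+
    moreover have "norm q = 1 \<or> (\<exists>x\<in>W - {a,b}. orient a q x = 0 \<or> orient q b x = 0)"
      using T(3) unfolding f_def Let_def T(1)[symmetric] I_def by (auto split: if_splits)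
    ultimately show ?thesis by blast
  qed
  have L: "0 \<le> orient a q x \<and> 0 \<le> orient q b x" if "q \<in> {p, q1, q2}" "x \<in> X" for q x
  proof (rule lines[OF _ _ that(2)])
    show "orient a b q \<le> 0" using oq[OF that(1)] oabp by simp
    show "0 \<le> orient a q x \<and> 0 \<le> orient q b x" if "x \<in> W - {a,b}" for x
      using \<open>q \<in> {p, q1, q2}\<close> Q[of q] oap[of x] that by (auto intro: less_imp_le)
  qed
  obtain q where q: "q \<in> {q1, q2}" "mw (convex hull (insert p X)) < mw (convex hull (insert q X))"
    "area (convex hull (insert q X)) = area (convex hull (insert p X))"
    using slide_apex[OF X oX oabp T1(1) T2(1) q1_def q2_def L] by metis
  note Qq = Q[OF q(1)]
  have oq': "orient a b q < 0" using oq[of q] q(1) oabp by auto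
  define R where "R = convex hull (insert q W)"
  have WD: "W \<subseteq> cball 0 1" using P(2) unfolding W_def vertices_def extreme_point_of_def by auto
  have cardR: "card (vertices R) \<le> card (vertices P) \<and> 
      card (vertices R) + card (vertices R \<inter> ball 0 1) < card (vertices P) + card (vertices P \<inter> ball 0 1)"
  proof -
    have cP: "card (vertices P) = Suc (card W)" using insW by (metis card_insert_disjoint)
    have cPi: "card (vertices P \<inter> ball 0 1) = Suc (card (W \<inter> ball 0 1))"
    proof -
      have "vertices P \<inter> ball 0 1 = insert p (W \<inter> ball 0 1)" using insW p(2) by auto
      then show ?thesis using insW by simp
    qed
    \<comment> \<open>The moved vertex \<open>q\<close> may still be interior, as \<open>p\<close>
      was; the loss of \<open>c\<close> lowers the count anyway.\<close>
    have drop: ?thesis if "vertices R \<subseteq> insert q (W - {c})" "c \<in> W" for c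
    proof -
      have "card (vertices R) \<le> card (insert q (W - {c}))" using that insW by (intro card_mono) auto
      also have "\<dots> \<le> Suc (card (W - {c}))" using insW by (simp add: card_insert_if)
      also have "\<dots> = card W" using that insW by (metis card_Suc_Diff1)
      finally have 1: "card (vertices R) \<le> card W" .
      have "card (vertices R \<inter> ball 0 1) \<le> card (insert q (W \<inter> ball 0 1))"
        using that insW by (intro card_mono) auto
      also have "\<dots> \<le> Suc (card (W \<inter> ball 0 1))" using insW by (simp add: card_insert_if)
      finally show ?thesis using 1 cP cPi by simp
    qed
    have dropc: ?thesis if "c \<in> convex hull (insert q (W - {c}))" "c \<in> W" for c
    proof (rule drop)
      have "R = convex hull (insert c (insert q (W - {c})))" unfolding R_def
        using that(2) by (metis insert_Diff insert_commute)
      also have "\<dots> = convex hull (insert q (W - {c}))" using that(1) hull_redundant by metis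
      finally show "vertices R \<subseteq> insert q (W - {c})" using vertices_hull_subset by metis
    qed fact
    consider "norm q = 1" | x where "x \<in> W - {a,b}" "orient a q x = 0" | x where "x \<in> W - {a,b}" "orient q b x = 0"
      using Qq by blast
    then show ?thesis
    proof cases
      case 1
      have sub: "vertices R \<subseteq> insert q W" unfolding R_def by (rule vertices_hull_subset)
      then have "card (vertices R) \<le> card (insert q W)" using insW by (intro card_mono) auto
      then have "card (vertices R) \<le> Suc (card W)" using insW by (simp add: card_insert_if split: if_splits)
      moreover have "card (vertices R \<inter> ball 0 1) \<le> card (W \<inter> ball 0 1)"
        using sub insW 1 by (intro card_mono) auto
      ultimately show ?thesis using cP cPi by simp
    next
      case (2 x)
      then have "a \<in> closed_segment q x" using opposite_sides_between[OF 2(2) oq'] oab by auto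
      moreover have "closed_segment q x \<subseteq> convex hull (insert q (W - {a}))"
        unfolding segment_convex_hull using 2 by (intro hull_mono) auto
      ultimately show ?thesis using dropc[of a] abW by blast
    next
      case (3 x)
      have "orient b q x = 0" "orient b a x < 0" "0 < orient b a q"
        using 3 oab[of x] oq' by (auto simp: orient_swap[of b])
      then have "b \<in> closed_segment q x"
        using opposite_sides_between[of b x q a] by (simp add: orient_swap_right[of b x q] closed_segment_commute)
      moreover have "closed_segment q x \<subseteq> convex hull (insert q (W - {b}))"
        unfolding segment_convex_hull using 3 by (intro hull_mono) auto
      ultimately show ?thesis using dropc[of b] abW by blast
    qed
  qed
  show ?thesis
  proof (rule that[of R])
    show "convex_polygon R" unfolding R_def
      using abW insW oq' by (intro convex_polygonI[of _ a b q]) auto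
    show "R \<subseteq> cball 0 1" unfolding R_def using WD Qq by (intro hull_minimal) auto
    show "area R = area P" "mw P < mw R" using q(2,3) unfolding hullq Pp R_def by auto
  qed (use cardR in auto)
qed

lemma dominated_by_inscribed:
  assumes "convex_polygon P" "P \<subseteq> cball 0 1"
  shows "\<exists>Q. inscribed_in_disk Q \<and> card (vertices Q) \<le> card (vertices P) \<and> area Q = area P \<and>
    mw P \<le> mw Q \<and> (\<not> inscribed_in_disk P \<longrightarrow> mw P < mw Q)"
  using assms
proof (induction "card (vertices P) + card (vertices P \<inter> ball 0 1)" arbitrary: P rule: less_induct)
  case less
  show ?case
  proof (cases "inscribed_in_disk P")
    case False
    then obtain p where p: "p \<in> vertices P" "norm p \<noteq> 1"
      using less.prems(1) unfolding inscribed_in_disk_def by (metis mem_sphere_0 subsetI)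
    then have "norm p < 1" using less.prems unfolding vertices_def extreme_point_of_def by fastforce
    from push_vertex[OF less.prems p(1) this]
    obtain R where R: "convex_polygon R" "R \<subseteq> cball 0 1" "area R = area P" "mw P < mw R"
    "card (vertices R) \<le> card (vertices P)"
    "card (vertices R) + card (vertices R \<inter> ball 0 1) < card (vertices P) + card (vertices P \<inter> ball 0 1)"
      by metis
    from less.hyps[OF R(6) R(1,2)] R show ?thesis by (metis dual_order.trans less_le_not_le order_less_le_trans)
  qed (use less.prems in auto)
qed

section \<open>Inscribed polygons and half central angles\<close>

lemma det2_mult: "det2 (p * a) (p * b) = (norm p)\<^sup>2 * det2 a b"
  unfolding cmod_power2 by (simp add: det2_def algebra_simps power2_eq_square)

lemma det2_cis: "det2 (cis a) (cis b) = sin (b - a)"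
  by (simp add: det2_def sin_diff mult.commute)

lemma cis_diff: "cis (2 * y) - cis (2 * x) = (2 * sin (y - x)) *\<^sub>R (\<i> * cis (x + y))"
proof -
  have "cos (2*y) - cos (2*x) = - 2 * sin (y - x) * sin (x + y)"
    using cos_diff_cos[of "2*y" "2*x"] sin_minus[of "y - x"] by (simp add: add.commute add_divide_distrib diff_divide_distrib)
  moreover have "sin (2*y) - sin (2*x) = 2 * sin (y - x) * cos (x + y)"
    using sin_diff_sin[of "2*y" "2*x"] by (simp add: add.commute add_divide_distrib diff_divide_distrib)
  ultimately show ?thesis by (simp add: complex_eq_iff)
qed

text \<open>A chord has direction \<open>\<i>\<close> times the unit vector at the mean angle, so
  the orientation splits into three sines of half-angle differences. All are positive for increasing
  parameters within an interval shorter than \<open>pi\<close>.\<close>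

lemma orient_cis:
  assumes "norm p = 1"
  shows "orient (p * cis (2*x)) (p * cis (2*y)) (p * cis (2*z)) = 4 * sin (y - x) * sin (z - x) * sin (z - y)"
proof -
  have "orient (p * cis (2*x)) (p * cis (2*y)) (p * cis (2*z)) = det2 (cis (2*y) - cis (2*x)) (cis (2*z) - cis (2*x))"
    unfolding orient_def right_diff_distrib[symmetric] det2_mult using assms by simp
  also have "\<dots> = 4 * sin (y - x) * sin (z - x) * det2 (\<i> * cis (x + y)) (\<i> * cis (x + z))"
    unfolding cis_diff by simp
  also have "det2 (\<i> * cis (x + y)) (\<i> * cis (x + z)) = sin (z - y)"
    unfolding det2_mult det2_cis by simp
  finally show ?thesis by simp
qed

locale inscribed_gaps =
  fixes p :: complex and n :: nat and x :: "nat \<Rightarrow> real"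
  assumes p: "norm p = 1" and n: "3 \<le> n" and xpos: "\<And>i. i < n \<Longrightarrow> 0 < x i" and xsum: "(\<Sum>i<n. x i) = pi"
begin

definition vx :: "nat \<Rightarrow> complex" where "vx i = p * cis (2 * (\<Sum>j<i. x j))"

definition poly :: "complex set" where "poly = convex hull (vx ` {..<n})"

lemma partial_less: "i < j \<Longrightarrow> j \<le> n \<Longrightarrow> (\<Sum>k<i. x k) < (\<Sum>k<j. x k)"
proof -
  assume ij: "i < j" "j \<le> n"
  have "{..<j} = {..<i} \<union> {i..<j}" using ij by auto
  then have "(\<Sum>k<j. x k) = (\<Sum>k<i. x k) + (\<Sum>k\<in>{i..<j}. x k)"
    by (simp add: sum.union_disjoint ivl_disj_int)
  moreover have "(\<Sum>k\<in>{i..<j}. x k) > 0" using ij xpos by (intro sum_pos) auto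
  ultimately show ?thesis by simp
qed

lemma cpoly_vx: "cpoly n vx"
  unfolding cpoly_def
proof (intro conjI allI impI)
  fix i j k assume ijk: "i < j \<and> j < k \<and> k < n"
  let ?s = "\<lambda>i. \<Sum>k<i. x k"
  have "?s i < ?s j" "?s j < ?s k" "?s k < ?s n" using ijk by (auto intro: partial_less)
  moreover have "?s i \<ge> 0" using ijk xpos by (intro sum_nonneg less_imp_le) auto
  ultimately show "0 < orient (vx i) (vx j) (vx k)"
    unfolding vx_def orient_cis[OF p] xsum by (intro mult_pos_pos sin_gt_zero) auto
qed (rule n)

sublocale convex_cycle n vx poly
  by unfold_locales (rule cpoly_vx, rule poly_def)

lemma vx_nxt: "i < n \<Longrightarrow> vx (nxt i) = vx (Suc i)"
proof -
  assume "i < n"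
  moreover have "vx n = vx 0" unfolding vx_def xsum by simp
  ultimately show ?thesis using nxt_cases[of i] by metis
qed

lemma dist_side: "i < n \<Longrightarrow> dist (vx i) (vx (nxt i)) = 2 * sin (x i)"
proof -
  assume i: "i < n"
  have "x i \<le> (\<Sum>j<n. x j)" using i xpos by (intro member_le_sum) (auto intro: less_imp_le)
  then have s: "sin (x i) \<ge> 0" using xpos[OF i] xsum by (intro sin_ge_zero) auto
  have "dist (vx i) (vx (nxt i)) = norm (vx (Suc i) - vx i)" unfolding vx_nxt[OF i] by (simp add: dist_norm norm_minus_commute)
  also have "\<dots> = 2 * \<bar>sin (x i)\<bar>"
    unfolding vx_def right_diff_distrib[symmetric] cis_diff norm_mult p
    by (simp add: norm_mult abs_mult)
  finally show ?thesis using s by simp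
qed

lemma det2_side: "i < n \<Longrightarrow> det2 (vx i) (vx (nxt i)) = sin (2 * x i)"
  unfolding vx_nxt unfolding vx_def det2_mult p det2_cis by (simp add: algebra_simps)

lemma mw_poly: "mw poly = 2 * (\<Sum>i<n. sin (x i))"
  unfolding mw_eq sum_distrib_left using dist_side by (intro sum.cong) auto

lemma area_poly: "area poly = (\<Sum>i<n. sin (2 * x i)) / 2"
proof -
  have "(\<Sum>i<n. det2 (vx i) (vx (nxt i))) = (\<Sum>i<n. sin (2 * x i))"
    using det2_side by (intro sum.cong) auto
  then show ?thesis unfolding area_eq by simp
qed

lemma side_lengths_poly: "side_lengths poly = image_mset (\<lambda>i. 2 * sin (x i)) (mset_set {..<n})"
  unfolding side_lengths_eq using dist_side by (intro image_mset_cong) auto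

lemma norm_vx: "norm (vx i) = 1" unfolding vx_def by (simp add: norm_mult p)

lemma inscribed_poly: "inscribed_in_disk poly"
  unfolding inscribed_in_disk_def vertices_eq using convex_polygon norm_vx by auto

lemma poly_subset: "poly \<subseteq> cball 0 1"
  unfolding poly_def using norm_vx by (intro hull_minimal) auto

text \<open>\<open>central_angle\<close> takes values in \<open>[0, pi]\<close>, so twice the gap is
  read off correctly only up to \<open>x i = pi / 2\<close>; beyond that the angle is measured on
  the other side.\<close>

lemma central_angle_side:
  assumes "i < n" "x i \<le> pi / 2"
  shows "central_angle (closed_segment (vx i) (vx (nxt i))) = 2 * x i"
proof -
  have "vx i \<bullet> vx (Suc i) = Re (cnj (vx i) * vx (Suc i))" by (simp add: inner_complex_def)
  also have "cnj (vx i) * vx (Suc i) = (cnj p * p) * (cnj (cis (2 * (\<Sum>j<i. x j))) * cis (2 * (\<Sum>j<Suc i. x j)))"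
    unfolding vx_def by (simp add: algebra_simps)
  also have "cnj p * p = 1" using p by (metis complex_norm_square mult.commute of_real_1 one_power2)
  also have "cnj (cis (2 * (\<Sum>j<i. x j))) * cis (2 * (\<Sum>j<Suc i. x j)) = cis (2 * x i)"
    by (simp add: cis_cnj cis_mult algebra_simps)
  finally have inn: "vx i \<bullet> vx (nxt i) = cos (2 * x i)" using vx_nxt[OF assms(1)] by simp
  have arc: "arccos (cos (2 * x i)) = 2 * x i" using assms xpos[of i] by (intro arccos_cos) auto
  show ?thesis unfolding central_angle_def
  proof (rule the_equality)
    show "\<exists>a b. closed_segment (vx i) (vx (nxt i)) = closed_segment a b \<and> 2 * x i = arccos (a \<bullet> b / (norm a * norm b))"
      using inn arc norm_vx by (intro exI[of _ "vx i"] exI[of _ "vx (nxt i)"]) simp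
    fix t assume "\<exists>a b. closed_segment (vx i) (vx (nxt i)) = closed_segment a b \<and> t = arccos (a \<bullet> b / (norm a * norm b))"
    then obtain a b where "{vx i, vx (nxt i)} = {a, b}" "t = arccos (a \<bullet> b / (norm a * norm b))" by auto
    then have "(vx i = a \<and> vx (nxt i) = b \<or> vx i = b \<and> vx (nxt i) = a) \<and> t = arccos (a \<bullet> b / (norm a * norm b))"
      by (metis doubleton_eq_iff)
    then show "t = 2 * x i" using inn arc norm_vx by (auto simp: inner_commute)
  qed
qed

lemma central_angles_poly:
  assumes "\<And>i. i < n \<Longrightarrow> x i \<le> pi / 2"
  shows "central_angles poly = image_mset (\<lambda>i. 2 * x i) (mset_set {..<n})"
  unfolding central_angles_def mset_sides image_mset.compositionality comp_def
  using central_angle_side assms by (intro image_mset_cong) auto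

end

lemma inscribed_gaps_enumeration:
  assumes \<Theta>: "finite \<Theta>" "0 \<in> \<Theta>" "\<Theta> \<subseteq> {0..<pi}" "3 \<le> card \<Theta>" and p: "norm p = 1"
  obtains \<tau> where "bij_betw \<tau> {..<card \<Theta>} \<Theta>" "\<tau> 0 = 0" "\<tau> (card \<Theta>) = pi"
    "\<And>i j. i < j \<Longrightarrow> j \<le> card \<Theta> \<Longrightarrow> \<tau> i < \<tau> j"
    "inscribed_gaps p (card \<Theta>) (\<lambda>i. \<tau> (Suc i) - \<tau> i)"
    "convex hull ((\<lambda>t. p * cis (2 * t)) ` \<Theta>) = inscribed_gaps.poly p (card \<Theta>) (\<lambda>i. \<tau> (Suc i) - \<tau> i)"
proof -
  let ?n = "card \<Theta>"
  obtain f where f: "bij_betw f {..<?n} \<Theta>" "\<And>i j. i < j \<Longrightarrow> j < ?n \<Longrightarrow> f i < f j"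
    using strict_enumeration[of \<Theta> "\<lambda>t. t"] \<Theta>(1) by auto
  define \<tau> where "\<tau> i = (if i < ?n then f i else pi)" for i
  have bij: "bij_betw \<tau> {..<?n} \<Theta>" using f(1) by (rule bij_betw_cong[THEN iffD1, rotated]) (simp add: \<tau>_def)
  have lt: "\<tau> i < \<tau> j" if "i < j" "j \<le> ?n" for i j
  proof (cases "j < ?n")
    case False
    then have "f i \<in> \<Theta>" using f(1) that by (auto simp: bij_betw_def)
    then show ?thesis using \<Theta>(3) False that by (auto simp: \<tau>_def)
  qed (use f(2) that in \<open>auto simp: \<tau>_def\<close>)
  have \<tau>0: "\<tau> 0 = 0"
  proof -
    obtain i where i: "i < ?n" "\<tau> i = 0" using bij \<Theta>(2) unfolding bij_betw_def by (metis imageE lessThan_iff)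
    have "\<tau> 0 \<in> \<Theta>" using bij \<Theta>(4) by (auto simp: bij_betw_def)
    then have "\<tau> 0 \<ge> 0" using \<Theta>(3) by auto
    then show ?thesis using lt[of 0 i] i by (cases "i = 0") auto
  qed
  have \<tau>n: "\<tau> ?n = pi" by (simp add: \<tau>_def)
  let ?x = "\<lambda>i. \<tau> (Suc i) - \<tau> i"
  have tel: "(\<Sum>i<k. ?x i) = \<tau> k" for k using \<tau>0 by (simp add: sum_lessThan_telescope)
  have G: "inscribed_gaps p ?n ?x"
  proof
    show "0 < ?x i" if "i < ?n" for i using lt[of i "Suc i"] that by simp
    show "(\<Sum>i<?n. ?x i) = pi" unfolding tel by (rule \<tau>n)
  qed (use p \<Theta>(4) in auto)
  have "inscribed_gaps.poly p ?n ?x = convex hull ((\<lambda>i. p * cis (2 * \<tau> i)) ` {..<?n})"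
    unfolding inscribed_gaps.poly_def[OF G] inscribed_gaps.vx_def[OF G] tel ..
  also have "(\<lambda>i. p * cis (2 * \<tau> i)) ` {..<?n} = (\<lambda>t. p * cis (2 * t)) ` \<Theta>"
    using bij unfolding bij_betw_def by (metis image_image)
  finally show ?thesis using that[OF bij \<tau>0 \<tau>n lt G] by simp
qed

lemma circle_param:
  assumes "norm p = 1" "norm v = 1"
  obtains t where "0 \<le> t" "t < pi" "v = p * cis (2 * t)"
proof -
  have "p \<noteq> 0" using assms by auto
  define t where "t = Arg2pi (v / p) / 2"
  have "v / p = norm (v / p) * exp (\<i> * Arg2pi (v / p))" by (rule Arg2pi_eq)
  then have "v / p = cis (2 * t)" unfolding t_def cis_conv_exp using assms by (simp add: norm_divide)
  then have "v = p * cis (2 * t)" using \<open>p \<noteq> 0\<close> by (simp add: field_simps)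
  moreover have "0 \<le> t" "t < pi" unfolding t_def using Arg2pi_ge_0[of "v/p"] Arg2pi_lt_2pi[of "v/p"] by auto
  ultimately show ?thesis using that by blast
qed

lemma inscribed_obtain_gaps:
  assumes "inscribed_in_disk P"
  obtains p x where "inscribed_gaps p (card (vertices P)) x" "P = inscribed_gaps.poly p (card (vertices P)) x"
proof -
  have P: "convex_polygon P" "vertices P \<subseteq> sphere 0 1" using assms by (auto simp: inscribed_in_disk_def)
  note V = convex_polygon_vertices[OF P(1)]
  obtain p where p: "p \<in> vertices P" using convex_polygon_vertices_nonempty[OF P(1)] by blast
  have np: "norm p = 1" using p P(2) by auto
  obtain n v where cyc: "convex_cycle n v P" using convex_polygon_cycle[OF P(1) p] by metis
  have c3: "3 \<le> card (vertices P)" using convex_cycle.card_vertices[OF cyc] convex_cycle.n3[OF cyc] by simp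
  define \<Theta> where "\<Theta> = {t. 0 \<le> t \<and> t < pi \<and> p * cis (2 * t) \<in> vertices P}"
  have inj: "inj_on (\<lambda>t. p * cis (2 * t)) {0..<pi}"
  proof (rule inj_onI)
    fix s t assume st: "s \<in> {0..<pi}" "t \<in> {0..<pi}" "p * cis (2 * s) = p * cis (2 * t)"
    then have "cis (2 * s) = cis (2 * t)" using np by auto
    then have "sin (s - t) = 0" using cis_diff[of s t] by auto
    then show "s = t" using st sin_gt_zero[of "s - t"] sin_gt_zero[of "t - s"] sin_minus[of "s - t"]
      by (cases s t rule: linorder_cases) auto
  qed
  have img: "(\<lambda>t. p * cis (2 * t)) ` \<Theta> = vertices P"
  proof
    show "vertices P \<subseteq> (\<lambda>t. p * cis (2 * t)) ` \<Theta>"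
    proof
      fix v assume v: "v \<in> vertices P"
      then have "norm v = 1" using P(2) by auto
      then obtain t where "0 \<le> t" "t < pi" "v = p * cis (2 * t)" using circle_param[OF np] by metis
      then show "v \<in> (\<lambda>t. p * cis (2 * t)) ` \<Theta>" using v unfolding \<Theta>_def by auto
    qed
  qed (auto simp: \<Theta>_def)
  have sub: "\<Theta> \<subseteq> {0..<pi}" by (auto simp: \<Theta>_def)
  have bij: "bij_betw (\<lambda>t. p * cis (2 * t)) \<Theta> (vertices P)"
    using img inj_on_subset[OF inj sub] by (simp add: bij_betw_def)
  have card: "card \<Theta> = card (vertices P)" "finite \<Theta>" using bij_betw_same_card[OF bij] bij_betw_finite[OF bij] V(1) by auto
  have "0 \<in> \<Theta>" using p unfolding \<Theta>_def by simp
  from inscribed_gaps_enumeration[OF card(2) this sub _ np] c3 card(1) img V(2) that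
  show ?thesis by metis
qed

section \<open>The finite-dimensional problem\<close>

text \<open>Gaps may vanish: polygons with fewer than \<open>n\<close> vertices are then included,
  and the feasible set is closed.\<close>

definition feas :: "nat \<Rightarrow> real \<Rightarrow> (nat \<Rightarrow> real) \<Rightarrow> bool" where
  "feas n A x \<longleftrightarrow> (\<forall>i<n. 0 \<le> x i) \<and> (\<Sum>i<n. x i) = pi \<and> (\<Sum>i<n. sin (2 * x i)) \<le> 2 * A"

definition opt :: "nat \<Rightarrow> real \<Rightarrow> (nat \<Rightarrow> real) \<Rightarrow> bool" where
  "opt n A x \<longleftrightarrow> feas n A x \<and> (\<forall>y. feas n A y \<longrightarrow> (\<Sum>i<n. sin (y i)) \<le> (\<Sum>i<n. sin (x i)))"

lemma feas_le_pi: "feas n A x \<Longrightarrow> i < n \<Longrightarrow> x i \<le> pi"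
  unfolding feas_def using member_le_sum[of i "{..<n}" x] by auto

lemma opt_exists:
  assumes "2 \<le> n" "0 \<le> A"
  shows "\<exists>x. opt n A x"
proof -
  \<comment> \<open>Coordinates from \<open>n\<close> on are pinned to \<open>0\<close>, so that the
    box is compact in the product topology on functions.\<close>
  let ?B = "\<lambda>i. if i < n then {0..pi} else {0::real}"
  define K where "K = {x. \<forall>i. x i \<in> ?B i} \<inter> {x. (\<Sum>i<n. x i) = pi} \<inter> {x. (\<Sum>i<n. sin (2 * x i)) \<le> 2 * A}"
  have "compactin (product_topology (\<lambda>i::nat. euclidean) UNIV) (PiE UNIV ?B)"
    unfolding compactin_PiE by auto
  moreover have "PiE UNIV ?B = {x. \<forall>i. x i \<in> ?B i}" by (auto simp: PiE_def Pi_def)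
  ultimately have c: "compact {x. \<forall>i. x i \<in> ?B i}"
    by (simp add: euclidean_product_topology)
  have [continuous_intros]: "continuous_on S (\<lambda>x::nat\<Rightarrow>real. x i)" for S i
    by (rule continuous_on_subset[OF continuous_on_product_coordinates]) simp
  have "closed {x. (\<Sum>i<n. x i) = pi}" "closed {x. (\<Sum>i<n. sin (2 * x i)) \<le> 2 * A}"
    by (intro closed_Collect_eq closed_Collect_le continuous_intros)+
  then have cK: "compact K" unfolding K_def using c by (simp add: compact_Int_closed)
  \<comment> \<open>The doubled diameter: two gaps \<open>pi / 2\<close> and area zero, feasible for
    every \<open>A \<ge> 0\<close>.\<close>
  define x0 where "x0 i = (if i < (2::nat) then pi / 2 else 0)" for i
  have n2: "{..<n} = {0,1} \<union> {2..<n}" using assms by auto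
  have s2: "(\<Sum>i<n. h (x0 i)) = 2 * h (pi/2)" if "h 0 = 0" for h :: "real \<Rightarrow> real"
  proof -
    have "(\<Sum>i\<in>{2..<n}. h (x0 i)) = 0" using that by (intro sum.neutral) (auto simp: x0_def)
    then show ?thesis unfolding n2 by (subst sum.union_disjoint) (auto simp: x0_def)
  qed
  have "x0 \<in> K" unfolding K_def using s2[of "\<lambda>t. t"] s2[of "\<lambda>t. sin (2 * t)"] assms by (auto simp: x0_def)
  then obtain x where x: "x \<in> K" "\<And>y. y \<in> K \<Longrightarrow> (\<Sum>i<n. sin (y i)) \<le> (\<Sum>i<n. sin (x i))"
    using continuous_attains_sup[OF cK, of "\<lambda>y. \<Sum>i<n. sin (y i)"] by (fastforce intro!: continuous_intros)
  have "feas n A x" using x(1) unfolding K_def feas_def by (auto split: if_splits)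
  moreover have "(\<Sum>i<n. sin (y i)) \<le> (\<Sum>i<n. sin (x i))" if y: "feas n A y" for y
  proof -
    define z where "z i = (if i < n then y i else 0)" for i
    have e: "(\<Sum>i<n. h (z i)) = (\<Sum>i<n. h (y i))" for h :: "real \<Rightarrow> real" by (intro sum.cong) (auto simp: z_def)
    have "z \<in> K" unfolding K_def using y feas_le_pi[OF y] e[of "\<lambda>t. t"] e[of "\<lambda>t. sin (2 * t)"]
      by (auto simp: feas_def z_def)
    then show ?thesis using x(2) e[of sin] by metis
  qed
  ultimately show ?thesis unfolding opt_def by blast
qed

lemma eventually_increase:
  fixes f :: "real \<Rightarrow> real"
  assumes "(f has_real_derivative l) (at 0)" "0 < l"
  shows "\<forall>\<^sub>F h in at_right 0. f 0 < f h"
proof -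
  obtain d where "d > 0" "\<forall>h>0. h < d \<longrightarrow> f 0 < f (0 + h)" using DERIV_pos_inc_right[OF assms] by blast
  then show ?thesis unfolding eventually_at_right_field by auto
qed

lemma eventually_decrease:
  fixes f :: "real \<Rightarrow> real"
  assumes "(f has_real_derivative l) (at 0)" "l < 0"
  shows "\<forall>\<^sub>F h in at_right 0. f h < f 0"
  using eventually_increase[of "\<lambda>h. - f h" "- l"] assms by (auto intro: DERIV_minus)

lemma sum_fun_upd:
  fixes h :: "real \<Rightarrow> real" and x :: "nat \<Rightarrow> real"
  assumes "i < n"
  shows "(\<Sum>l<n. h ((x(i := a)) l)) = (\<Sum>l<n. h (x l)) - h (x i) + h a"
proof -
  have "(\<Sum>l<n. h ((x(i := a)) l)) = h a + (\<Sum>l\<in>{..<n} - {i}. h ((x(i := a)) l))"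
    using assms by (subst sum.remove[of "{..<n}" i]) auto
  also have "(\<Sum>l\<in>{..<n} - {i}. h ((x(i := a)) l)) = (\<Sum>l\<in>{..<n} - {i}. h (x l))" by (intro sum.cong) auto
  also have "\<dots> = (\<Sum>l<n. h (x l)) - h (x i)" using assms by (subst sum.remove[of "{..<n}" i]) auto
  finally show ?thesis by simp
qed

lemma opt_not_improvable3:
  assumes x: "opt n A x" and ijk: "i < n" "j < n" "k < n" "i \<noteq> j" "i \<noteq> k" "j \<noteq> k"
    and nonneg: "0 \<le> a" "0 \<le> b" "0 \<le> c" and s: "a + b + c = x i + x j + x k"
    and area: "sin (2*a) + sin (2*b) + sin (2*c) \<le> sin (2 * x i) + sin (2 * x j) + sin (2 * x k)"
  shows "sin a + sin b + sin c \<le> sin (x i) + sin (x j) + sin (x k)"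
proof -
  let ?y = "x(i := a, j := b, k := c)"
  have e: "(\<Sum>l<n. h (?y l)) = (\<Sum>l<n. h (x l)) - h (x i) - h (x j) - h (x k) + h a + h b + h c" for h :: "real \<Rightarrow> real"
    using ijk by (simp add: sum_fun_upd fun_upd_other del: fun_upd_apply)
  have "feas n A ?y" using x nonneg s area e[of "\<lambda>t. t"] e[of "\<lambda>t. sin (2 * t)"] unfolding opt_def feas_def by auto
  then have "(\<Sum>l<n. sin (?y l)) \<le> (\<Sum>l<n. sin (x l))" using x unfolding opt_def by blast
  then show ?thesis using e[of sin] by simp
qed

text \<open>In contrast to the version with three gaps, the total area is compared with the bound,
  so slack in the constraint can be spent.\<close>

lemma opt_not_improvable2:
  assumes x: "opt n A x" and ij: "i < n" "j < n" "i \<noteq> j"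
    and nonneg: "0 \<le> a" "0 \<le> b" and s: "a + b = x i + x j"
    and area: "(\<Sum>l<n. sin (2 * x l)) + (sin (2*a) + sin (2*b) - sin (2 * x i) - sin (2 * x j)) \<le> 2 * A"
  shows "sin a + sin b \<le> sin (x i) + sin (x j)"
proof -
  let ?y = "x(i := a, j := b)"
  have e: "(\<Sum>l<n. h (?y l)) = (\<Sum>l<n. h (x l)) - h (x i) - h (x j) + h a + h b" for h :: "real \<Rightarrow> real"
    using ij by (simp add: sum_fun_upd fun_upd_other del: fun_upd_apply)
  have "feas n A ?y" using x nonneg s area e[of "\<lambda>t. t"] e[of "\<lambda>t. sin (2 * t)"] unfolding opt_def feas_def by auto
  then have "(\<Sum>l<n. sin (?y l)) \<le> (\<Sum>l<n. sin (x l))" using x unfolding opt_def by blast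
  then show ?thesis using e[of sin] by simp
qed

lemma eventually_pos_shift: "0 < a \<Longrightarrow> \<forall>\<^sub>F h in at_right 0. 0 < a + h * c" for a c :: real
proof -
  assume a: "0 < a"
  have "((\<lambda>h. a + h * c) \<longlongrightarrow> a + 0 * c) (at_right 0)" by (intro tendsto_intros)
  then show ?thesis using a by (auto intro: order_tendstoD)
qed

text \<open>A first-order perturbation: since 1, cos and its square are independent on three distinct
  values, the sum and the area can be controlled separately from the perimeter.\<close>

lemma opt_not_three_values:
  assumes x: "opt n A x" and ijk: "i < n" "j < n" "k < n" "i \<noteq> j" "i \<noteq> k" "j \<noteq> k"
    and pos: "0 < x i" "0 < x j" "0 < x k"
  shows "\<not> (x i \<noteq> x j \<and> x i \<noteq> x k \<and> x j \<noteq> x k)"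
proof
  assume d: "x i \<noteq> x j \<and> x i \<noteq> x k \<and> x j \<noteq> x k"
  note le = feas_le_pi[of n A x]
  have f: "feas n A x" using x by (simp add: opt_def)
  define p q r where "p = cos (x i)" and "q = cos (x j)" and "r = cos (x k)"
  have pqr: "p - q \<noteq> 0" "p - r \<noteq> 0" "q - r \<noteq> 0"
    using d pos le[OF f] ijk cos_inj_pi[of "x i" "x j"] cos_inj_pi[of "x i" "x k"] cos_inj_pi[of "x j" "x k"]
    unfolding p_def q_def r_def by (auto intro: less_imp_le)
  \<comment> \<open>Lagrange weights at the nodes \<open>p\<close>, \<open>q\<close>,
    \<open>r\<close>: they send the polynomials 1, t and t squared to 0, 1 and -1. So the sum of the
    gaps is kept, the perimeter grows at rate 1 and, as the cosine of the double angle is twice the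
    square minus 1, the area term falls at rate 4.\<close>
  define \<alpha> \<beta> \<gamma> where "\<alpha> = (- 1 - (q + r)) / ((p - q) * (p - r))" and "\<beta> = (- 1 - (p + r)) / ((q - p) * (q - r))"
    and "\<gamma> = (- 1 - (p + q)) / ((r - p) * (r - q))"
  have nz: "q - p \<noteq> 0" "r - p \<noteq> 0" "r - q \<noteq> 0" using pqr by auto
  have s0: "\<alpha> + \<beta> + \<gamma> = 0" unfolding \<alpha>_def \<beta>_def \<gamma>_def using pqr nz by (simp add: divide_simps) (simp add: algebra_simps)
  have s1: "\<alpha> * p + \<beta> * q + \<gamma> * r = 1" unfolding \<alpha>_def \<beta>_def \<gamma>_def using pqr nz by (simp add: divide_simps) (simp add: algebra_simps)
  have s2: "\<alpha> * p\<^sup>2 + \<beta> * q\<^sup>2 + \<gamma> * r\<^sup>2 = -1"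
    unfolding \<alpha>_def \<beta>_def \<gamma>_def using pqr nz by (simp add: divide_simps power2_eq_square) (simp add: algebra_simps)
  let ?F = "\<lambda>h. sin (x i + h * \<alpha>) + sin (x j + h * \<beta>) + sin (x k + h * \<gamma>)"
  let ?G = "\<lambda>h. sin (2 * (x i + h * \<alpha>)) + sin (2 * (x j + h * \<beta>)) + sin (2 * (x k + h * \<gamma>))"
  have "(?F has_real_derivative (\<alpha> * p + \<beta> * q + \<gamma> * r)) (at 0)"
    unfolding p_def q_def r_def by (auto intro!: derivative_eq_intros)
  then have 1: "\<forall>\<^sub>F h in at_right 0. ?F 0 < ?F h" by (rule eventually_increase) (simp add: s1)
  have "(?G has_real_derivative (2 * \<alpha> * cos (2 * x i) + 2 * \<beta> * cos (2 * x j) + 2 * \<gamma> * cos (2 * x k))) (at 0)"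
    by (auto intro!: derivative_eq_intros)
  moreover have "2 * \<alpha> * cos (2 * x i) + 2 * \<beta> * cos (2 * x j) + 2 * \<gamma> * cos (2 * x k) 
    = 4 * (\<alpha> * p\<^sup>2 + \<beta> * q\<^sup>2 + \<gamma> * r\<^sup>2) - 2 * (\<alpha> + \<beta> + \<gamma>)"
    unfolding p_def q_def r_def cos_double_cos by (simp add: algebra_simps)
  ultimately have 2: "\<forall>\<^sub>F h in at_right 0. ?G h < ?G 0" using s0 s2 by (intro eventually_decrease) auto
  have "\<forall>\<^sub>F h in at_right 0. ?F 0 < ?F h \<and> ?G h < ?G 0 \<and> 0 < x i + h * \<alpha> \<and> 0 < x j + h * \<beta> \<and> 0 < x k + h * \<gamma>"
    using 1 2 eventually_pos_shift pos by (intro eventually_conj) auto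
  then obtain h where h: "?F 0 < ?F h" "?G h < ?G 0" "0 < x i + h * \<alpha>" "0 < x j + h * \<beta>" "0 < x k + h * \<gamma>"
    using eventually_happens trivial_limit_at_right_real by blast
  have "h * \<alpha> + h * \<beta> + h * \<gamma> = 0" using s0 by (metis distrib_left mult_zero_right)
  then have "?F h \<le> sin (x i) + sin (x j) + sin (x k)"
    using h by (intro opt_not_improvable3[OF x ijk]) auto
  then show False using h(1) by simp
qed

text \<open>Spreading two equal small gaps by \<open>\<plusminus>\<epsilon>\<close> costs perimeter \<open>O(\<eta>)\<close> with \<open>\<eta> = 1 - cos \<epsilon>\<close>; the area saved
  pays for moving \<open>2\<kappa>\<eta>\<close> from the large gap to the small ones, which more than compensates.\<close>

lemma opt_not_two_small:
  assumes x: "opt n A x" and ijk: "i < n" "j < n" "k < n" "i \<noteq> j" "i \<noteq> k" "j \<noteq> k"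
    and pos: "0 < x i" and eq: "x j = x i"
  shows "x k \<le> x i"
proof (rule ccontr)
  assume "\<not> x k \<le> x i"
  define t u where "t = x i" and "u = x k"
  have tu: "0 < t" "t < u" using pos \<open>\<not> x k \<le> x i\<close> by (auto simp: t_def u_def)
  have f: "feas n A x" using x by (simp add: opt_def)
  have "x i + x j + x k = (\<Sum>l\<in>{i,j,k}. x l)" using ijk by simp
  also have "\<dots> \<le> (\<Sum>l<n. x l)" using f ijk unfolding feas_def by (intro sum_mono2) auto
  finally have "2 * t + u \<le> pi" using f eq unfolding feas_def t_def u_def by simp
  then have tpi: "t + u < pi" "t < pi" "u \<le> pi" using tu by auto
  have cc: "cos t > cos u" using tu tpi by (intro cos_monotone_0_pi) auto
  have "cos (pi - u) < cos t" using tu tpi by (intro cos_monotone_0_pi) auto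
  then have cs: "cos t + cos u > 0" by simp
  have st: "sin t > 0" using tu tpi by (intro sin_gt_zero) auto
  have ct: "cos t > 0" using cc cs by linarith
  \<comment> \<open>The window for the rate: above \<open>sin t\<close> the perimeter grows, below
    the right-hand side the area falls. It is nonempty because \<open>cos u < cos t\<close>.\<close>
  have "sin t < 2 * sin t * cos t / (cos t + cos u)"
  proof -
    have "sin t * (cos t + cos u) < sin t * (2 * cos t)" using st cc by (intro mult_strict_left_mono) auto
    then show ?thesis using cs by (simp add: pos_less_divide_eq mult_ac)
  qed
  then obtain K where K: "sin t < K" "K < 2 * sin t * cos t / (cos t + cos u)" using dense by blast
  define \<kappa> where "\<kappa> = K / (cos t - cos u)"
  have Kk: "\<kappa> * (cos t - cos u) = K" unfolding \<kappa>_def using cc by simp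
  \<comment> \<open>The parameter is \<open>h = 1 - cos \<epsilon>\<close>, in which the sums over
    \<open>t \<plusminus> \<epsilon>\<close> are differentiable at \<open>0\<close>, although
    \<open>\<epsilon>\<close> itself grows like a square root of \<open>h\<close>.\<close>
  let ?F = "\<lambda>h. 2 * sin (t + \<kappa> * h) * (1 - h) + sin (u - 2 * \<kappa> * h)"
  let ?G = "\<lambda>h. 2 * sin (2 * t + 2 * \<kappa> * h) * (2 * (1 - h)\<^sup>2 - 1) + sin (2 * u - 4 * \<kappa> * h)"
  have "(?F has_real_derivative (2 * \<kappa> * cos t - 2 * sin t - 2 * \<kappa> * cos u)) (at 0)"
    by (auto intro!: derivative_eq_intros simp: algebra_simps)
  moreover have "2 * \<kappa> * cos t - 2 * sin t - 2 * \<kappa> * cos u = 2 * (K - sin t)" unfolding Kk[symmetric] by (simp add: algebra_simps)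
  ultimately have 1: "\<forall>\<^sub>F h in at_right 0. ?F 0 < ?F h" using K by (intro eventually_increase) auto
  have "(?G has_real_derivative (4 * \<kappa> * cos (2 * t) - 8 * sin (2 * t) - 4 * \<kappa> * cos (2 * u))) (at 0)"
    by (auto intro!: derivative_eq_intros simp: algebra_simps)
  moreover have "4 * \<kappa> * cos (2 * t) - 8 * sin (2 * t) - 4 * \<kappa> * cos (2 * u) < 0"
  proof -
    have "4 * \<kappa> * cos (2 * t) - 4 * \<kappa> * cos (2 * u) = 8 * (\<kappa> * (cos t - cos u)) * (cos t + cos u)"
      unfolding cos_double_cos by (simp add: algebra_simps power2_eq_square)
    moreover have "K * (cos t + cos u) < 2 * sin t * cos t" using K(2) cs by (simp add: pos_less_divide_eq)
    ultimately show ?thesis unfolding Kk sin_double by linarith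
  qed
  ultimately have 2: "\<forall>\<^sub>F h in at_right 0. ?G h < ?G 0" by (rule eventually_decrease)
  \<comment> \<open>\<open>arccos\<close> is continuous but not differentiable at \<open>1\<close>,
    so nonnegativity of the smaller gap comes from a limit.\<close>
  have e3: "((\<lambda>h. t + \<kappa> * h - arccos (1 - h)) \<longlongrightarrow> t + \<kappa> * 0 - arccos (1 - 0)) (at 0 within {0..2})"
  proof -
    have "continuous_on {0..2} (\<lambda>h. t + \<kappa> * h - arccos (1 - h))" by (intro continuous_intros) auto
    then show ?thesis unfolding continuous_on_def by (metis atLeastAtMost_iff order_refl zero_le_numeral)
  qed
  then have "((\<lambda>h. t + \<kappa> * h - arccos (1 - h)) \<longlongrightarrow> t) (at_right 0)"
    using at_within_Icc_at_right[of "0::real" 2] by simp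
  then have 3: "\<forall>\<^sub>F h in at_right 0. 0 < t + \<kappa> * h - arccos (1 - h)" using tu(1) by (rule order_tendstoD)
  have 4: "\<forall>\<^sub>F h in at_right 0. 0 < u + h * (- 2 * \<kappa>)" using tu by (intro eventually_pos_shift) auto
  have 5: "\<forall>\<^sub>F h in at_right (0::real). h < 1 \<and> 0 < h" unfolding eventually_at_right_field by (auto intro: exI[of _ 1])
  have "\<forall>\<^sub>F h in at_right 0. ?F 0 < ?F h \<and> ?G h < ?G 0 \<and> 0 < t + \<kappa> * h - arccos (1 - h) \<and> 0 < u + h * (- 2 * \<kappa>) \<and> h < 1 \<and> 0 < h"
    using 1 2 3 4 5 by eventually_elim blast
  then obtain h where h: "?F 0 < ?F h" "?G h < ?G 0" "0 < t + \<kappa> * h - arccos (1 - h)" "0 < u + h * (- 2 * \<kappa>)" "h < 1" "0 < h"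
    using eventually_happens trivial_limit_at_right_real by blast
  define \<epsilon> where "\<epsilon> = arccos (1 - h)"
  have ce: "cos \<epsilon> = 1 - h" unfolding \<epsilon>_def using h by (intro cos_arccos) auto
  have e0: "0 \<le> \<epsilon>" unfolding \<epsilon>_def using h by (intro arccos_lbound) auto
  let ?a = "t + \<kappa> * h + \<epsilon>" and ?b = "t + \<kappa> * h - \<epsilon>" and ?c = "u - 2 * \<kappa> * h"
  have "sin ?a + sin ?b + sin ?c = ?F h" unfolding sin_add[of "t + \<kappa> * h"] sin_diff[of "t + \<kappa> * h"] ce by simp
  moreover have "sin (2 * ?a) + sin (2 * ?b) + sin (2 * ?c) = ?G h"
  proof -
    have a: "2 * ?a = (2 * t + 2 * \<kappa> * h) + 2 * \<epsilon>" "2 * ?b = (2 * t + 2 * \<kappa> * h) - 2 * \<epsilon>" "2 * ?c = 2 * u - 4 * \<kappa> * h"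
      by (simp_all add: algebra_simps)
    have "cos (2 * \<epsilon>) = 2 * (1 - h)\<^sup>2 - 1" unfolding cos_double_cos ce ..
    then show ?thesis unfolding a sin_add[of "2 * t + 2 * \<kappa> * h"] sin_diff[of "2 * t + 2 * \<kappa> * h"] by simp
  qed
  moreover have "sin ?a + sin ?b + sin ?c \<le> sin (x i) + sin (x j) + sin (x k)"
  proof (rule opt_not_improvable3[OF x ijk])
    show "0 \<le> ?b" "0 \<le> ?c" using h unfolding \<epsilon>_def by (auto simp: mult_ac)
    then show "0 \<le> ?a" using e0 by simp
    show "?a + ?b + ?c = x i + x j + x k" unfolding eq t_def u_def by simp
    show "sin (2 * ?a) + sin (2 * ?b) + sin (2 * ?c) \<le> sin (2 * x i) + sin (2 * x j) + sin (2 * x k)"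
      using h(2) unfolding calculation(2) eq by (simp add: t_def u_def)
  qed
  ultimately show False using h(1) eq by (simp add: t_def u_def)
qed

text \<open>With slack in the area only the sum constrains. Moving a little from a larger gap to a
  smaller one increases the sum of sines, since \<open>cos\<close> is decreasing on
  \<open>[0, pi]\<close>.\<close>

lemma opt_slack_equal:
  assumes x: "opt n A x" and slack: "(\<Sum>l<n. sin (2 * x l)) < 2 * A" and ij: "i < n" "j < n"
  shows "x i = x j"
proof -
  have False if ij: "i < n" "j < n" "x i < x j" for i j
  proof -
    have f: "feas n A x" using x by (simp add: opt_def)
    have x0: "0 \<le> x i" "x j \<le> pi" using f ij feas_le_pi[OF f] by (auto simp: feas_def)
    let ?F = "\<lambda>h. sin (x i + h) + sin (x j - h)"
    let ?G = "\<lambda>h. (\<Sum>l<n. sin (2 * x l)) + (sin (2 * (x i + h)) + sin (2 * (x j - h)) - sin (2 * x i) - sin (2 * x j))"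
    have "cos (x j) < cos (x i)" using x0 ij by (intro cos_monotone_0_pi) auto
    moreover have "(?F has_real_derivative (cos (x i) - cos (x j))) (at 0)"
      by (auto intro!: derivative_eq_intros)
    ultimately have 1: "\<forall>\<^sub>F h in at_right 0. ?F 0 < ?F h" by (intro eventually_increase) auto
    have "(?G \<longlongrightarrow> ?G 0) (at_right 0)" by (intro tendsto_intros)
    then have 2: "\<forall>\<^sub>F h in at_right 0. ?G h < 2 * A" using slack by (intro order_tendstoD) auto
    have "0 < x j" using x0 ij by linarith
    then have 3: "\<forall>\<^sub>F h in at_right 0. 0 < x j + h * (-1)" by (rule eventually_pos_shift)
    have 4: "\<forall>\<^sub>F h in at_right (0::real). 0 < h" unfolding eventually_at_right_field by (auto intro: exI[of _ 1])
    have "\<forall>\<^sub>F h in at_right 0. ?F 0 < ?F h \<and> ?G h < 2 * A \<and> 0 < x j + h * (-1) \<and> 0 < h"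
      using 1 2 3 4 by (intro eventually_conj) auto
    then obtain h where h: "?F 0 < ?F h" "?G h < 2 * A" "0 < x j + h * (-1)" "0 < h"
      using eventually_happens trivial_limit_at_right_real by blast
    have "?F h \<le> sin (x i) + sin (x j)"
      using h x0 ij by (intro opt_not_improvable2[OF x]) auto
    then show False using h(1) by simp
  qed
  then show ?thesis using ij by (metis linorder_neqE_linordered_idom)
qed

text \<open>\<open>reg k\<close> is twice the area of the regular \<open>k\<close>-gon; \<open>prof k t\<close> is twice the area of the \<open>k\<close>-gon with one
  half-angle \<open>t\<close> and the others equal.\<close>

definition reg :: "nat \<Rightarrow> real" where
  "reg k = real k * sin (2 * pi / real k)"

definition prof :: "nat \<Rightarrow> real \<Rightarrow> real" where
  "prof k t = sin (2 * t) + (real k - 1) * sin (2 * ((pi - t) / (real k - 1)))"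

text \<open>The derivative is \<open>2 * cos (2 * t) - 2 * cos (2 * u)\<close>, where
  \<open>u\<close> is the common value of the other half-angles. It is positive because
  \<open>t < u \<le> pi / 2\<close>; the last bound needs \<open>k \<ge> 3\<close>.\<close>

lemma prof_strict_mono:
  assumes k: "3 \<le> k" and st: "0 \<le> s" "s < t" "t \<le> pi / real k"
  shows "prof k s < prof k t"
proof -
  have k1: "real k - 1 > 0" using k by simp
  show ?thesis
  proof (rule DERIV_pos_imp_increasing_open[OF st(2)])
    fix x assume x: "s < x" "x < t"
    have "t * real k \<le> pi" using st(3) k by (simp add: pos_le_divide_eq)
    moreover have "x * real k < t * real k" using x k by simp
    ultimately have xk: "x * real k < pi" by linarith
    define u where "u = (pi - x) / (real k - 1)"
    have "x < u" unfolding u_def using xk k1 by (simp add: pos_less_divide_eq algebra_simps)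
    moreover have "u \<le> pi / 2"
    proof -
      have "pi / 2 * 2 \<le> pi / 2 * (real k - 1)" using k by (intro mult_left_mono) auto
      then have "pi - x \<le> pi / 2 * (real k - 1)" using x st by linarith
      then show ?thesis unfolding u_def using k1 by (simp add: pos_divide_le_eq)
    qed
    ultimately have "cos (2 * u) < cos (2 * x)" using x st by (intro cos_monotone_0_pi) auto
    moreover have "(prof k has_real_derivative (2 * cos (2 * x) - 2 * cos (2 * u))) (at x)"
    proof -
      define c where "c = real k - 1"
      have "c \<noteq> 0" using k1 by (simp add: c_def)
      then have "((\<lambda>t. sin (2 * t) + c * sin (2 * ((pi - t) / c))) has_real_derivative
          (2 * cos (2 * x) - 2 * cos (2 * ((pi - x) / c)))) (at x)"
        by (auto intro!: derivative_eq_intros)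
      then show ?thesis unfolding prof_def u_def c_def .
    qed
    ultimately show "\<exists>y. (prof k has_real_derivative y) (at x) \<and> 0 < y" by (intro exI conjI) auto
  next
    show "continuous_on {s..t} (prof k)" unfolding prof_def using k1 by (intro continuous_intros) auto
  qed
qed

lemma prof_0: "3 \<le> k \<Longrightarrow> prof k 0 = reg (k - 1)"
  by (simp add: prof_def reg_def of_nat_diff)

lemma prof_regular: "3 \<le> k \<Longrightarrow> prof k (pi / real k) = reg k"
proof -
  assume k: "3 \<le> k"
  have "(pi - pi / real k) / (real k - 1) = pi / real k" using k by (simp add: field_simps)
  then show ?thesis unfolding prof_def reg_def using k by (simp add: algebra_simps)
qed

text \<open>The family \<open>prof (Suc k)\<close> runs from the regular \<open>k\<close>-gon, where
  one side has length zero, to the regular polygon with one more side.\<close>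

lemma reg_less_Suc: "2 \<le> k \<Longrightarrow> reg k < reg (Suc k)"
  using prof_strict_mono[of "Suc k" 0 "pi / real (Suc k)"] prof_0[of "Suc k"] prof_regular[of "Suc k"] by simp

lemma reg_mono:
  assumes "2 \<le> j" "j \<le> k" shows "reg j \<le> reg k"
  using assms(2)
proof (induction k rule: dec_induct)
  case (step k)
  then show ?case using reg_less_Suc[of k] assms(1) by simp
qed simp

lemma reg_tendsto: "reg \<longlonglongrightarrow> 2 * pi"
proof -
  have 1: "((\<lambda>x::real. sin x / x) \<longlongrightarrow> 1) (at 0)" using DERIV_sin[of 0] by (simp add: DERIV_def)
  have 2: "filterlim (\<lambda>k. 2 * pi / real k) (at 0) sequentially"
    unfolding filterlim_at
  proof
    show "\<forall>\<^sub>F k in sequentially. 2 * pi / real k \<in> UNIV \<and> 2 * pi / real k \<noteq> 0"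
      using eventually_gt_at_top[of 0] by eventually_elim auto
    show "(\<lambda>k. 2 * pi / real k) \<longlonglongrightarrow> 0" by (rule lim_const_over_n)
  qed
  have "(\<lambda>k. 2 * pi * (sin (2 * pi / real k) / (2 * pi / real k))) \<longlonglongrightarrow> 2 * pi * 1"
    by (intro tendsto_intros filterlim_compose[OF 1 2])
  moreover have "2 * pi * (sin (2 * pi / real k) / (2 * pi / real k)) = reg k" for k
    by (cases "k = 0") (auto simp: reg_def)
  ultimately show ?thesis by simp
qed

section \<open>The unique optimal multiset of gaps\<close>

definition positive_gaps :: "nat \<Rightarrow> (nat \<Rightarrow> real) \<Rightarrow> real multiset" where
  "positive_gaps n x = image_mset x (mset_set {i. i < n \<and> 0 < x i})"

lemma sum_positive_gaps:
  fixes h :: "real \<Rightarrow> real"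
  assumes "\<And>i. i < n \<Longrightarrow> 0 \<le> x i" "h 0 = 0"
  shows "(\<Sum>i<n. h (x i)) = sum_mset (image_mset h (positive_gaps n x))"
proof -
  have "(\<Sum>i<n. h (x i)) = (\<Sum>i\<in>{i. i < n \<and> 0 < x i}. h (x i))"
  proof (intro sum.mono_neutral_right ballI)
    fix i assume "i \<in> {..<n} - {i. i < n \<and> 0 < x i}"
    then have "x i = 0" using assms(1)[of i] by auto
    then show "h (x i) = 0" using assms(2) by simp
  qed auto
  then show ?thesis unfolding positive_gaps_def by (simp add: sum_unfold_sum_mset image_mset.compositionality comp_def)
qed

locale area_param =
  fixes A :: real
  assumes A0: "0 < A" and Api: "A < pi"
begin

definition m :: nat where "m = (LEAST k. 3 \<le> k \<and> 2 * A \<le> reg k)"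

lemma m_props: "3 \<le> m" "2 * A \<le> reg m" "reg (m - 1) < 2 * A"
proof -
  have "\<forall>\<^sub>F k in sequentially. 2 * A < reg k"
    using order_tendstoD(1)[OF reg_tendsto] Api by auto
  then have "\<forall>\<^sub>F k in sequentially. 3 \<le> k \<and> 2 * A \<le> reg k"
    using eventually_ge_at_top[of 3] by eventually_elim auto
  then obtain k where "3 \<le> k \<and> 2 * A \<le> reg k" using eventually_happens by fastforce
  then have m: "3 \<le> m \<and> 2 * A \<le> reg m" unfolding m_def by (rule LeastI)
  then show "3 \<le> m" "2 * A \<le> reg m" by auto
  show "reg (m - 1) < 2 * A"
  proof (cases "m = 3")
    case True
    \<comment> \<open>\<open>reg 2 = 0\<close>: the degenerate polygon with two sides has no
      area.\<close>
    then show ?thesis using A0 by (simp add: reg_def)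
  next
    case False
    then have "m - 1 < m" "3 \<le> m - 1" using m by auto
    then show ?thesis using not_less_Least[of "m - 1" "\<lambda>k. 3 \<le> k \<and> 2 * A \<le> reg k"] unfolding m_def[symmetric] by auto
  qed
qed

lemma m_least: "3 \<le> k \<Longrightarrow> 2 * A \<le> reg k \<Longrightarrow> m \<le> k"
  unfolding m_def by (rule Least_le) simp

text \<open>It exists by intermediate values between \<open>reg (m - 1)\<close> and
  \<open>reg m\<close>, the values of \<open>prof m\<close> at \<open>0\<close> and
  \<open>pi / m\<close>, and is unique by \<open>prof_strict_mono\<close>.\<close>

definition t0 :: real where "t0 = (SOME t. 0 < t \<and> t \<le> pi / real m \<and> prof m t = 2 * A)"

definition u0 :: real where "u0 = (pi - t0) / (real m - 1)"

lemma t0_props: "0 < t0" "t0 \<le> pi / real m" "prof m t0 = 2 * A"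
proof -
  have "continuous_on {0..pi / real m} (prof m)" unfolding prof_def using m_props(1) by (intro continuous_intros) auto
  then obtain t where t: "0 \<le> t" "t \<le> pi / real m" "prof m t = 2 * A"
    using IVT'[of "prof m" 0 "2 * A" "pi / real m"] m_props prof_0[of m] prof_regular[of m] by auto
  moreover have "t \<noteq> 0" using t m_props prof_0[of m] by auto
  ultimately have "\<exists>t. 0 < t \<and> t \<le> pi / real m \<and> prof m t = 2 * A" by (metis less_eq_real_def)
  from someI_ex[OF this] show "0 < t0" "t0 \<le> pi / real m" "prof m t0 = 2 * A" unfolding t0_def by auto
qed

lemma u0_props: "t0 \<le> u0" "u0 \<le> pi / 2" "t0 + (real m - 1) * u0 = pi"
  "sin (2 * t0) + (real m - 1) * sin (2 * u0) = 2 * A"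
proof -
  have m1: "real m - 1 \<ge> 2" using m_props(1) by auto
  show "t0 + (real m - 1) * u0 = pi" unfolding u0_def using m1 by simp
  show "sin (2 * t0) + (real m - 1) * sin (2 * u0) = 2 * A" using t0_props(3) unfolding prof_def u0_def .
  have "t0 * real m \<le> pi" using t0_props(2) m_props(1) by (simp add: pos_le_divide_eq)
  then show "t0 \<le> u0" unfolding u0_def using m1 by (simp add: pos_le_divide_eq algebra_simps)
  have "pi / 2 * 2 \<le> pi / 2 * (real m - 1)" using m1 by (intro mult_left_mono) auto
  then have "pi - t0 \<le> pi / 2 * (real m - 1)" using t0_props(1) by linarith
  then show "u0 \<le> pi / 2" unfolding u0_def using m1 by (simp add: pos_divide_le_eq)
qed

text \<open>For \<open>3 \<le> n < m\<close> even the regular \<open>n\<close>-gon has area below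
  \<open>A\<close>, so the area constraint does not bind and the regular polygon wins.\<close>

definition best :: "nat \<Rightarrow> real multiset" where
  "best n = (if m \<le> n then add_mset t0 (replicate_mset (m - 1) u0) else replicate_mset n (pi / real n))"

text \<open>If the area constraint is slack, all gaps are equal and \<open>n < m\<close>. If it is
  tight, the exclusion of three values and of two equal small gaps leaves one free gap
  \<open>t\<close> besides copies of the largest, and the area equation determines both
  \<open>t\<close> and the number of gaps.\<close>

lemma opt_positive_gaps:
  assumes x: "opt n A x" and n: "3 \<le> n"
  shows "positive_gaps n x = best n"
proof (cases "(\<Sum>l<n. sin (2 * x l)) < 2 * A")
  case True
  define c where "c = x 0"
  have eq: "x i = c" if "i < n" for i using opt_slack_equal[OF x True that, of 0] n by (simp add: c_def)
  have sum_eq: "(\<Sum>i<n. h (x i)) = real n * h c" for h :: "real \<Rightarrow> real" using eq by simp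
  have "real n * c = pi" using x sum_eq[of "\<lambda>t. t"] by (simp add: opt_def feas_def)
  then have c: "c = pi / real n" using n by (simp add: field_simps)
  have "reg n < 2 * A" using True unfolding sum_eq[of "\<lambda>t. sin (2 * t)"] unfolding c reg_def by simp
  then have nm: "n < m" using reg_mono[of m n] m_props by (cases "m \<le> n") auto
  have "{i. i < n \<and> 0 < x i} = {..<n}" using eq c n by auto
  then have "positive_gaps n x = image_mset (\<lambda>i. pi / real n) (mset_set {..<n})"
    unfolding positive_gaps_def using eq c by (auto intro!: image_mset_cong)
  then show ?thesis using nm by (simp add: best_def image_mset_const_eq)
next
  case False
  have f: "feas n A x" using x by (simp add: opt_def)
  have tight: "(\<Sum>l<n. sin (2 * x l)) = 2 * A" using False f by (simp add: feas_def)
  have nonneg: "\<And>i. i < n \<Longrightarrow> 0 \<le> x i" using f by (simp add: feas_def)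
  define S where "S = {i. i < n \<and> 0 < x i}"
  have finS: "finite S" by (simp add: S_def)
  have "S \<noteq> {}"
  proof
    assume "S = {}"
    then have "\<And>i. i < n \<Longrightarrow> x i = 0" using nonneg unfolding S_def by (force simp: less_eq_real_def)
    then have "(\<Sum>i<n. x i) = 0" by simp
    then show False using f by (simp add: feas_def)
  qed
  then have "Max (x ` S) \<in> x ` S" using finS by (intro Max_in) auto
  then obtain k0 where k0: "k0 \<in> S" "Max (x ` S) = x k0" by auto
  define u where "u = x k0"
  have le_u: "x i \<le> u" if "i \<in> S" for i using that finS k0 unfolding u_def by (metis Max_ge finite_imageI imageI)
  have "\<exists>i0\<in>S. \<forall>j\<in>S - {i0}. x j = u"
  proof (cases "\<forall>i\<in>S. x i = u")
    case True
    then show ?thesis using k0 by blast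
  next
    case False
    then obtain i0 where i0: "i0 \<in> S" "x i0 \<noteq> u" by blast
    have "x j = u" if j: "j \<in> S - {i0}" for j
    proof (rule ccontr)
      assume ju: "x j \<noteq> u"
      have d: "i0 < n" "j < n" "k0 < n" "i0 \<noteq> j" "i0 \<noteq> k0" "j \<noteq> k0" "0 < x i0" "0 < x j" "0 < x k0"
        using i0 j ju k0 unfolding S_def u_def by auto
      have "x j = x i0" using opt_not_three_values[OF x d] i0 ju unfolding u_def by auto
      then have "x k0 \<le> x i0" using opt_not_two_small[OF x d(1-7)] by simp
      then show False using le_u[OF i0(1)] i0(2) unfolding u_def by simp
    qed
    then show ?thesis using i0(1) by blast
  qed
  then obtain i0 where i0: "i0 \<in> S" "\<And>j. j \<in> S - {i0} \<Longrightarrow> x j = u" by blast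
  define t where "t = x i0"
  define k where "k = card S"
  have k1: "1 \<le> k" unfolding k_def using finS \<open>S \<noteq> {}\<close> by (simp add: Suc_leI card_gt_0_iff)
  have kn: "k \<le> n" unfolding k_def using card_mono[of "{..<n}" S] by (auto simp: S_def)
  have pg: "positive_gaps n x = add_mset t (replicate_mset (k - 1) u)"
  proof -
    have "positive_gaps n x = image_mset x (mset_set S)" unfolding positive_gaps_def S_def ..
    also have "mset_set S = add_mset i0 (mset_set (S - {i0}))" using i0(1) finS by (simp add: mset_set.remove)
    also have "image_mset x \<dots> = add_mset t (image_mset (\<lambda>_. u) (mset_set (S - {i0})))"
      unfolding t_def using i0(2) finS by (auto intro!: image_mset_cong)
    also have "image_mset (\<lambda>_. u) (mset_set (S - {i0})) = replicate_mset (k - 1) u"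
      using i0(1) finS by (simp add: image_mset_const_eq k_def)
    finally show ?thesis .
  qed
  have val: "(\<Sum>i<n. h (x i)) = h t + (real k - 1) * h u" if "h 0 = 0" for h :: "real \<Rightarrow> real"
    using sum_positive_gaps[of n x h, OF nonneg that] unfolding pg using k1 by (simp add: of_nat_diff)
  have sum_eq: "t + (real k - 1) * u = pi" using val[of "\<lambda>t. t"] f by (simp add: feas_def)
  have area_eq: "sin (2 * t) + (real k - 1) * sin (2 * u) = 2 * A" using val[of "\<lambda>t. sin (2 * t)"] tight by simp
  have t: "0 < t" "t \<le> u" using i0(1) le_u[OF i0(1)] unfolding t_def S_def by auto
  \<comment> \<open>A single gap \<open>pi\<close>, or two gaps with sum \<open>pi\<close>, encloses
    no area.\<close>
  have "k \<noteq> 1" using sum_eq area_eq A0 by auto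
  moreover have "k \<noteq> 2"
  proof
    assume "k = 2"
    then have "2 * u = 2 * pi - 2 * t" using sum_eq by simp
    then have "sin (2 * u) = - sin (2 * t)" by (simp add: sin_diff)
    then show False using area_eq A0 \<open>k = 2\<close> by simp
  qed
  ultimately have k3: "3 \<le> k" using k1 by simp
  have u: "u = (pi - t) / (real k - 1)" using sum_eq k3 by (simp add: field_simps)
  have prof: "prof k t = 2 * A" using area_eq unfolding prof_def u .
  have "(real k - 1) * t \<le> (real k - 1) * u" using t k3 by (intro mult_left_mono) auto
  then have tk: "t \<le> pi / real k" using sum_eq k3 by (simp add: pos_le_divide_eq algebra_simps)
  \<comment> \<open>\<open>prof k\<close> maps \<open>(0, pi / k]\<close> into the interval from
    \<open>reg (k - 1)\<close>, excluded, to \<open>reg k\<close>. These intervals are disjoint for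
    different \<open>k\<close>, so \<open>2 * A\<close> determines \<open>k\<close>.\<close>
  have "2 * A \<le> reg k"
  proof (cases "t = pi / real k")
    case True then show ?thesis using prof prof_regular[OF k3] by simp
  next
    case False then show ?thesis using prof prof_strict_mono[OF k3, of t "pi / real k"] prof_regular[OF k3] t tk by simp
  qed
  moreover have "reg (k - 1) < 2 * A" using prof_strict_mono[OF k3, of 0 t] t tk prof prof_0[OF k3] by simp
  ultimately have "m \<le> k" "\<not> m \<le> k - 1" using m_least[OF k3] reg_mono[of m "k - 1"] m_props by fastforce+
  then have km: "k = m" by simp
  have "t = t0"
  proof (rule linorder_cases[of t t0])
    assume "t < t0" then show ?thesis using prof_strict_mono[OF k3, of t t0] t t0_props prof km by simp
  next
    assume "t0 < t" then show ?thesis using prof_strict_mono[OF k3, of t0 t] tk t0_props prof km by simp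
  qed
  then show ?thesis unfolding pg best_def using km kn u by (simp add: u0_def)
qed

definition best_val :: "nat \<Rightarrow> real" where "best_val n = sum_mset (image_mset sin (best n))"

lemma feas_le_best:
  assumes n: "3 \<le> n" and y: "feas n A y"
  shows "(\<Sum>i<n. sin (y i)) \<le> best_val n"
    and "(\<Sum>i<n. sin (y i)) = best_val n \<Longrightarrow> positive_gaps n y = best n"
proof -
  obtain x where x: "opt n A x" using opt_exists[of n A] n A0 by auto
  then have "feas n A x" by (simp add: opt_def)
  then have "\<And>i. i < n \<Longrightarrow> 0 \<le> x i" by (simp add: feas_def)
  from sum_positive_gaps[of n x sin, OF this] have v: "(\<Sum>i<n. sin (x i)) = best_val n"
    unfolding opt_positive_gaps[OF x n] best_val_def by simp
  then show "(\<Sum>i<n. sin (y i)) \<le> best_val n" using x y unfolding opt_def by metis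
  assume "(\<Sum>i<n. sin (y i)) = best_val n"
  then have "opt n A y" using x y v unfolding opt_def by metis
  then show "positive_gaps n y = best n" using opt_positive_gaps n by blast
qed

definition V :: real where "V = sin t0 + (real m - 1) * sin u0"

lemma best_val_large: "m \<le> n \<Longrightarrow> best_val n = V"
  unfolding best_val_def V_def best_def using m_props(1) by (simp add: of_nat_diff)

lemma feas_pad:
  assumes "feas k A y" "k \<le> n"
  shows "feas n A (\<lambda>i. if i < k then y i else 0)"
    "(\<Sum>i<n. sin (if i < k then y i else 0)) = (\<Sum>i<k. sin (y i))"
proof -
  have e: "(\<Sum>i<n. h (if i < k then y i else 0)) = (\<Sum>i<k. h (y i))" if "h 0 = 0" for h :: "real \<Rightarrow> real"
  proof -
    have "(\<Sum>i<n. h (if i < k then y i else 0)) = (\<Sum>i<k. h (if i < k then y i else 0))"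
      using assms(2) that by (intro sum.mono_neutral_right) auto
    then show ?thesis by simp
  qed
  show "feas n A (\<lambda>i. if i < k then y i else 0)"
    using assms e[of "\<lambda>t. t"] e[of "\<lambda>t. sin (2 * t)"] unfolding feas_def by auto
  show "(\<Sum>i<n. sin (if i < k then y i else 0)) = (\<Sum>i<k. sin (y i))" by (rule e) simp
qed

lemma feas_le_V: "feas k A y \<Longrightarrow> (\<Sum>i<k. sin (y i)) \<le> V"
proof -
  assume y: "feas k A y"
  let ?n = "max k m"
  have "feas ?n A (\<lambda>i. if i < k then y i else 0)" using feas_pad(1)[OF y, of ?n] by simp
  from feas_le_best(1)[OF _ this] show ?thesis
    using feas_pad(2)[OF y, of ?n] best_val_large[of ?n] m_props(1) by simp
qed

text \<open>The doubled diameter is feasible with area zero. The bound lets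
  \<open>convex_bound\<close> treat segments, whose \<open>mw\<close> is at most
  \<open>4\<close>.\<close>

lemma V_ge_2: "2 \<le> V"
proof -
  have "feas 2 A (\<lambda>_. pi / 2)" unfolding feas_def using A0 by (simp add: numeral_2_eq_2)
  from feas_le_V[OF this] show ?thesis by (simp add: numeral_2_eq_2)
qed

section \<open>Solutions of problem (I)\<close>

lemma gaps_feas:
  assumes "inscribed_gaps p k x" "area (inscribed_gaps.poly p k x) \<le> A"
  shows "feas k A x"
proof -
  interpret inscribed_gaps p k x by fact
  show ?thesis using xpos xsum assms(2) unfolding area_poly feas_def by (auto intro: less_imp_le)
qed

lemma inscribed_bound:
  assumes P: "inscribed_in_disk P" "area P \<le> A" and nn: "3 \<le> n" "card (vertices P) \<le> n"
  shows "mw P \<le> 2 * best_val n"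
    and "mw P = 2 * best_val n \<Longrightarrow> side_lengths P = image_mset (\<lambda>x. 2 * sin x) (best n)"
proof -
  let ?k = "card (vertices P)"
  obtain p x where G: "inscribed_gaps p ?k x" and PG: "P = inscribed_gaps.poly p ?k x"
    using inscribed_obtain_gaps[OF P(1)] by metis
  interpret inscribed_gaps p ?k x by fact
  let ?y = "\<lambda>i. if i < ?k then x i else 0"
  have f: "feas ?k A x" using gaps_feas[OF G] P(2) PG by simp
  note pad = feas_pad[OF f nn(2)]
  have mwP: "mw P = 2 * (\<Sum>i<n. sin (?y i))" using mw_poly PG pad(2) by simp
  show "mw P \<le> 2 * best_val n" unfolding mwP using feas_le_best(1)[OF nn(1) pad(1)] by simp
  assume "mw P = 2 * best_val n"
  then have "positive_gaps n ?y = best n" unfolding mwP using feas_le_best(2)[OF nn(1) pad(1)] by simp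
  moreover have "positive_gaps n ?y = image_mset x (mset_set {..<?k})"
  proof -
    have "{i. i < n \<and> 0 < ?y i} = {..<?k}" using xpos nn(2) by auto
    moreover have "image_mset ?y (mset_set {..<?k}) = image_mset x (mset_set {..<?k})"
      by (rule image_mset_cong) simp
    ultimately show ?thesis unfolding positive_gaps_def by argo
  qed
  ultimately have "best n = image_mset x (mset_set {..<?k})" by simp
  then show "side_lengths P = image_mset (\<lambda>x. 2 * sin x) (best n)"
    using side_lengths_poly PG by (simp add: image_mset.compositionality comp_def)
qed

lemma polygon_bound:
  assumes P: "polygon_class n A P" and n: "3 \<le> n"
  shows "perimeter P \<le> 2 * best_val n"
    and "perimeter P = 2 * best_val n \<Longrightarrow> inscribed_in_disk P \<and> side_lengths P = image_mset (\<lambda>x. 2 * sin x) (best n)"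
proof -
  have P': "convex_polygon P" "P \<subseteq> cball 0 1" "card (vertices P) \<le> n" "area P \<le> A"
    using P by (auto simp: polygon_class_def)
  obtain Q where Q: "inscribed_in_disk Q" "card (vertices Q) \<le> card (vertices P)" "area Q = area P"
    "mw P \<le> mw Q" "\<not> inscribed_in_disk P \<Longrightarrow> mw P < mw Q"
    using dominated_by_inscribed[OF P'(1,2)] by auto
  have Qb: "mw Q \<le> 2 * best_val n" using inscribed_bound(1)[OF Q(1) _ n] Q P' by simp
  then show "perimeter P \<le> 2 * best_val n" using Q(4) perimeter_polygon[OF P'(1)] by simp
  assume e: "perimeter P = 2 * best_val n"
  then have "inscribed_in_disk P" using Q(5) Qb perimeter_polygon[OF P'(1)] by fastforce
  then show "inscribed_in_disk P \<and> side_lengths P = image_mset (\<lambda>x. 2 * sin x) (best n)"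
    using inscribed_bound(2)[OF _ P'(4) n P'(3)] e perimeter_polygon[OF P'(1)] by simp
qed

definition best_gap :: "nat \<Rightarrow> real" where "best_gap i = (if i = 0 then t0 else u0)"

lemma sum_best_gap: "(\<Sum>i<m. h (best_gap i)) = h t0 + (real m - 1) * h u0" for h :: "real \<Rightarrow> real"
proof -
  have "{..<m} = insert 0 {1..<m}" using m_props(1) by auto
  then have "(\<Sum>i<m. h (best_gap i)) = h t0 + (\<Sum>i\<in>{1..<m}. h u0)" by (simp add: best_gap_def)
  then show ?thesis using m_props(1) by (simp add: of_nat_diff)
qed

lemma best_gaps: "inscribed_gaps 1 m best_gap"
proof
  show "(\<Sum>i<m. best_gap i) = pi" using sum_best_gap[of "\<lambda>t. t"] u0_props(3) by simp
  show "0 < best_gap i" for i using t0_props(1) u0_props(1) by (simp add: best_gap_def)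
qed (use m_props in auto)

definition best_poly :: "complex set" where "best_poly = inscribed_gaps.poly 1 m best_gap"

lemma best_poly_props:
  "convex_polygon best_poly" "best_poly \<subseteq> cball 0 1" "card (vertices best_poly) = m" "area best_poly = A"
  "perimeter best_poly = 2 * V" "mw best_poly = 2 * V"
proof -
  interpret inscribed_gaps 1 m best_gap by (rule best_gaps)
  show cp: "convex_polygon best_poly" "best_poly \<subseteq> cball 0 1" "card (vertices best_poly) = m"
    unfolding best_poly_def using convex_polygon poly_subset card_vertices by auto
  show "area best_poly = A" unfolding best_poly_def area_poly
    using sum_best_gap[of "\<lambda>t. sin (2 * t)"] u0_props(4) by simp
  show mw: "mw best_poly = 2 * V" unfolding best_poly_def mw_poly V_def using sum_best_gap[of sin] by simp
  then show "perimeter best_poly = 2 * V" using perimeter_polygon[OF cp(1)] by simp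
qed

lemma best_attained:
  assumes n: "3 \<le> n" shows "\<exists>P. polygon_class n A P \<and> perimeter P = 2 * best_val n"
proof (cases "m \<le> n")
  case True
  then have "polygon_class n A best_poly" using best_poly_props by (simp add: polygon_class_def)
  then show ?thesis using best_poly_props(5) best_val_large[OF True] by auto
next
  case False
  have G: "inscribed_gaps 1 n (\<lambda>_. pi / real n)" using n by unfold_locales auto
  interpret inscribed_gaps 1 n "\<lambda>_. pi / real n" by (rule G)
  have "reg n \<le> 2 * A" using m_least[of n] n False by force
  then have "area poly \<le> A" unfolding area_poly reg_def by simp
  then have "polygon_class n A poly" unfolding polygon_class_def
    using convex_polygon poly_subset card_vertices by simp
  moreover have "perimeter poly = 2 * best_val n"
    unfolding perimeter_polygon[OF convex_polygon] mw_poly best_val_def best_def using False by simp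
  ultimately show ?thesis by blast
qed

lemma solution_I_iff:
  assumes n: "3 \<le> n"
  shows "solution_I n A P \<longleftrightarrow> polygon_class n A P \<and> perimeter P = 2 * best_val n"
proof -
  obtain Q where Q: "polygon_class n A Q" "perimeter Q = 2 * best_val n" using best_attained[OF n] by blast
  have "\<not> perimeter P < perimeter Q \<Longrightarrow> polygon_class n A P \<Longrightarrow> perimeter P = 2 * best_val n"
    using polygon_bound(1)[OF _ n, of P] Q(2) by simp
  then show ?thesis unfolding solution_I_def is_arg_max_def
    using Q polygon_bound(1)[OF _ n] by (metis leD)
qed

lemma solution_I_exists: "3 \<le> n \<Longrightarrow> \<exists>P. solution_I n A P"
  using best_attained solution_I_iff by blast

lemma solution_I_side_lengths:
  assumes "3 \<le> n" "solution_I n A P"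
  shows "side_lengths P = image_mset (\<lambda>x. 2 * sin x) (best n)"
  using polygon_bound(2)[OF _ assms(1)] assms solution_I_iff by blast

lemma best_large: "m \<le> n \<Longrightarrow> best n = best m"
  by (simp add: best_def)

end

section \<open>Replacing a cap by a triangle\<close>

text \<open>The function \<open>sqrt (S\<^sup>2 - k) - S\<close> does not decrease in
  \<open>S\<close>, and increases strictly if \<open>k\<close> is positive. In the application
  \<open>S\<close> is the sum of the two lengths cut off at a corner.\<close>

lemma sqrt_shift:
  fixes S :: real
  assumes "0 \<le> S" "S \<le> S'" "0 \<le> k" "k \<le> S\<^sup>2"
  shows "S' - S \<le> sqrt (S'\<^sup>2 - k) - sqrt (S\<^sup>2 - k)"
    and "S < S' \<Longrightarrow> 0 < k \<Longrightarrow> S' - S < sqrt (S'\<^sup>2 - k) - sqrt (S\<^sup>2 - k)"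
proof -
  define f where "f = sqrt (S\<^sup>2 - k)"
  have f2: "f\<^sup>2 = S\<^sup>2 - k" "0 \<le> f" using assms by (auto simp: f_def)
  have fS: "f \<le> S" unfolding f_def using assms by (intro real_le_lsqrt) auto
  have e: "S'\<^sup>2 - k - (f + (S' - S))\<^sup>2 = 2 * (S - f) * (S' - S)"
    using f2(1) by (simp add: power2_eq_square algebra_simps)
  have "0 \<le> (S - f) * (S' - S)" using fS assms by simp
  then have "(f + (S' - S))\<^sup>2 \<le> S'\<^sup>2 - k" using e by linarith
  then have "f + (S' - S) \<le> sqrt (S'\<^sup>2 - k)" by (rule real_le_rsqrt)
  then show "S' - S \<le> sqrt (S'\<^sup>2 - k) - sqrt (S\<^sup>2 - k)" by (simp add: f_def)
  assume s: "S < S'" "0 < k"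
  have "f \<noteq> S" using f2 s by auto
  then have "0 < (S - f) * (S' - S)" using fS s by simp
  then have "(f + (S' - S))\<^sup>2 < S'\<^sup>2 - k" using e by linarith
  then have "f + (S' - S) < sqrt (S'\<^sup>2 - k)" by (rule real_less_rsqrt)
  then show "S' - S < sqrt (S'\<^sup>2 - k) - sqrt (S\<^sup>2 - k)" by (simp add: f_def)
qed

text \<open>The law of cosines, arranged so that for fixed \<open>r * s\<close>, that is for fixed
  area cut off, the length of the cut depends only on the sum
  \<open>r * norm A + s * norm B\<close>.\<close>

lemma norm_diff_scaled:
  fixes A B :: complex
  shows "norm (r *\<^sub>R A - s *\<^sub>R B) = sqrt ((r * norm A + s * norm B)\<^sup>2 - 2 * (r * s) * (norm A * norm B + A \<bullet> B))"
proof -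
  have "(norm (r *\<^sub>R A - s *\<^sub>R B))\<^sup>2 = (r * norm A)\<^sup>2 + (s * norm B)\<^sup>2 - 2 * (r * s) * (A \<bullet> B)"
    by (simp add: power2_norm_eq_inner inner_diff_left inner_diff_right inner_commute power_mult_distrib algebra_simps)
      (simp add: power2_eq_square flip: power2_norm_eq_inner)
  also have "\<dots> = (r * norm A + s * norm B)\<^sup>2 - 2 * (r * s) * (norm A * norm B + A \<bullet> B)"
    by (simp add: power2_eq_square algebra_simps)
  finally show ?thesis by (metis norm_ge_zero real_sqrt_unique)
qed

text \<open>Cutting a corner \<open>o\<close> along a segment of fixed area costs least perimeter when the cut passes
  through the farther end.\<close>

lemma corner_cut_far:
  assumes r: "0 \<le> r" "r \<le> 1" and s: "0 \<le> s" "s \<le> 1" and far: "norm B \<le> norm (A::complex)"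
  shows "norm (A - r *\<^sub>R A) + norm (r *\<^sub>R A - s *\<^sub>R B) + norm (s *\<^sub>R B - B)
       \<le> norm (A - (r * s) *\<^sub>R B) + norm ((r * s) *\<^sub>R B - B)" (is "?l \<le> ?r")
    and "0 < r \<Longrightarrow> r < 1 \<Longrightarrow> 0 < s \<Longrightarrow> s < 1 \<Longrightarrow> det2 A B \<noteq> 0 \<Longrightarrow>
      norm (A - r *\<^sub>R A) + norm (r *\<^sub>R A - s *\<^sub>R B) + norm (s *\<^sub>R B - B)
       < norm (A - (r * s) *\<^sub>R B) + norm ((r * s) *\<^sub>R B - B)"
proof -
  \<comment> \<open>\<open>k\<close> depends only on \<open>r * s\<close>, so it is the same for
    both cuts. \<open>S\<close> belongs to the given cut and \<open>S'\<close> to the cut through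
    \<open>A\<close>; they differ by \<open>(1 - r) * (P - s * Q)\<close>, which is nonnegative
    because \<open>A\<close> is the farther end.\<close>
  define P Q where "P = norm A" and "Q = norm B"
  define k where "k = 2 * (r * s) * (P * Q + A \<bullet> B)"
  define S S' where "S = r * P + s * Q" and "S' = P + (r * s) * Q"
  have n: "norm (r *\<^sub>R A - s *\<^sub>R B) = sqrt (S\<^sup>2 - k)"
    unfolding norm_diff_scaled S_def k_def P_def Q_def ..
  have n': "norm (A - (r * s) *\<^sub>R B) = sqrt (S'\<^sup>2 - k)"
    using norm_diff_scaled[of 1 A "r * s" B] unfolding S'_def k_def P_def Q_def by simp
  have e1: "norm (A - r *\<^sub>R A) = (1 - r) * P"
  proof -
    have "A - r *\<^sub>R A = (1 - r) *\<^sub>R A" by (simp add: algebra_simps)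
    then show ?thesis using r by (simp add: P_def)
  qed
  have e2: "norm (t *\<^sub>R B - B) = (1 - t) * Q" if "t \<le> 1" for t
  proof -
    have "t *\<^sub>R B - B = (t - 1) *\<^sub>R B" by (simp add: algebra_simps)
    then show ?thesis using that by (simp add: Q_def)
  qed
  have rs: "r * s \<le> 1" "0 \<le> r * s" using r s by (auto simp: mult_le_one)
  have PQ: "0 \<le> Q" "Q \<le> P" "0 \<le> P" using far by (auto simp: P_def Q_def)
  have "- (A \<bullet> B) \<le> P * Q" using norm_cauchy_schwarz[of "-A" B] by (simp add: P_def Q_def)
  then have k0: "0 \<le> k" unfolding k_def using rs by simp
  have "sQ": "s * Q \<le> Q" using s PQ by (simp add: mult_left_le_one_le)
  have SS: "S' - S = (1 - r) * (P - s * Q)" unfolding S_def S'_def by (simp add: algebra_simps)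
  have S: "0 \<le> S" "S \<le> S'"
  proof -
    show "0 \<le> S" unfolding S_def using r s PQ by simp
    have "0 \<le> (1 - r) * (P - s * Q)" using r sQ PQ by (intro mult_nonneg_nonneg) auto
    then show "S \<le> S'" using SS by linarith
  qed
  have kS: "k \<le> S\<^sup>2"
  proof -
    have "0 \<le> (norm (r *\<^sub>R A - s *\<^sub>R B))\<^sup>2" by simp
    moreover have "(norm (r *\<^sub>R A - s *\<^sub>R B))\<^sup>2 = S\<^sup>2 - k"
      by (simp add: power2_norm_eq_inner S_def k_def P_def Q_def inner_diff_left inner_diff_right inner_commute algebra_simps)
        (simp add: power2_eq_square algebra_simps flip: power2_norm_eq_inner)
    ultimately show ?thesis by simp
  qed
  have L: "?l = P + Q - (S - sqrt (S\<^sup>2 - k))" "?r = P + Q - (S' - sqrt (S'\<^sup>2 - k))"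
    unfolding n n' e1 using e2[of s] e2[of "r * s"] s rs unfolding S_def S'_def by (simp_all add: algebra_simps)
  show "?l \<le> ?r" unfolding L using sqrt_shift(1)[OF S k0 kS] by simp
  assume st: "0 < r" "r < 1" "0 < s" "s < 1" "det2 A B \<noteq> 0"
  have "B \<noteq> 0" using st by auto
  then have "0 < Q" by (simp add: Q_def)
  then have "s * Q < Q" using st by simp
  then have "0 < (1 - r) * (P - s * Q)" using st PQ by simp
  then have "S < S'" using SS by linarith
  \<comment> \<open>\<open>k = 0\<close> would be equality in Cauchy-Schwarz with opposite vectors,
    which \<open>det2 A B \<noteq> 0\<close> excludes.\<close>
  moreover have "0 < k"
  proof -
    have "norm A * norm B + A \<bullet> B \<noteq> 0"
    proof
      assume "norm A * norm B + A \<bullet> B = 0"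
      then have "(A \<bullet> B)\<^sup>2 = (norm A)\<^sup>2 * (norm B)\<^sup>2" by (metis add_eq_0_iff power2_minus power_mult_distrib)
      then have "(det2 A B)\<^sup>2 = 0"
        unfolding cmod_power2 by (simp add: det2_def inner_complex_def power2_eq_square algebra_simps)
      then show False using st by simp
    qed
    then have "k \<noteq> 0" unfolding k_def P_def Q_def using st by simp
    then show ?thesis using k0 by simp
  qed
  ultimately show "?l < ?r" unfolding L using sqrt_shift(2)[OF S k0 kS] by simp
qed

text \<open>The new cut starts at whichever of \<open>a\<close> and \<open>b\<close> is farther from
  \<open>q\<close>, and \<open>w\<close> is its other end; it turns a quadrilateral into a triangle
  of equal area.\<close>

lemma corner_cut:
  assumes r: "0 \<le> r" "r \<le> 1" and s: "0 \<le> s" "s \<le> 1"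
    and x: "x = q + r *\<^sub>R (a - q)" and y: "y = q + s *\<^sub>R (b - q)"
  obtains w where "w = q + (r * s) *\<^sub>R (a - q) \<or> w = q + (r * s) *\<^sub>R (b - q)"
    "dist a x + dist x y + dist y b \<le> dist a w + dist w b"
    "0 < r \<Longrightarrow> r < 1 \<Longrightarrow> 0 < s \<Longrightarrow> s < 1 \<Longrightarrow> orient q a b \<noteq> 0 \<Longrightarrow> dist a x + dist x y + dist y b < dist a w + dist w b"
proof -
  define A B where "A = a - q" and "B = b - q"
  have d: "dist (q + t *\<^sub>R C) (q + u *\<^sub>R E) = norm (t *\<^sub>R C - u *\<^sub>R E)" for t u C E
    by (simp add: dist_norm)
  have aq: "a = q + 1 *\<^sub>R A" "b = q + 1 *\<^sub>R B" by (simp_all add: A_def B_def)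
  have xy: "x = q + r *\<^sub>R A" "y = q + s *\<^sub>R B" using x y by (simp_all add: A_def B_def)
  have o: "orient q a b = det2 A B" by (simp add: orient_def A_def B_def)
  show ?thesis
  proof (cases "norm B \<le> norm A")
    case True
    show ?thesis
    proof (rule that[of "q + (r * s) *\<^sub>R B"])
      show "dist a x + dist x y + dist y b \<le> dist a (q + (r * s) *\<^sub>R B) + dist (q + (r * s) *\<^sub>R B) b"
        using corner_cut_far(1)[OF r s True] unfolding aq xy d by simp
      show "dist a x + dist x y + dist y b < dist a (q + (r * s) *\<^sub>R B) + dist (q + (r * s) *\<^sub>R B) b"
        if "0 < r" "r < 1" "0 < s" "s < 1" "orient q a b \<noteq> 0"
      proof -
        have "det2 A B \<noteq> 0" using that(5) o by simp
        from corner_cut_far(2)[OF r s True that(1-4) this] show ?thesis unfolding aq xy d by simp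
      qed
    qed (simp add: B_def)
  next
    case False
    then have F: "norm A \<le> norm B" by simp
    have c: "norm (s *\<^sub>R B - r *\<^sub>R A) = norm (r *\<^sub>R A - s *\<^sub>R B)" "norm (B - s *\<^sub>R B) = norm (s *\<^sub>R B - B)"
      "norm (r *\<^sub>R A - A) = norm (A - r *\<^sub>R A)" "norm (B - (s * r) *\<^sub>R A) = norm ((r * s) *\<^sub>R A - B)"
      "norm ((s * r) *\<^sub>R A - A) = norm (A - (r * s) *\<^sub>R A)"
      by (metis norm_minus_commute mult.commute)+
    show ?thesis
    proof (rule that[of "q + (r * s) *\<^sub>R A"])
      show "dist a x + dist x y + dist y b \<le> dist a (q + (r * s) *\<^sub>R A) + dist (q + (r * s) *\<^sub>R A) b"
        using corner_cut_far(1)[OF s r F] unfolding aq xy d c by simp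
      show "dist a x + dist x y + dist y b < dist a (q + (r * s) *\<^sub>R A) + dist (q + (r * s) *\<^sub>R A) b"
        if "0 < r" "r < 1" "0 < s" "s < 1" "orient q a b \<noteq> 0"
      proof -
        have "det2 B A \<noteq> 0" using that(5) o det2_swap[of A B] by simp
        from corner_cut_far(2)[OF s r F that(3,4,1,2) this] show ?thesis unfolding aq xy d c by simp
      qed
    qed (simp add: A_def)
  qed
qed

lemma in_triangleD:
  assumes "x \<in> convex hull {a,b,c}" "0 \<le> orient a b c"
  shows "0 \<le> orient a b x" "0 \<le> orient b c x" "0 \<le> orient c a x"
proof -
  have "orient b c a = orient a b c" "orient c a b = orient a b c" using orient_cyclic by metis+
  then have "convex hull {a,b,c} \<subseteq> {x. 0 \<le> orient a b x}" "convex hull {a,b,c} \<subseteq> {x. 0 \<le> orient b c x}"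
     "convex hull {a,b,c} \<subseteq> {x. 0 \<le> orient c a x}"
    using assms(2) by (intro hull_minimal convex_orient_ge; simp)+
  with assms(1) show "0 \<le> orient a b x" "0 \<le> orient b c x" "0 \<le> orient c a x" by auto
qed

lemma in_triangleI':
  assumes "0 < orient a b c" "0 \<le> orient a b x" "0 \<le> orient b c x" "0 \<le> orient c a x"
  shows "x \<in> convex hull {a,b,c}"
  using assms orient_cyclic by (intro in_triangleI) metis+

text \<open>Either cut removes the fraction \<open>r * s\<close> of the triangle
  \<open>q a b\<close>.\<close>

lemma corner_cut_area:
  assumes "x = q + r *\<^sub>R (a - q)" "y = q + s *\<^sub>R (b - q)" "w = q + (r * s) *\<^sub>R (a - q) \<or> w = q + (r * s) *\<^sub>R (b - q)"
  shows "orient a w b = orient a x b + orient x y b"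
  using assms(3)
proof
  assume w: "w = q + (r * s) *\<^sub>R (a - q)"
  show ?thesis unfolding assms(1,2) w by (simp add: orient_simps algebra_simps)
next
  assume w: "w = q + (r * s) *\<^sub>R (b - q)"
  show ?thesis unfolding assms(1,2) w by (simp add: orient_simps algebra_simps)
qed

text \<open>Let \<open>x\<close> be the vertex after \<open>a\<close>. By induction the part beyond
  the chord \<open>x b\<close> may be replaced by a triangle \<open>x y b\<close> inside the smaller
  triangle with apex \<open>q1\<close>, where the ray \<open>a x\<close> meets \<open>q b\<close>.
  The remaining quadrilateral \<open>a x y b\<close> is a triangle with one corner cut off, and
  \<open>corner_cut\<close> moves this cut to an end without losing perimeter.\<close>

lemma polygon_cap:
  assumes "finite V" "a \<in> V" "b \<in> V" "V \<subseteq> convex hull {a,q,b}" "0 < orient a q b"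
  shows "\<exists>v\<in>convex hull {a,q,b}. area (convex hull {a,v,b}) \<le> area (convex hull V) \<and>
    mw (convex hull V) \<le> dist a v + dist v b + dist b a"
  using assms
proof (induction "card V" arbitrary: V a q rule: less_induct)
  case less
  let ?D = "orient a q b"
  have inT: "0 \<le> orient a q z" "0 \<le> orient q b z" "0 \<le> orient b a z" if "z \<in> V" for z
    using in_triangleD[of z a q b] that less.prems by auto
  have ba: "b \<noteq> a" using less.prems(5) by auto
  show ?case
  proof (cases "\<forall>z\<in>V. orient b a z = 0")
    case True
    \<comment> \<open>All points lie on the chord, so the degenerate triangle with apex
      \<open>a\<close> serves.\<close>
    have "z \<in> closed_segment a b" if "z \<in> V" for z
    proof (rule line_wedge[of a b z "q - a" "b - q"])
      show "orient a b z = 0" using True that orient_swap[of a b z] by simp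
      show "0 < det2 (q - a) (b - a)" using less.prems(5) by (simp add: orient_def)
      show "0 < det2 (b - q) (a - b)" using less.prems(5) by (simp add: orient_simps algebra_simps)
      show "0 \<le> det2 (q - a) (z - a)" using inT(1)[OF that] by (simp only: orient_def)
      show "0 \<le> det2 (b - q) (z - b)" using inT(2)[OF that] by (simp add: orient_simps algebra_simps)
    qed
    then have "convex hull V \<subseteq> closed_segment a b" by (intro hull_minimal) auto
    then have "mw (convex hull V) \<le> mw (closed_segment a b)"
      using less.prems by (intro mw_mono) (auto simp: compact_imp_bounded)
    then have "mw (convex hull V) \<le> dist a a + dist a b + dist b a" by (simp add: mw_segment dist_commute)
    moreover have "area (convex hull {a,a,b}) \<le> area (convex hull V)"
      unfolding area_triangle by (simp add: area_def)
    ultimately show ?thesis by (intro bexI[of _ a]) (auto intro: hull_inc)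
  next
    case False
    \<comment> \<open>The vertex following \<open>a\<close>: all points lie to the left of the ray from \<open>a\<close> through it.\<close>
    define f where "f z = orient b a z / (orient b a z + orient a q z)" for z
    have pos: "0 < orient b a z + orient a q z" if z: "z \<in> V" "z \<noteq> a" for z
    proof (rule ccontr)
      assume "\<not> ?thesis"
      then have "orient b a z = 0" "orient a q z = 0" using inT[OF z(1)] by linarith+
      then obtain s where s: "z = a + s *\<^sub>R (b - a)" using orient_eq_0_iff[of a b z] ba orient_swap[of a b z] by auto
      have "orient a q z = s * ?D" unfolding s by (simp add: orient_simps algebra_simps)
      then have "s = 0" using \<open>orient a q z = 0\<close> less.prems(5) by simp
      then show False using s z by simp
    qed
    have "b \<in> V - {a}" "finite (V - {a})" using less.prems ba by auto
    then have "Max (f ` (V - {a})) \<in> f ` (V - {a})" by (intro Max_in) auto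
    then obtain x where x: "x \<in> V - {a}" "Max (f ` (V - {a})) = f x" by auto
    have x: "x \<in> V - {a}" "\<And>z. z \<in> V - {a} \<Longrightarrow> f z \<le> f x"
      using x Max_ge[of "f ` (V - {a})"] \<open>finite (V - {a})\<close> by auto
    have left: "0 \<le> orient a x z" if z: "z \<in> V" for z
    proof (cases "z = a")
      case False
      have "orient b a z * (orient b a x + orient a q x) \<le> orient b a x * (orient b a z + orient a q z)"
        using x(2)[of z] z False pos[of z] pos[of x] x(1) unfolding f_def by (simp add: pos_divide_le_eq pos_le_divide_eq divide_simps)
      then have "0 \<le> orient b a x * orient a q z - orient b a z * orient a q x" by (simp add: algebra_simps)
      moreover have "?D * orient a x z = orient b a x * orient a q z - orient b a z * orient a q x"
        by (simp add: orient_simps algebra_simps)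
      ultimately show ?thesis using less.prems(5) by (metis zero_le_mult_iff less_le_not_le)
    qed simp
    have fpos: "0 < orient b a x"
    proof -
      obtain z where z: "z \<in> V" "orient b a z \<noteq> 0" using False by blast
      then have "z \<noteq> a" "0 < orient b a z" using inT(3)[OF z(1)] by auto
      then have "0 < f z" unfolding f_def using pos[OF z(1)] by simp
      then have "0 < f x" using x(2)[of z] z \<open>z \<noteq> a\<close> by auto
      then show ?thesis unfolding f_def using pos[of x] x(1) by (simp add: zero_less_divide_iff) 
    qed
    have axb: "0 < orient a x b" using fpos orient_cyclic[of b a x] by simp
    \<comment> \<open>The points on or beyond the chord \<open>x b\<close>. They do not include
      \<open>a\<close>, so the induction hypothesis applies to them.\<close>
    define V1 where "V1 = {z \<in> V. 0 \<le> orient b x z \<and> z \<noteq> a}"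
    have oV1: "orient b x a < 0" using axb by (simp add: orient_simps algebra_simps)
    have V1: "finite V1" "x \<in> V1" "b \<in> V1" "a \<notin> V1" "V1 \<subseteq> V"
      using less.prems x(1) ba unfolding V1_def by auto
    have cardV1: "card V1 < card V" using V1 less.prems by (intro psubset_card_mono) auto
    let ?X = "convex hull V1"
    have hullV: "convex hull V = convex hull (insert a ?X)"
    proof
      have "z \<in> convex hull (insert a ?X)" if "z \<in> V" for z
      proof (cases "z \<in> V1 \<or> z = a")
        case True then show ?thesis by (auto intro: hull_inc)
      next
        case False
        then have "0 \<le> orient x b z" using that unfolding V1_def using orient_swap[of b x z] by auto
        then have "z \<in> convex hull {a,x,b}" using left[OF that] inT(3)[OF that] axb by (intro in_triangleI') auto
        moreover have "convex hull {a,x,b} \<subseteq> convex hull (insert a ?X)" using V1 by (intro hull_mono) (auto intro: hull_inc)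
        ultimately show ?thesis by blast
      qed
      then show "convex hull V \<subseteq> convex hull (insert a ?X)" by (intro hull_minimal) auto
      show "convex hull (insert a ?X) \<subseteq> convex hull V"
        unfolding hull_insert_hull using V1 less.prems by (intro hull_mono) auto
    qed
    have X: "compact ?X" "convex ?X" "b \<in> ?X" "x \<in> ?X" using V1 by (auto intro!: finite_imp_compact_convex_hull hull_inc)
    have "?X \<subseteq> {z. 0 \<le> orient b x z} \<inter> {z. 0 \<le> orient b a z} \<inter> {z. 0 \<le> orient a x z}"
      using inT left unfolding V1_def by (intro hull_minimal convex_Int convex_orient_ge) auto
    then have oX: "0 \<le> orient b x z" "0 \<le> orient b a z" "0 \<le> orient a x z" if "z \<in> ?X" for z using that by auto
    have g: "mw (convex hull V) = mw ?X + dist b a + dist a x - dist b x"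
       "area (convex hull V) = area ?X - orient b x a / 2"
      unfolding hullV using apex_glue(2,3)[OF X oX(1) oV1 oX(2) oX(3)] by auto
    have orba: "orient b x a = - orient a x b" by (simp add: orient_simps algebra_simps)
    have xT: "x \<in> convex hull {a,q,b}" using x less.prems by auto
    show ?thesis
    proof (cases "orient q b x = 0")
      case True
      \<comment> \<open>Here \<open>x\<close> lies on the side \<open>q b\<close>, so nothing lies
        strictly beyond the chord \<open>x b\<close> and the triangle \<open>a x b\<close>
        suffices.\<close>
      have "z \<in> closed_segment x b" if z: "z \<in> V1" for z
      proof -
        have zV: "z \<in> V" using z V1 by auto
        have qb: "q \<noteq> b" using less.prems(5) by auto
        obtain s where s: "x = q + s *\<^sub>R (b - q)" using orient_eq_0_iff[OF qb, THEN iffD1, OF True] by blast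
        have s1: "s < 1" using axb less.prems(5) 
        proof -
          have "orient a x b = (1 - s) * ?D" unfolding s by (simp add: orient_simps algebra_simps)
          then show ?thesis using axb less.prems(5) by (simp add: zero_less_mult_iff)
        qed
        have "orient b x z = - (1 - s) * orient q b z" unfolding s by (simp add: orient_simps algebra_simps)
        moreover have "0 \<le> orient b x z" using z by (simp add: V1_def)
        ultimately have "orient q b z = 0" using inT(2)[OF zV] s1 by (simp add: mult_le_0_iff zero_le_mult_iff)
        then have xbz: "orient x b z = 0" unfolding s by (simp add: orient_simps algebra_simps) algebra
        show ?thesis
        proof (rule line_wedge[OF xbz, of "x - a" "a - b"])
          show "0 < det2 (x - a) (b - x)" using axb by (simp add: orient_simps algebra_simps)
          show "0 < det2 (a - b) (x - b)" using axb by (simp add: orient_simps algebra_simps)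
          show "0 \<le> det2 (x - a) (z - x)" using left[OF zV] by (simp add: orient_simps algebra_simps)
          show "0 \<le> det2 (a - b) (z - b)" using inT(3)[OF zV] by (simp only: orient_def)
        qed
      qed
      then have "?X \<subseteq> closed_segment x b" by (intro hull_minimal) auto
      then have "mw ?X \<le> mw (closed_segment x b)"
        using V1 by (intro mw_mono) (auto simp: compact_imp_bounded)
      then have "mw (convex hull V) \<le> dist a x + dist x b + dist b a"
        unfolding g(1) mw_segment by (simp add: dist_commute)
      moreover have "area (convex hull {a,x,b}) \<le> area (convex hull V)"
        unfolding area_triangle g(2) orba using axb by (simp add: area_def)
      ultimately show ?thesis using xT by blast
    next
      case False
      then have qbx: "0 < orient q b x" using inT(2)[of x] x(1) by auto
      obtain \<alpha> \<gamma> \<beta> where bc: "0 \<le> \<alpha>" "0 \<le> \<gamma>" "0 \<le> \<beta>" "\<alpha> + \<gamma> + \<beta> = 1" "x = \<alpha> *\<^sub>R a + \<gamma> *\<^sub>R q + \<beta> *\<^sub>R b"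
        using xT unfolding convex_hull_3 by auto
      \<comment> \<open>\<open>1 - \<rho>\<close> is the barycentric weight of \<open>a\<close>.
        Hence the ray from \<open>a\<close> through \<open>x\<close> meets the line
        \<open>q b\<close> at \<open>q1\<close>, and \<open>x\<close> lies at the fraction
        \<open>\<rho>\<close> of the way from \<open>a\<close> to \<open>q1\<close>.\<close>
      define \<rho> where "\<rho> = \<gamma> + \<beta>"
      have xa: "x = a + \<gamma> *\<^sub>R (q - a) + \<beta> *\<^sub>R (b - a)" unfolding bc(5) using bc(4)
        by (simp add: algebra_simps flip: scaleR_add_left)
      have bax: "orient b a x = \<gamma> * ?D" unfolding xa by (simp add: orient_simps algebra_simps)
      have \<gamma>: "0 < \<gamma>" using fpos less.prems(5) unfolding bax by (simp add: zero_less_mult_iff)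
      have \<rho>: "0 < \<rho>" "\<rho> < 1"
      proof -
        show "0 < \<rho>" using \<gamma> bc by (simp add: \<rho>_def)
        have "orient q b x = (1 - \<rho>) * ?D" unfolding xa \<rho>_def by (simp add: orient_simps algebra_simps)
        then show "\<rho> < 1" using qbx less.prems(5) by (simp add: zero_less_mult_iff)
      qed
      define q1 where "q1 = a + (1 / \<rho>) *\<^sub>R (x - a)"
      have q1: "q1 = b + (\<gamma> / \<rho>) *\<^sub>R (q - b)"
      proof -
        have "\<rho> *\<^sub>R q1 = \<rho> *\<^sub>R a + (x - a)" unfolding q1_def using \<rho> by (simp add: algebra_simps)
        also have "\<dots> = \<rho> *\<^sub>R b + \<gamma> *\<^sub>R (q - b)" unfolding xa by (simp add: \<rho>_def algebra_simps)
        also have "\<dots> = \<rho> *\<^sub>R (b + (\<gamma> / \<rho>) *\<^sub>R (q - b))" using \<rho> by (simp add: scaleR_add_right)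
        finally show ?thesis using \<rho> by simp
      qed
      have xq1: "x = a + \<rho> *\<^sub>R (q1 - a)" unfolding q1_def using \<rho> by simp
      have D1: "0 < orient x q1 b"
      proof -
        have "orient x q1 b = (1 / \<rho> - 1) * orient a x b" unfolding q1_def by (simp add: orient_simps algebra_simps)
        then show ?thesis using axb \<rho> by simp
      qed
      have V1T: "V1 \<subseteq> convex hull {x,q1,b}"
      proof
        fix z assume z: "z \<in> V1"
        then have zV: "z \<in> V" using V1 by auto
        show "z \<in> convex hull {x,q1,b}"
        proof (rule in_triangleI'[OF D1])
          have "orient x q1 z = (1 / \<rho> - 1) * orient a x z" unfolding q1_def by (simp add: orient_simps algebra_simps)
          then show "0 \<le> orient x q1 z" using left[OF zV] \<rho> by simp
          have "orient q1 b z = (\<gamma> / \<rho>) * orient q b z" unfolding q1 by (simp add: orient_simps algebra_simps)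
          then show "0 \<le> orient q1 b z" using inT(2)[OF zV] \<rho> \<gamma> by simp
          show "0 \<le> orient b x z" using z by (simp add: V1_def)
        qed
      qed
      obtain y where y: "y \<in> convex hull {x,q1,b}" "area (convex hull {x,y,b}) \<le> area ?X"
         "mw ?X \<le> dist x y + dist y b + dist b x"
        using less.hyps[OF cardV1 V1(1,2,3) V1T D1] by blast
      have oxyb: "0 \<le> orient x y b" using in_triangleD(3)[OF y(1)] D1 orient_cyclic[of b x y] by simp
      obtain \<mu>1 \<mu>2 \<mu>3 where mu: "0 \<le> \<mu>1" "0 \<le> \<mu>2" "0 \<le> \<mu>3" "\<mu>1 + \<mu>2 + \<mu>3 = 1" "y = \<mu>1 *\<^sub>R x + \<mu>2 *\<^sub>R q1 + \<mu>3 *\<^sub>R b"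
        using y(1) unfolding convex_hull_3 by auto
      \<comment> \<open>The lines \<open>a x\<close> and \<open>b y\<close> meet at \<open>p\<close>.\<close>
      obtain \<kappa> s where ks: "0 \<le> \<kappa>" "\<kappa> \<le> 1" "0 \<le> s" "s \<le> 1" "y = (x + \<kappa> *\<^sub>R (q1 - x)) + s *\<^sub>R (b - (x + \<kappa> *\<^sub>R (q1 - x)))"
      proof (cases "\<mu>1 + \<mu>2 = 0")
        case True
        then have "y = b" using mu by (auto simp: add_nonneg_eq_0_iff)
        then show ?thesis by (intro that[of 0 1]) auto
      next
        case False
        define \<kappa> where "\<kappa> = \<mu>2 / (\<mu>1 + \<mu>2)"
        have m12: "\<mu>1 + \<mu>2 > 0" using False mu by linarith
        have e1: "(\<mu>1 + \<mu>2) * \<kappa> = \<mu>2" using m12 by (simp add: \<kappa>_def)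
        have "y = (\<mu>1 + \<mu>2) *\<^sub>R (x + \<kappa> *\<^sub>R (q1 - x)) + \<mu>3 *\<^sub>R b"
        proof -
          have "(\<mu>1 + \<mu>2) *\<^sub>R (x + \<kappa> *\<^sub>R (q1 - x)) = (\<mu>1 + \<mu>2) *\<^sub>R x + ((\<mu>1 + \<mu>2) * \<kappa>) *\<^sub>R (q1 - x)"
            by (simp add: scaleR_add_right)
          also have "\<dots> = \<mu>1 *\<^sub>R x + \<mu>2 *\<^sub>R q1" unfolding e1 by (simp add: algebra_simps)
          finally show ?thesis using mu(5) by simp
        qed
        moreover have "\<mu>1 + \<mu>2 = 1 - \<mu>3" using mu(4) by simp
        ultimately have "y = (x + \<kappa> *\<^sub>R (q1 - x)) + \<mu>3 *\<^sub>R (b - (x + \<kappa> *\<^sub>R (q1 - x)))"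
          by (simp add: algebra_simps)
        then show ?thesis using m12 mu by (intro that[of \<kappa> \<mu>3]) (auto simp: \<kappa>_def)
      qed
      define p where "p = x + \<kappa> *\<^sub>R (q1 - x)"
      define \<rho>' where "\<rho>' = \<rho> + \<kappa> * (1 - \<rho>)"
      have \<rho>': "0 < \<rho>'" "\<rho>' \<le> 1" "\<rho> \<le> \<rho>'"
      proof -
        show "\<rho> \<le> \<rho>'" unfolding \<rho>'_def using ks \<rho> by simp
        then show "0 < \<rho>'" using \<rho> by simp
        have "\<kappa> * (1 - \<rho>) \<le> 1 * (1 - \<rho>)" using ks \<rho> by (intro mult_right_mono) auto
        then show "\<rho>' \<le> 1" unfolding \<rho>'_def by simp
      qed
      have pa: "p = a + \<rho>' *\<^sub>R (q1 - a)" unfolding p_def xq1 \<rho>'_def by (simp add: algebra_simps)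
      define r where "r = 1 - \<rho> / \<rho>'"
      have r: "0 \<le> r" "r \<le> 1" using \<rho>' \<rho> by (auto simp: r_def)
      have xr: "x = p + r *\<^sub>R (a - p)"
      proof -
        have "(\<rho> / \<rho>') * \<rho>' = \<rho>" using \<rho>' by simp
        then have "p + r *\<^sub>R (a - p) = a + ((\<rho> / \<rho>') * \<rho>') *\<^sub>R (q1 - a)" unfolding pa r_def by (simp add: algebra_simps)
        then show ?thesis using xq1 \<rho>' by simp
      qed
      have ys: "y = p + s *\<^sub>R (b - p)" using ks(5) unfolding p_def .
      obtain w where w: "w = p + (r * s) *\<^sub>R (a - p) \<or> w = p + (r * s) *\<^sub>R (b - p)"
        "dist a x + dist x y + dist y b \<le> dist a w + dist w b"
        using corner_cut[OF r ks(3,4) xr ys] by metis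
      have q1T: "q1 \<in> convex hull {a,q,b}"
      proof -
        have "\<gamma> / \<rho> \<le> 1" "0 \<le> \<gamma> / \<rho>" using \<gamma> bc \<rho> by (auto simp: \<rho>_def)
        then have "q1 \<in> closed_segment b q" unfolding q1 by (intro in_segment_param) auto
        moreover have "closed_segment b q \<subseteq> convex hull {a,q,b}" unfolding segment_convex_hull by (intro hull_mono) auto
        ultimately show ?thesis by blast
      qed
      have cT: "closed_segment u z \<subseteq> convex hull {a,q,b}" if "u \<in> convex hull {a,q,b}" "z \<in> convex hull {a,q,b}" for u z
        using that by (simp add: closed_segment_subset)
      have abT: "a \<in> convex hull {a,q,b}" "b \<in> convex hull {a,q,b}" by (auto intro: hull_inc)
      have "p \<in> closed_segment a q1" unfolding pa using \<rho>' by (intro in_segment_param) auto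
      then have pT: "p \<in> convex hull {a,q,b}" using cT[OF abT(1) q1T] by blast
      have rs: "0 \<le> r * s" "r * s \<le> 1" using r ks by (auto simp: mult_le_one)
      have "w \<in> closed_segment p a \<or> w \<in> closed_segment p b" using w(1) in_segment_param[OF rs] by auto
      then have wT: "w \<in> convex hull {a,q,b}" using cT[OF pT abT(1)] cT[OF pT abT(2)] by blast
      have "orient a w b = orient a x b + orient x y b" using corner_cut_area[OF xr ys w(1)] .
      then have "area (convex hull {a,w,b}) \<le> area (convex hull V)"
        using y(2) oxyb axb unfolding area_triangle g(2) orba by simp
      moreover have "mw (convex hull V) \<le> dist a w + dist w b + dist b a"
        unfolding g(1) using y(3) w(2) by (simp add: dist_commute)
      ultimately show ?thesis using wT by blast
    qed
  qed
qed

text \<open>Finite subsets of \<open>K\<close> give triangles by \<open>polygon_cap\<close>, but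
  these vary with the approximation. A maximizer of the distance sum over the compact set
  \<open>G\<close> of admissible apexes dominates all of them.\<close>

lemma convex_cap:
  assumes K: "compact K" "convex K" "a \<in> K" "b \<in> K" "K \<subseteq> convex hull {a,q,b}" and D: "0 < orient a q b"
  obtains v where "v \<in> convex hull {a,q,b}" "area (convex hull {a,v,b}) \<le> area K"
    "mw K \<le> dist a v + dist v b + dist b a"
proof -
  let ?T = "convex hull {a,q,b}"
  define G where "G = ?T \<inter> {v. \<bar>orient a v b\<bar> \<le> 2 * area K}"
  have "compact ?T" by (intro finite_imp_compact_convex_hull) auto
  moreover have "closed {v. \<bar>orient a v b\<bar> \<le> 2 * area K}"
    unfolding orient_simps by (intro closed_Collect_le continuous_intros)
  ultimately have cG: "compact G" unfolding G_def by (rule compact_Int_closed)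
  have "\<bar>orient a a b\<bar> \<le> 2 * area K" by (simp add: area_def)
  then have "a \<in> G" unfolding G_def by (auto intro: hull_inc)
  then obtain v where v: "v \<in> G" "\<And>y. y \<in> G \<Longrightarrow> dist a y + dist y b \<le> dist a v + dist v b"
    using continuous_attains_sup[OF cG, of "\<lambda>y. dist a y + dist y b"] by (fastforce intro!: continuous_intros)
  have "mw K \<le> dist a v + dist v b + dist b a"
  proof (rule field_le_epsilon)
    fix \<epsilon> :: real assume e: "0 < \<epsilon>"
    obtain W where W: "finite W" "W \<noteq> {}" "{a,b} \<subseteq> W" "W \<subseteq> K" "mw (convex hull K) \<le> mw (convex hull W) + \<epsilon>"
      using mw_finite_approx[OF K(1) _ _ _ e, of "{a,b}"] K by auto
    then obtain y where y: "y \<in> ?T" "area (convex hull {a,y,b}) \<le> area (convex hull W)"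
       "mw (convex hull W) \<le> dist a y + dist y b + dist b a"
      using polygon_cap[of W a b q] K D by auto
    have "convex hull W \<subseteq> K" using W K by (intro hull_minimal)
    then have "area (convex hull W) \<le> area K" using W K by (intro area_mono finite_imp_compact_convex_hull)
    then have "y \<in> G" using y unfolding G_def area_triangle by auto
    then have "dist a y + dist y b \<le> dist a v + dist v b" by (rule v(2))
    moreover have "convex hull K = K" using K by (simp add: hull_same)
    ultimately show "mw K \<le> dist a v + dist v b + dist b a + \<epsilon>" using W y by simp
  qed
  then show ?thesis using v(1) that unfolding G_def area_triangle by auto
qed

section \<open>Caps with a strict gain\<close>

lemma det2_cramer: "det2 x y *\<^sub>R w = det2 w y *\<^sub>R x + det2 x w *\<^sub>R y"
  by (simp add: complex_eq_iff det2_def algebra_simps)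

lemma det2_comb: "det2 u (s *\<^sub>R x + t *\<^sub>R y) = s * det2 u x + t * det2 u y"
  "det2 (s *\<^sub>R x + t *\<^sub>R y) u = s * det2 x u + t * det2 y u"
  by simp_all

lemma det2_inner_identity: "(d \<bullet> v) * det2 u w = (d \<bullet> w) * det2 u v + (d \<bullet> u) * det2 v w"
  by (simp add: det2_def inner_complex_def algebra_simps)

lemma det2_plucker: "det2 d g * det2 y u = det2 d y * det2 g u - det2 d u * det2 g y"
  by (simp add: det2_def algebra_simps)

text \<open>Turning left is transitive for vectors in an open half-plane, by the three-term identity
  \<open>det2_inner_identity\<close>.\<close>

lemma det2_trans:
  assumes "0 < d \<bullet> u" "0 < d \<bullet> v" "0 < d \<bullet> w" "0 < det2 u v" "0 < det2 v w"
  shows "0 < det2 u w"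
proof -
  have "0 < (d \<bullet> v) * det2 u w" unfolding det2_inner_identity[of d v u w] using assms by (simp add: add_pos_pos)
  then show ?thesis using assms(2) by (simp add: zero_less_mult_iff)
qed

lemma dist_strict: "orient a b e \<noteq> 0 \<Longrightarrow> dist a b < dist a e + dist e b"
  using norm_add_strict[of "e - a" "b - e"]
  by (simp add: dist_norm norm_minus_commute orient_simps algebra_simps)

lemma pos_combination: "0 \<le> s \<Longrightarrow> 0 \<le> t \<Longrightarrow> s \<noteq> 0 \<or> t \<noteq> 0 \<Longrightarrow> 0 < x \<Longrightarrow> 0 < y \<Longrightarrow> 0 < s * x + t * y"
  for s t x y :: real
  by (cases "s = 0") (auto simp: add_pos_nonneg)

text \<open>The support lines at \<open>a\<close> and \<open>b\<close> confine the intersection of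
  \<open>K\<close> with the line \<open>a b\<close> to the segment, so the two parts of
  \<open>K\<close> are glued exactly along the chord.\<close>

lemma cut_chord:
  assumes K: "compact K" "convex K" "a \<in> K" "b \<in> K"
    and \<alpha>: "0 < det2 \<alpha> (b - a)" "\<And>x. x \<in> K \<Longrightarrow> 0 \<le> det2 \<alpha> (x - a)"
    and \<beta>: "0 < det2 \<beta> (a - b)" "\<And>x. x \<in> K \<Longrightarrow> 0 \<le> det2 \<beta> (x - b)"
  defines "R \<equiv> K \<inter> {x. orient a b x \<le> 0}" and "L \<equiv> K \<inter> {x. 0 \<le> orient a b x}"
  shows "mw K = mw R + mw L - 2 * dist a b" "area K = area R + area L"
    "compact R" "convex R" "compact L" "convex L" "a \<in> R" "b \<in> R" "a \<in> L" "b \<in> L"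
proof -
  show ab: "a \<in> R" "b \<in> R" "a \<in> L" "b \<in> L" using K by (auto simp: R_def L_def)
  show c: "compact R" "compact L" "convex R" "convex L" unfolding R_def L_def
    using K by (auto intro!: compact_Int_closed convex_Int convex_orient_le convex_orient_ge closed_orient_le closed_orient_ge)
  have un: "R \<union> L = K" unfolding R_def L_def by auto
  have "R \<inter> L \<subseteq> closed_segment a b"
  proof
    fix x assume "x \<in> R \<inter> L"
    then have "x \<in> K" "orient a b x = 0" unfolding R_def L_def by auto
    then show "x \<in> closed_segment a b" using line_wedge[OF _ \<alpha>(1) \<beta>(1) \<alpha>(2) \<beta>(2)] by blast
  qed
  moreover have "closed_segment a b \<subseteq> R \<inter> L" using ab c by (simp add: closed_segment_subset)
  ultimately have int: "R \<inter> L = closed_segment a b" by blast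
  show "mw K = mw R + mw L - 2 * dist a b" using mw_glue[OF c(1,2) _ int] K(2) un by simp
  show "area K = area R + area L" using area_glue[OF c(1,2) int] un by simp
qed

text \<open>Replaces the cap of \<open>K\<close> beyond the chord \<open>a b\<close> by a triangle inside the wedge of the support
  directions \<open>\<alpha>\<close> and \<open>\<beta>\<close>.\<close>

lemma cap_chord:
  assumes K: "compact K" "convex K" "a \<in> K" "b \<in> K"
    and \<alpha>: "0 < det2 \<alpha> (b - a)" "\<And>x. x \<in> K \<Longrightarrow> 0 \<le> det2 \<alpha> (x - a)"
    and \<beta>: "0 < det2 \<beta> (a - b)" "\<And>x. x \<in> K \<Longrightarrow> 0 \<le> det2 \<beta> (x - b)"
    and \<alpha>\<beta>: "0 < det2 \<alpha> \<beta>" and e: "e \<in> K" "orient a b e < 0"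
  defines "L \<equiv> K \<inter> {x. 0 \<le> orient a b x}"
  obtains v s t s' t' where "0 \<le> s" "0 \<le> t" "v - a = s *\<^sub>R \<alpha> + t *\<^sub>R (b - a)"
    "0 \<le> s'" "0 \<le> t'" "b - v = s' *\<^sub>R \<beta> + t' *\<^sub>R (b - a)" "orient a b v < 0"
    "mw K \<le> mw L + dist a v + dist v b - dist a b" "area L - orient a b v / 2 \<le> area K"
proof -
  define R where "R = K \<inter> {x. orient a b x \<le> 0}"
  have c: "mw K = mw R + mw L - 2 * dist a b" "area K = area R + area L" "compact R" "convex R" "a \<in> R" "b \<in> R"
    unfolding R_def L_def using cut_chord[OF K \<alpha> \<beta>] by auto
  \<comment> \<open>Coordinates of \<open>b - a\<close> in the basis \<open>\<alpha>\<close>,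
    \<open>\<beta>\<close>, by Cramer's rule; \<open>q\<close> is where the two support lines
    meet.\<close>
  define \<xi> \<mu> where "\<xi> = det2 \<beta> (a - b) / det2 \<alpha> \<beta>" and "\<mu> = det2 \<alpha> (b - a) / det2 \<alpha> \<beta>"
  have lm: "0 < \<xi>" "0 < \<mu>" using \<alpha> \<beta> \<alpha>\<beta> by (auto simp: \<xi>_def \<mu>_def)
  define q where "q = a + \<xi> *\<^sub>R \<alpha>"
  have "det2 \<alpha> \<beta> *\<^sub>R (b - a) = det2 \<alpha> \<beta> *\<^sub>R (\<xi> *\<^sub>R \<alpha> + \<mu> *\<^sub>R \<beta>)"
  proof -
    have "det2 \<alpha> \<beta> *\<^sub>R (\<xi> *\<^sub>R \<alpha> + \<mu> *\<^sub>R \<beta>) = det2 \<beta> (a - b) *\<^sub>R \<alpha> + det2 \<alpha> (b - a) *\<^sub>R \<beta>"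
      using \<alpha>\<beta> by (simp add: \<xi>_def \<mu>_def scaleR_add_right)
    moreover have "det2 \<beta> (a - b) = det2 (b - a) \<beta>" by (simp add: det2_def algebra_simps)
    ultimately show ?thesis using det2_cramer[of \<alpha> \<beta> "b - a"] by simp
  qed
  then have ba: "b - a = \<xi> *\<^sub>R \<alpha> + \<mu> *\<^sub>R \<beta>" using \<alpha>\<beta> by simp
  have q: "q = b - \<mu> *\<^sub>R \<beta>" unfolding q_def using ba by (simp add: algebra_simps)
  have oa: "orient a q x = \<xi> * det2 \<alpha> (x - a)" for x unfolding q_def by (simp add: orient_simps algebra_simps)
  have ob: "orient q b x = \<mu> * det2 \<beta> (x - b)" for x unfolding q by (simp add: orient_simps algebra_simps)
  have D: "0 < orient a q b" unfolding oa using lm \<alpha> by simp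
  have "R \<subseteq> convex hull {a,q,b}"
  proof
    fix x assume x: "x \<in> R"
    then have "x \<in> K" by (simp add: R_def)
    have "0 \<le> orient b a x" using x orient_swap[of a b x] by (simp add: R_def)
    moreover have "0 \<le> orient a q x" unfolding oa using lm \<alpha>(2)[OF \<open>x \<in> K\<close>] by simp
    moreover have "0 \<le> orient q b x" unfolding ob using lm \<beta>(2)[OF \<open>x \<in> K\<close>] by simp
    ultimately show "x \<in> convex hull {a,q,b}" using D by (intro in_triangleI')
  qed
  from convex_cap[OF c(3,4,5,6) this D]
  obtain v where v: "v \<in> convex hull {a,q,b}" "area (convex hull {a,v,b}) \<le> area R"
    "mw R \<le> dist a v + dist v b + dist b a" by metis
  obtain k1 k2 k3 where k: "0 \<le> k1" "0 \<le> k2" "0 \<le> k3" "k1 + k2 + k3 = 1" "v = k1 *\<^sub>R a + k2 *\<^sub>R q + k3 *\<^sub>R b"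
    using v(1) unfolding convex_hull_3 by auto
  have k1': "k1 = 1 - k2 - k3" using k by simp
  have va: "v - a = (k2 * \<xi>) *\<^sub>R \<alpha> + k3 *\<^sub>R (b - a)" unfolding k(5) k1' q_def by (simp add: algebra_simps)
  have k3': "k3 = 1 - k2 - k1" using k by simp
  have bv: "b - v = (k2 * \<mu>) *\<^sub>R \<beta> + k1 *\<^sub>R (b - a)" unfolding k(5) k3' q by (simp add: algebra_simps)
  have ov: "orient a b v = - (k2 * \<xi>) * det2 \<alpha> (b - a)"
    unfolding orient_def va by (simp add: det2_def algebra_simps)
  \<comment> \<open>A degenerate triangle would force \<open>mw R \<le> 2 * dist a b\<close>, but
    \<open>R\<close> contains the proper triangle \<open>a e b\<close>.\<close>
  have "orient a b v \<noteq> 0"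
  proof
    assume "orient a b v = 0"
    then have "k2 = 0" using ov lm \<alpha>(1) by simp
    then have "v = a + k3 *\<^sub>R (b - a)" using va by (simp add: algebra_simps)
    then have "v \<in> closed_segment a b" using k \<open>k2 = 0\<close> in_segment_param[of k3 a b] by simp
    then have "dist a v + dist v b = dist a b" by (metis between between_mem_segment)
    then have "mw R \<le> 2 * dist a b" using v(3) by (simp add: dist_commute)
    moreover have "mw (convex hull {a,e,b}) \<le> mw R"
      using c e by (intro mw_mono hull_minimal) (auto simp: R_def compact_imp_bounded)
    moreover have "dist a b < dist a e + dist e b" using e by (intro dist_strict) simp
    ultimately show False unfolding mw_triangle by (simp add: dist_commute)
  qed
  moreover have ov0: "orient a b v \<le> 0" unfolding ov using k lm \<alpha>(1) by simp
  ultimately have ovn: "orient a b v < 0" by simp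
  show ?thesis
  proof (rule that[OF _ k(3) va _ k(1) bv ovn])
    show "0 \<le> k2 * \<xi>" "0 \<le> k2 * \<mu>" using k lm by auto
    show "mw K \<le> mw L + dist a v + dist v b - dist a b" using c(1) v(3) by (simp add: dist_commute)
    have "\<bar>orient a v b\<bar> = - orient a b v" using ovn orient_swap_right[of a v b] by simp
    then show "area L - orient a b v / 2 \<le> area K" using c(2) v(2) unfolding area_triangle by simp
  qed
qed

text \<open>A single replacement by \<open>cap_chord\<close> gives only a weak inequality. Here
  \<open>K\<close> is a cap over \<open>a c\<close> with an intermediate point \<open>b\<close> and
  its own support direction. The caps over \<open>a b\<close> and then over \<open>v c\<close> are
  replaced by triangles, which leaves a proper quadrilateral \<open>a v v2 c\<close>; cutting its
  corner through an end is a strict gain. The points \<open>e\<close> and \<open>e'\<close> keep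
  both caps nondegenerate, and \<open>d\<close> keeps all directions in one half-plane.\<close>

lemma strict_cap:
  notes det2_simps(4-7) [simp del]
  assumes K: "compact K" "convex K" and in_K: "a \<in> K" "b \<in> K" "c \<in> K" "e \<in> K" "e' \<in> K"
    and d: "0 < d \<bullet> \<alpha>" "0 < d \<bullet> \<beta>" "0 < d \<bullet> \<gamma>" "0 < d \<bullet> (b - a)" "0 < d \<bullet> (c - b)"
    and lines: "\<And>x. x \<in> K \<Longrightarrow> 0 \<le> det2 \<alpha> (x - a)" "\<And>x. x \<in> K \<Longrightarrow> 0 \<le> det2 \<beta> (x - b)"
      "\<And>x. x \<in> K \<Longrightarrow> 0 \<le> det2 \<gamma> (x - c)" "\<And>x. x \<in> K \<Longrightarrow> orient a c x \<le> 0"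
    and o: "0 < orient a e b" "0 < orient b e' c" "0 < orient a b c" "0 \<le> orient a b e'"
    and dirs: "0 < det2 \<alpha> \<beta>" "0 < det2 \<beta> \<gamma>"
    and q: "q = a + \<xi> *\<^sub>R \<alpha>" "q = c - \<mu> *\<^sub>R \<gamma>" "0 < \<xi>" "0 < \<mu>"
  obtains w where "w \<in> convex hull {a,q,c}" "area (convex hull {a,w,c}) \<le> area K"
    "mw K < dist a w + dist w c + dist c a"
proof -
  \<comment> \<open>Otherwise \<open>\<delta>\<close> would point along the chord from
    \<open>x\<close> to \<open>y\<close>, and \<open>z\<close>, strictly beyond that chord, would
    violate the support line at \<open>x\<close>.\<close>
  have strict1: "0 < det2 \<delta> (y - x)" if "0 < d \<bullet> \<delta>" "0 < d \<bullet> (y - x)" "0 \<le> det2 \<delta> (z - x)" "0 \<le> det2 \<delta> (y - x)" "0 < orient x z y"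
    for \<delta> x y z
  proof (rule ccontr)
    assume "\<not> 0 < det2 \<delta> (y - x)"
    then have "det2 \<delta> (y - x) = 0" using that by simp
    then have "(d \<bullet> \<delta>) * orient x z y = (d \<bullet> (y - x)) * det2 (z - x) \<delta>"
      unfolding orient_def det2_inner_identity[of d \<delta> "z - x" "y - x"] by simp
    also have "\<dots> \<le> 0" using that det2_swap[of "z - x" \<delta>] by (simp add: mult_le_0_iff)
    finally show False using that(1,5) by (simp add: mult_le_0_iff)
  qed
  have strict2: "0 < det2 \<delta> (x - y)" if "0 < d \<bullet> \<delta>" "0 < d \<bullet> (y - x)" "0 \<le> det2 \<delta> (z - y)" "0 \<le> det2 \<delta> (x - y)" "0 < orient x z y"
    for \<delta> x y z
  proof (rule ccontr)
    assume "\<not> 0 < det2 \<delta> (x - y)"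
    then have z: "det2 (x - y) \<delta> = 0" using that det2_swap[of \<delta> "x - y"] by simp
    have "orient x z y = det2 (x - y) (z - y)" by (simp add: orient_simps algebra_simps)
    then have "(d \<bullet> \<delta>) * orient x z y = (d \<bullet> (x - y)) * det2 \<delta> (z - y)"
      using det2_inner_identity[of d \<delta> "x - y" "z - y"] z by simp
    moreover have "d \<bullet> (x - y) < 0" using that(2) by (simp add: inner_diff_right)
    ultimately have "(d \<bullet> \<delta>) * orient x z y \<le> 0" using that(3) by (simp add: mult_le_0_iff)
    then show False using that(1,5) by (simp add: mult_le_0_iff)
  qed
  have P1: "0 < det2 \<alpha> (b - a)" using strict1[OF d(1,4) lines(1)[OF in_K(4)] lines(1)[OF in_K(2)] o(1)] .
  have P2: "0 < det2 \<beta> (a - b)" using strict2[OF d(2,4) lines(2)[OF in_K(4)] lines(2)[OF in_K(1)] o(1)] .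
  have P3: "0 < det2 \<gamma> (b - c)" using strict2[OF d(3,5) lines(3)[OF in_K(5)] lines(3)[OF in_K(2)] o(2)] .
  have dca: "0 < d \<bullet> (c - a)" using d(4,5) by (simp add: inner_diff_right)
  have P4: "0 < det2 \<alpha> (c - a)"
    using det2_trans[OF d(1,4) dca P1] o(3) by (simp add: orient_def)
  have cb\<gamma>: "0 < det2 (c - b) \<gamma>" using P3 by (simp add: det2_def algebra_simps)
  have bacb: "0 < det2 (b - a) (c - b)" using o(3) by (simp add: orient_simps algebra_simps)
  have P6: "0 < det2 (b - a) \<gamma>" using det2_trans[OF d(4,5,3) bacb cb\<gamma>] .
  have \<alpha>\<gamma>: "0 < det2 \<alpha> \<gamma>" using det2_trans[OF d(1,2,3) dirs] .
  have oabe: "orient a b e < 0" using o(1) orient_swap_right[of a b e] by simp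
  define L where "L = K \<inter> {x. 0 \<le> orient a b x}"
  have cL: "compact L" "convex L" "a \<in> L" "b \<in> L" "c \<in> L" "e' \<in> L" "L \<subseteq> K"
    using cut_chord(5,6)[OF K in_K(1,2) P1 lines(1) P2 lines(2)] in_K o unfolding L_def by auto
  obtain v s t s' t' where v: "0 \<le> s" "0 \<le> t" "v - a = s *\<^sub>R \<alpha> + t *\<^sub>R (b - a)"
    "0 \<le> s'" "0 \<le> t'" "b - v = s' *\<^sub>R \<beta> + t' *\<^sub>R (b - a)" "orient a b v < 0"
    "mw K \<le> mw L + dist a v + dist v b - dist a b" "area L - orient a b v / 2 \<le> area K"
    by (rule cap_chord[OF K in_K(1,2) P1 lines(1) P2 lines(2) dirs(1) in_K(4) oabe, folded L_def])
  have vb: "v - b = - (s' *\<^sub>R \<beta> + t' *\<^sub>R (b - a))" using v(6) by (metis minus_diff_eq)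
  have spos: "0 < s"
  proof -
    have "orient a b v = - s * det2 \<alpha> (b - a)" unfolding orient_def v(3) by (simp add: det2_def algebra_simps)
    then have "0 < s * det2 \<alpha> (b - a)" using v(7) by simp
    then show ?thesis using P1 by (simp add: zero_less_mult_iff)
  qed
  have s'pos: "0 < s'"
  proof -
    have "orient a b v = det2 (b - a) (v - b)" by (simp add: orient_simps algebra_simps)
    also have "\<dots> = - s' * det2 \<beta> (a - b)" unfolding vb by (simp add: det2_def algebra_simps)
    finally have "0 < s' * det2 \<beta> (a - b)" using v(7) by simp
    then show ?thesis using P2 by (simp add: zero_less_mult_iff)
  qed
  have v\<alpha>: "0 \<le> det2 \<alpha> (v - a)" unfolding v(3) det2_comb using v P1 by simp
  have v\<beta>: "0 \<le> det2 \<beta> (v - b)"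
  proof -
    have "det2 \<beta> (v - b) = t' * det2 \<beta> (a - b)" unfolding vb by (simp add: det2_def algebra_simps)
    then show ?thesis using v P2 by simp
  qed
  \<comment> \<open>First replacement: the cap over \<open>a b\<close> becomes the triangle
    \<open>a v b\<close>.\<close>
  define K' where "K' = convex hull (insert v L)"
  have g: "mw K' = mw L + dist a v + dist v b - dist a b" "area K' = area L + \<bar>orient a b v\<bar> / 2"
    "K' = L \<union> convex hull {a,v,b}"
    unfolding K'_def
    using triangle_glue[OF cL(1,2,3,4), of v \<alpha> \<beta>] v(7) P1 P2 v\<alpha> v\<beta> lines cL(7) unfolding L_def by auto
  have mwK: "mw K \<le> mw K'" and areaK: "area K' \<le> area K" using g v(7,8,9) by auto
  have cK': "compact K'" "convex K'"
    unfolding g(3) using cL(1) apply (auto intro!: compact_Un finite_imp_compact_convex_hull)[1]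
    unfolding g(3)[symmetric] K'_def by auto
  have inK': "v \<in> K'" "a \<in> K'" "b \<in> K'" "c \<in> K'" "e' \<in> K'" unfolding K'_def using cL by (auto intro: hull_inc)
  \<comment> \<open>The new side from \<open>v\<close> to \<open>b\<close> extends to a support line
    of \<open>K'\<close>; the second cap uses it at \<open>v\<close>.\<close>
  have vL: "0 \<le> det2 (b - v) (x - v)" if x: "x \<in> K'" for x
  proof -
    have "insert v L \<subseteq> {x. 0 \<le> det2 (b - v) (x - v)}"
    proof
      fix x assume "x \<in> insert v L"
      moreover have "0 \<le> det2 (b - v) (x - v)" if xL: "x \<in> L"
      proof -
        have eqs: "det2 (a - b) (v - b) = - orient a b v" "det2 (a - b) (x - b) = - orient a b x"
          by (simp_all add: orient_simps algebra_simps)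
        have "det2 \<beta> (a - b) * det2 (x - b) (v - b) = det2 \<beta> (x - b) * (- orient a b v) + det2 \<beta> (v - b) * orient a b x"
          unfolding det2_plucker[of \<beta> "a - b" "x - b" "v - b"] eqs by simp
        moreover have "0 \<le> det2 \<beta> (x - b) * (- orient a b v)"
          using lines(2)[of x] xL cL(7) v(7) by (intro mult_nonneg_nonneg) auto
        moreover have "0 \<le> det2 \<beta> (v - b) * orient a b x"
          using v\<beta> xL by (intro mult_nonneg_nonneg) (auto simp: L_def)
        ultimately have "0 \<le> det2 \<beta> (a - b) * det2 (x - b) (v - b)" by linarith
        then have "0 \<le> det2 (x - b) (v - b)" using P2 by (simp add: zero_le_mult_iff)
        moreover have "det2 (b - v) (x - v) = det2 (x - b) (v - b)" by (simp add: det2_def algebra_simps)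
        ultimately show ?thesis by simp
      qed
      ultimately show "x \<in> {x. 0 \<le> det2 (b - v) (x - v)}" by auto
    qed
    then have "K' \<subseteq> {x. 0 \<le> det2 (b - v) (x - v)}" unfolding K'_def by (rule convex_hull_subset_det2)
    then show ?thesis using x by blast
  qed
  have aL: "0 \<le> det2 (v - a) (x - a)" if x: "x \<in> K'" for x
  proof -
    have "insert v L \<subseteq> {x. 0 \<le> det2 (v - a) (x - a)}"
    proof
      fix x assume "x \<in> insert v L"
      moreover have "0 \<le> det2 (v - a) (x - a)" if xL: "x \<in> L"
      proof -
        have "det2 (v - a) (x - a) = s * det2 \<alpha> (x - a) + t * orient a b x" unfolding v(3) orient_def det2_comb ..
        then show ?thesis using v spos lines(1)[of x] xL cL(7) by (simp add: L_def)
      qed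
      ultimately show "x \<in> {x. 0 \<le> det2 (v - a) (x - a)}" using det2_swap[of v a] by auto
    qed
    then have "K' \<subseteq> {x. 0 \<le> det2 (v - a) (x - a)}" unfolding K'_def by (rule convex_hull_subset_det2)
    then show ?thesis using x by blast
  qed
  have v\<gamma>: "0 < det2 \<gamma> (v - c)"
  proof -
    have vc: "v - c = (b - c) - (s' *\<^sub>R \<beta> + t' *\<^sub>R (b - a))" using vb by (simp add: algebra_simps)
    have "det2 \<gamma> (v - c) = s' * det2 \<beta> \<gamma> + t' * det2 (b - a) \<gamma> + det2 \<gamma> (b - c)"
      unfolding vc by (simp add: det2_def algebra_simps)
    then show ?thesis using v dirs P6 P3 by (simp add: add_nonneg_pos)
  qed
  have cLin: "0 \<le> det2 \<gamma> (x - c)" if x: "x \<in> K'" for x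
  proof -
    have "insert v L \<subseteq> {x. 0 \<le> det2 \<gamma> (x - c)}" using v\<gamma> lines(3) cL(7) by auto
    then have "K' \<subseteq> {x. 0 \<le> det2 \<gamma> (x - c)}" unfolding K'_def by (rule convex_hull_subset_det2)
    then show ?thesis using x by blast
  qed
  have oacv: "orient a c v < 0"
  proof -
    have "orient a c v = - (s * det2 \<alpha> (c - a) + t * orient a b c)"
      unfolding orient_def v(3) by (simp add: det2_def algebra_simps)
    moreover have "0 < s * det2 \<alpha> (c - a) + t * orient a b c" using spos P4 v o(3) by (simp add: add_pos_nonneg)
    ultimately show ?thesis by simp
  qed
  have oacK': "orient a c x \<le> 0" if x: "x \<in> K'" for x
  proof -
    have "insert v L \<subseteq> {x. orient a c x \<le> 0}" using oacv lines(4) cL(7) by auto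
    then have "K' \<subseteq> {x. orient a c x \<le> 0}" unfolding K'_def by (intro hull_minimal convex_orient_le)
    then show ?thesis using x by blast
  qed
  have dbv: "0 < d \<bullet> (b - v)" unfolding v(6) using s'pos v d by (simp add: inner_add_right add_pos_nonneg)
  \<comment> \<open>If \<open>c\<close> were on the line from \<open>v\<close> through
    \<open>b\<close>, then \<open>e'\<close>, strictly beyond the chord \<open>b c\<close>, would
    lie on the wrong side of it.\<close>
  have bvcv: "0 < det2 (b - v) (c - v)"
  proof (rule ccontr)
    assume "\<not> ?thesis"
    then have "det2 (b - v) (c - v) = 0" using vL[OF inK'(4)] by simp
    then have 0: "det2 (b - v) (c - b) = 0" by (simp add: det2_def algebra_simps)
    have "0 \<le> det2 (b - v) (e' - b)" using vL[OF inK'(5)] by (simp add: det2_def algebra_simps)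
    then have 1: "det2 (e' - b) (b - v) \<le> 0" using det2_swap[of "b - v" "e' - b"] by simp
    have "(d \<bullet> (b - v)) * orient b e' c = (d \<bullet> (c - b)) * det2 (e' - b) (b - v)"
      unfolding orient_def det2_inner_identity[of d "b - v" "e' - b" "c - b"] 0 by simp
    also have "\<dots> \<le> 0" using 1 d(5) by (simp add: mult_le_0_iff)
    finally show False using dbv o(2) by (simp add: mult_le_0_iff)
  qed
  have bv\<gamma>: "0 < det2 (b - v) \<gamma>" unfolding v(6) det2_comb using s'pos v dirs P6 by (simp add: add_pos_nonneg)
  have ovcb: "orient v c b < 0" using bvcv det2_swap[of "b - v" "c - v"] by (simp only: orient_def)
  \<comment> \<open>Second replacement: the cap of \<open>K'\<close> over \<open>v c\<close>. What
    remains of \<open>K'\<close> is the triangle \<open>a v c\<close>.\<close>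
  define M where "M = K' \<inter> {x. 0 \<le> orient v c x}"
  obtain v2 s2 t2 s2' t2' where v2: "0 \<le> s2" "0 \<le> t2" "v2 - v = s2 *\<^sub>R (b - v) + t2 *\<^sub>R (c - v)"
    "0 \<le> s2'" "0 \<le> t2'" "c - v2 = s2' *\<^sub>R \<gamma> + t2' *\<^sub>R (c - v)" "orient v c v2 < 0"
    "mw K' \<le> mw M + dist v v2 + dist v2 c - dist v c" "area M - orient v c v2 / 2 \<le> area K'"
    by (rule cap_chord[OF cK' inK'(1,4) bvcv vL v\<gamma> cLin bv\<gamma> inK'(3) ovcb, folded M_def])
  have oavc: "0 < orient a v c" using oacv orient_swap_right[of a v c] by simp
  have M: "M \<subseteq> convex hull {a,v,c}"
  proof
    fix x assume x: "x \<in> M"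
    then have xK: "x \<in> K'" by (simp add: M_def)
    have "0 \<le> orient c a x" using oacK'[OF xK] orient_swap[of c a x] by simp
    then show "x \<in> convex hull {a,v,c}"
      using aL[OF xK] x oavc by (intro in_triangleI') (auto simp: orient_def M_def)
  qed
  have cM: "compact M" "convex M" "a \<in> M" "v \<in> M" "c \<in> M"
    using cK' inK' oavc orient_cyclic[of a v c] unfolding M_def
    by (auto intro!: compact_Int_closed convex_Int closed_orient_ge convex_orient_ge)
  have cT: "compact (convex hull {a,v,c})" by (intro finite_imp_compact_convex_hull) auto
  have mwM: "mw M \<le> dist a v + dist v c + dist c a"
    using mw_mono[OF compact_imp_bounded[OF cT] _ M] cM unfolding mw_triangle by auto
  have "convex hull {a,v,c} \<subseteq> M" using cM by (intro hull_minimal) auto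
  then have areaM: "orient a v c / 2 \<le> area M" using area_mono[OF cT cM(1)] oavc unfolding area_triangle by simp
  have ovv2c: "0 < orient v v2 c" using v2(7) orient_swap_right[of v v2 c] by simp
  have va\<gamma>: "0 < det2 (v - a) \<gamma>" unfolding v(3) det2_comb using spos \<alpha>\<gamma> v P6 by (simp add: add_pos_nonneg)
  have vacv: "det2 (v - a) (c - v) = orient a v c" by (simp add: orient_simps algebra_simps)
  have N: "0 < det2 (v - a) (c - v2)"
  proof -
    have eq: "det2 (v - a) (c - v2) = s2' * det2 (v - a) \<gamma> + t2' * orient a v c" unfolding v2(6) by (simp only: det2_comb vacv)
    have "s2' \<noteq> 0 \<or> t2' \<noteq> 0" using v2(6,7) by auto
    then show ?thesis unfolding eq using v2(4,5) va\<gamma> oavc by (intro pos_combination)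
  qed
  have N2: "0 < det2 (v - a) (v2 - v)"
  proof -
    have vabv: "det2 (v - a) (b - v) = - orient a b v" by (simp add: orient_simps algebra_simps)
    have eq: "det2 (v - a) (v2 - v) = s2 * (- orient a b v) + t2 * orient a v c" unfolding v2(3) by (simp only: det2_comb vacv vabv)
    have "s2 \<noteq> 0 \<or> t2 \<noteq> 0" using v2(3,7) by auto
    then show ?thesis unfolding eq using v2(1,2) v(7) oavc by (intro pos_combination) auto
  qed
  \<comment> \<open>Coordinates of \<open>v2 - v\<close> with respect to \<open>v - a\<close> and
    \<open>c - v2\<close>: the sides \<open>a v\<close> and \<open>c v2\<close>, extended beyond
    \<open>v\<close> and \<open>v2\<close>, meet at \<open>p\<close>.\<close>
  define \<kappa> \<iota> where "\<kappa> = orient v v2 c / det2 (v - a) (c - v2)" and "\<iota> = det2 (v - a) (v2 - v) / det2 (v - a) (c - v2)"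
  have \<kappa>\<iota>: "0 < \<kappa>" "0 < \<iota>" using N N2 ovv2c by (auto simp: \<kappa>_def \<iota>_def)
  define p where "p = v + \<kappa> *\<^sub>R (v - a)"
  have p2: "p = v2 - \<iota> *\<^sub>R (c - v2)"
  proof -
    have "orient v v2 c = det2 (v2 - v) (c - v2)" by (simp add: orient_simps algebra_simps)
    then have "det2 (v - a) (c - v2) *\<^sub>R (v2 - v) = det2 (v - a) (c - v2) *\<^sub>R (\<kappa> *\<^sub>R (v - a) + \<iota> *\<^sub>R (c - v2))"
      using det2_cramer[of "v - a" "c - v2" "v2 - v"] N by (simp add: \<kappa>_def \<iota>_def scaleR_add_right)
    then have "v2 - v = \<kappa> *\<^sub>R (v - a) + \<iota> *\<^sub>R (c - v2)" using N by simp
    then show ?thesis unfolding p_def by (simp add: algebra_simps)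
  qed
  \<comment> \<open>Both parameters lie strictly between \<open>0\<close> and \<open>1\<close>,
    which makes the final corner cut a strict gain.\<close>
  define r s3 where "r = \<kappa> / (1 + \<kappa>)" and "s3 = \<iota> / (1 + \<iota>)"
  have rs: "0 < r" "r < 1" "0 < s3" "s3 < 1" using \<kappa>\<iota> by (auto simp: r_def s3_def)
  have solve: "y = z + (k / (1 + k)) *\<^sub>R (x - z)" if "z = y + k *\<^sub>R (y - x)" "0 < k" for x y z :: complex and k
  proof -
    have "(1 + k) *\<^sub>R (z + (k / (1 + k)) *\<^sub>R (x - z)) = (1 + k) *\<^sub>R z + k *\<^sub>R (x - z)"
      using that(2) by (simp add: scaleR_add_right)
    also have "\<dots> = (1 + k) *\<^sub>R y" unfolding that(1) by (simp add: algebra_simps)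
    finally show ?thesis using that(2) by simp
  qed
  have xv: "v = p + r *\<^sub>R (a - p)" unfolding r_def by (rule solve[OF p_def \<kappa>\<iota>(1)])
  have "p = v2 + \<iota> *\<^sub>R (v2 - c)" unfolding p2 by (simp add: algebra_simps)
  then have yv: "v2 = p + s3 *\<^sub>R (c - p)" unfolding s3_def using solve \<kappa>\<iota>(2) by blast
  have oacp: "orient a c p < 0"
  proof -
    have "orient a c p = (1 + \<kappa>) * orient a c v" unfolding p_def by (simp add: orient_simps algebra_simps)
    then show ?thesis using oacv \<kappa>\<iota> by (simp add: mult_pos_neg)
  qed
  have opac: "orient p a c \<noteq> 0" using oacp orient_cyclic[of p a c] by simp
  obtain w where w: "w = p + (r * s3) *\<^sub>R (a - p) \<or> w = p + (r * s3) *\<^sub>R (c - p)"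
    "dist a v + dist v v2 + dist v2 c < dist a w + dist w c"
    using corner_cut[of r s3 v p a v2 c] rs xv yv opac by (metis less_imp_le)
  have area_w: "orient a w c = orient a v c + orient v v2 c" using corner_cut_area[OF xv yv w(1)] .
  have qa: "orient a q x = \<xi> * det2 \<alpha> (x - a)" for x unfolding q(1) by (simp add: orient_simps algebra_simps)
  have qc: "orient q c x = \<mu> * det2 \<gamma> (x - c)" for x unfolding q(2) by (simp add: orient_simps algebra_simps)
  have D: "0 < orient a q c" unfolding qa using q P4 by simp
  have pa: "p - a = (1 + \<kappa>) *\<^sub>R (v - a)" unfolding p_def by (simp add: algebra_simps)
  have "det2 \<alpha> (p - a) = (1 + \<kappa>) * det2 \<alpha> (v - a)" unfolding pa by (rule det2_simps)
  then have "0 \<le> det2 \<alpha> (p - a)" using v\<alpha> \<kappa>\<iota> by simp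
  moreover have "0 \<le> det2 \<gamma> (p - c)"
  proof -
    have e1: "p - c = (1 + \<iota>) *\<^sub>R (v2 - c)" unfolding p2 by (simp add: algebra_simps)
    have e2: "v2 - c = - (s2' *\<^sub>R \<gamma> + t2' *\<^sub>R (c - v))" using v2(6) by (metis minus_diff_eq)
    have "det2 \<gamma> (p - c) = (1 + \<iota>) * (t2' * det2 \<gamma> (v - c))" unfolding e1 e2 by (simp add: det2_def algebra_simps)
    then show ?thesis using v\<gamma> v2 \<kappa>\<iota> by simp
  qed
  ultimately have pT: "p \<in> convex hull {a,q,c}"
    using oacp orient_swap[of c a p] q(3,4) D by (intro in_triangleI') (auto simp: qa qc)
  have rs1: "0 \<le> r * s3" "r * s3 \<le> 1" using rs by (auto simp: mult_le_one)
  have "w \<in> closed_segment p a \<or> w \<in> closed_segment p c" using w(1) in_segment_param[OF rs1] by auto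
  moreover have "closed_segment p a \<subseteq> convex hull {a,q,c}" "closed_segment p c \<subseteq> convex hull {a,q,c}"
    by (intro closed_segment_subset pT convex_convex_hull hull_inc; simp)+
  ultimately have wT: "w \<in> convex hull {a,q,c}" by blast
  show ?thesis
  proof (rule that[OF wT])
    show "area (convex hull {a,w,c}) \<le> area K"
      using areaK v2(9) areaM oavc ovv2c orient_swap_right[of v v2 c] unfolding area_triangle area_w by simp
    show "mw K < dist a w + dist w c + dist c a" using mwK v2(8) mwM w(2) by linarith
  qed
qed

section \<open>Optimal convex bodies\<close>

lemma collinear_area_0:
  assumes "compact C" "convex C" "collinear C" shows "area C = 0" 
proof (cases "C = {}")
  case False
  then obtain a b where "C = closed_segment a b"
    using compact_convex_collinear_segment assms by blast
  then show ?thesis unfolding area_def using negligible_imp_measure0[OF negligible_segment] by blast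
qed (simp add: area_def)

lemma extreme_support_normal:
  fixes C :: "complex set"
  assumes C: "compact C" "convex C" "x extreme_point_of C" "\<not> collinear C"
  obtains N where "norm N = 1" "\<And>y. y \<in> C \<Longrightarrow> N \<bullet> y \<le> N \<bullet> x"
proof -
  have xC: "x \<in> C" using C(3) by (simp add: extreme_point_of_def)
  have "x \<notin> rel_interior C"
    using extreme_point_not_in_REL_INTERIOR[OF C(3)] C(4) by (metis collinear_sing)
  then obtain a where a: "a \<noteq> 0" "\<And>y. y \<in> C \<Longrightarrow> a \<bullet> x \<le> a \<bullet> y"
    using supporting_hyperplane_rel_boundary[OF C(2) xC] by metis
  define N where "N = - (1 / norm a) *\<^sub>R a"
  have "norm N = 1" using a by (simp add: N_def)
  moreover have "N \<bullet> y \<le> N \<bullet> x" if "y \<in> C" for y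
  proof -
    have "a \<bullet> x \<le> a \<bullet> y" using a(2)[of y] that by blast
    then show ?thesis using a(1) by (simp add: N_def divide_right_mono)
  qed
  ultimately show ?thesis using that by blast
qed

context area_param
begin

text \<open>\<open>V\<close> does not depend on the number of vertices, so the polygon bound passes
  to the limit. Degenerate approximations are segments, handled by \<open>V_ge_2\<close>.\<close>

lemma convex_bound:
  assumes C: "compact C" "convex C" "C \<noteq> {}" "C \<subseteq> cball 0 1" "area C \<le> A"
  shows "mw C \<le> 2 * V"
proof (rule field_le_epsilon)
  fix \<epsilon> :: real assume e: "0 < \<epsilon>"
  obtain W where W: "finite W" "W \<noteq> {}" "W \<subseteq> C" "mw (convex hull C) \<le> mw (convex hull W) + \<epsilon>"
    using mw_finite_approx[OF C(1,3) _ _ e, of "{}"] by auto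
  have hC: "convex hull C = C" using C by (simp add: hull_same)
  have sub: "convex hull W \<subseteq> C" using W C by (intro hull_minimal)
  have cW: "compact (convex hull W)" using W by (intro finite_imp_compact_convex_hull)
  have "mw (convex hull W) \<le> 2 * V"
  proof (cases "collinear W")
    case True
    then have "collinear (convex hull W)" by (simp add: collinear_aff_dim aff_dim_convex_hull)
    then obtain a b where ab: "convex hull W = closed_segment a b"
      using compact_convex_collinear_segment cW W by (metis convex_convex_hull convex_hull_eq_empty)
    then have "a \<in> cball 0 1" "b \<in> cball 0 1" using sub C by auto
    then have "dist a b \<le> 2" using dist_triangle[of a b 0] by (simp add: dist_commute)
    then show ?thesis unfolding ab mw_segment using V_ge_2 by simp
  next
    case False
    have "\<not> aff_dim W \<le> 1" using False by (simp add: collinear_aff_dim)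
    moreover have "aff_dim W \<le> 2" using aff_dim_le_DIM[of W] by simp
    ultimately have cp: "convex_polygon (convex hull W)"
      using W(1) by (auto simp: convex_polygon_def polytope_def aff_dim_convex_hull)
    let ?n = "max m (card (vertices (convex hull W)))"
    have "polygon_class ?n A (convex hull W)"
      unfolding polygon_class_def using cp sub C area_mono[OF cW C(1) sub] by auto
    then have "perimeter (convex hull W) \<le> 2 * best_val ?n"
      using polygon_bound(1) m_props(1) by simp
    then show ?thesis using perimeter_polygon[OF cp] best_val_large[of ?n] by simp
  qed
  then show "mw C \<le> 2 * V + \<epsilon>" using W(4) hC by simp
qed

text \<open>By \<open>convex_bound\<close> the last inequality is an equality: these bodies attain
  the bound.\<close>

definition optimal_body :: "complex set \<Rightarrow> bool" where
  "optimal_body C \<longleftrightarrow> compact C \<and> convex C \<and> C \<subseteq> cball 0 1 \<and> area C = A \<and> 2 * V \<le> mw C"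

lemma optimal_bodyD:
  assumes "optimal_body C"
  shows "compact C" "convex C" "C \<subseteq> cball 0 1" "area C = A" "2 * V \<le> mw C" "\<not> collinear C" "C \<noteq> {}"
    "\<And>C'. compact C' \<Longrightarrow> convex C' \<Longrightarrow> C' \<noteq> {} \<Longrightarrow> C' \<subseteq> cball 0 1 \<Longrightarrow> area C' \<le> A \<Longrightarrow> mw C' \<le> mw C"
proof -
  show C: "compact C" "convex C" "C \<subseteq> cball 0 1" "area C = A" "2 * V \<le> mw C"
    using assms by (auto simp: optimal_body_def)
  show "\<not> collinear C" using collinear_area_0[OF C(1,2)] C(4) A0 by auto
  show "C \<noteq> {}" using C(4) A0 by (auto simp: area_def)
  show "mw C' \<le> mw C" if "compact C'" "convex C'" "C' \<noteq> {}" "C' \<subseteq> cball 0 1" "area C' \<le> A" for C'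
    using convex_bound[OF that] C(5) by simp
qed

text \<open>Near a limit point \<open>p\<close> there are infinitely many extreme points with almost
  parallel support lines. Five of them, in order along the common direction \<open>d\<close>, fit
  \<open>strict_cap\<close>, and the replacing triangle is so small that it stays in the disk. The
  new body has no more area and a larger perimeter.\<close>

lemma optimal_no_interior_limit:
  notes det2_simps(4-7) [simp del]
  assumes opt: "optimal_body C" and p: "norm p < 1"
  shows "\<not> p islimpt {x. x extreme_point_of C \<and> norm x < 1}"
proof
  assume lim: "p islimpt {x. x extreme_point_of C \<and> norm x < 1}"
  note C = optimal_bodyD[OF opt]
  \<comment> \<open>The apex \<open>q\<close> will lie within \<open>5 * \<eta>\<close> of
    \<open>p\<close>, well inside the disk, since \<open>norm p = 1 - 20 * \<eta>\<close>.\<close>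
  define \<eta> where "\<eta> = (1 - norm p) / 20"
  have \<eta>: "0 < \<eta>" using p by (simp add: \<eta>_def)
  define S where "S = {x. x extreme_point_of C \<and> norm x < 1} \<inter> ball p \<eta>"
  have infS: "infinite S" unfolding S_def using lim \<eta> by (meson islimpt_eq_infinite_ball)
  have "\<exists>N. norm N = 1 \<and> (\<forall>y\<in>C. N \<bullet> y \<le> N \<bullet> x)" if "x \<in> S" for x
  proof -
    have "x extreme_point_of C" using that by (simp add: S_def)
    show ?thesis
    proof (rule extreme_support_normal[OF C(1,2) \<open>x extreme_point_of C\<close> C(6)])
      fix N assume "norm N = 1" "\<And>y. y \<in> C \<Longrightarrow> N \<bullet> y \<le> N \<bullet> x"
      then show ?thesis by (intro exI[of _ N]) simp
    qed
  qed
  then have "\<exists>N. \<forall>x\<in>S. norm (N x) = 1 \<and> (\<forall>y\<in>C. N x \<bullet> y \<le> N x \<bullet> x)" by (intro bchoice) blast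
  then obtain N where N0: "\<forall>x\<in>S. norm (N x) = 1 \<and> (\<forall>y\<in>C. N x \<bullet> y \<le> N x \<bullet> x)" ..
  have N: "\<And>x. x \<in> S \<Longrightarrow> norm (N x) = 1" "\<And>x y. x \<in> S \<Longrightarrow> y \<in> C \<Longrightarrow> N x \<bullet> y \<le> N x \<bullet> x"
    using N0 by blast+
  \<comment> \<open>Finitely many balls of radius \<open>1/8\<close> cover the unit normals, so by
    the pigeonhole principle infinitely many support directions nearly agree.\<close>
  have "compact (sphere (0::complex) 1)" by simp
  then obtain F where F: "finite F" "F \<subseteq> sphere (0::complex) 1" "sphere 0 1 \<subseteq> (\<Union>\<nu>\<in>F. ball \<nu> (1/8))"
  proof (rule compactE_image[of _ "sphere 0 1" "\<lambda>\<nu>. ball \<nu> (1/8)"])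
    show "sphere (0::complex) 1 \<subseteq> (\<Union>\<nu>\<in>sphere 0 1. ball \<nu> (1/8))"
      by (rule subsetI, rule UN_I, assumption) simp
  qed auto
  have "\<forall>x\<in>S. \<exists>\<nu>\<in>F. dist \<nu> (N x) < 1/8" 
  proof
    fix x assume "x \<in> S"
    then have "N x \<in> sphere 0 1" using N(1) by simp
    then have "N x \<in> (\<Union>\<nu>\<in>F. ball \<nu> (1/8))" using F(3) by (rule rev_subsetD)
    then show "\<exists>\<nu>\<in>F. dist \<nu> (N x) < 1/8" by simp
  qed
  then obtain \<nu> where \<nu>: "\<nu> \<in> F" "infinite {x\<in>S. dist \<nu> (N x) < 1/8}"
    using pigeonhole_infinite_rel[OF infS F(1), of "\<lambda>x \<nu>. dist \<nu> (N x) < 1/8"] by auto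
  define S' where "S' = {x\<in>S. dist \<nu> (N x) < 1/8}"
  have n\<nu>: "norm \<nu> = 1" using F(2) \<nu>(1) by auto
  define d where "d = \<i> * \<nu>"
  define \<delta> where "\<delta> x = \<i> * N x" for x
  have nd: "norm d = 1" by (simp add: d_def norm_mult n\<nu>)
  have nd\<delta>: "norm (\<delta> x) = 1" if "x \<in> S'" for x using N(1) that by (simp add: \<delta>_def norm_mult S'_def)
  have dd: "norm (\<delta> x - d) < 1/8" if "x \<in> S'" for x
  proof -
    have "\<delta> x - d = \<i> * (N x - \<nu>)" by (simp add: d_def \<delta>_def algebra_simps)
    then show ?thesis using that by (simp add: norm_mult S'_def dist_norm norm_minus_commute)
  qed
  have line: "0 \<le> det2 (\<delta> x) (y - x)" if "x \<in> S'" "y \<in> C" for x y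
  proof -
    have "det2 (\<delta> x) (y - x) = - (N x \<bullet> (y - x))"
      unfolding det2_eq_inner \<delta>_def by (simp add: inner_complex_def algebra_simps)
    then show ?thesis using N(2)[of x y] that by (simp add: S'_def inner_diff_right)
  qed
  have SC: "x \<in> C" "x extreme_point_of C" "dist p x < \<eta>" if "x \<in> S'" for x
    using that unfolding S'_def S_def by (auto simp: extreme_point_of_def)
  have near: "\<bar>det2 u w\<bar> \<le> norm u * norm w" for u w
    unfolding det2_eq_inner using Cauchy_Schwarz_ineq2[of "\<i> * u" w] by (simp add: norm_mult)
  have d\<delta>: "7/8 < d \<bullet> \<delta> x" if "x \<in> S'" for x
  proof -
    have "d \<bullet> \<delta> x = d \<bullet> d + d \<bullet> (\<delta> x - d)" by (simp add: inner_diff_right)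
    moreover have "\<bar>d \<bullet> (\<delta> x - d)\<bar> \<le> norm d * norm (\<delta> x - d)" by (rule Cauchy_Schwarz_ineq2)
    moreover have "d \<bullet> d = 1" using nd by (simp add: power2_norm_eq_inner[symmetric])
    ultimately show ?thesis using dd[OF that] nd by simp
  qed
  \<comment> \<open>Each of two extreme points lies on the inner side of the other's support line,
    and these lines deviate from \<open>d\<close> by at most \<open>1/8\<close>; so the chord is
    nearly parallel to \<open>d\<close>. The bound \<open>7/8\<close> is a round value below
    \<open>sqrt (1 - 1/64)\<close>.\<close>
  have flat: "norm (y - x) * 7/8 \<le> \<bar>d \<bullet> (y - x)\<bar>" if "x \<in> S'" "y \<in> S'" for x y
  proof -
    define w where "w = y - x"
    have b1: "\<bar>det2 (\<delta> z - d) w\<bar> \<le> 1/8 * norm w" if "z \<in> S'" for z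
      using near[of "\<delta> z - d" w] dd[OF that] by (meson less_imp_le mult_right_mono norm_ge_zero order_trans)
    have "0 \<le> det2 (\<delta> x) w" using line[of x y] SC that by (simp only: w_def)
    moreover have "det2 (\<delta> y) w \<le> 0" using line[of y x] SC that by (simp add: w_def det2_def algebra_simps)
    moreover have "det2 (\<delta> z) w = det2 d w + det2 (\<delta> z - d) w" for z by (simp add: det2_def algebra_simps)
    ultimately have "\<bar>det2 d w\<bar> \<le> 1/8 * norm w" using b1[OF that(1)] b1[OF that(2)] by (simp add: abs_le_iff)
    then have "(det2 d w)\<^sup>2 \<le> (1/8 * norm w)\<^sup>2" by (simp add: abs_le_square_iff[symmetric])
    moreover have "(norm w)\<^sup>2 = (d \<bullet> w)\<^sup>2 + (det2 d w)\<^sup>2"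
    proof -
      have "(d \<bullet> w)\<^sup>2 + (det2 d w)\<^sup>2 = (norm d)\<^sup>2 * (norm w)\<^sup>2"
        unfolding cmod_power2 by (simp add: det2_def inner_complex_def power2_eq_square algebra_simps)
      then show ?thesis using nd by simp
    qed
    moreover have "(1/8 * norm w)\<^sup>2 = (norm w)\<^sup>2 / 64" "(norm w * 7/8)\<^sup>2 = 49 * (norm w)\<^sup>2 / 64"
      by (simp_all add: power_mult_distrib power_divide)
    ultimately have "(norm w * 7/8)\<^sup>2 \<le> (d \<bullet> w)\<^sup>2" using zero_le_power2[of "d \<bullet> w"] by linarith
    then show ?thesis unfolding w_def by (metis abs_le_square_iff abs_norm_cancel abs_mult abs_divide abs_numeral)
  qed
  have inj: "inj_on (\<lambda>x. d \<bullet> x) S'"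
  proof (rule inj_onI)
    fix x y assume "x \<in> S'" "y \<in> S'" "d \<bullet> x = d \<bullet> y"
    then show "x = y" using flat[of x y] by (simp add: inner_diff_right)
  qed
  \<comment> \<open>\<open>a\<close>, \<open>b\<close>, \<open>c\<close> carry the chords;
    \<open>e\<close> and \<open>e'\<close> lie strictly beyond \<open>a b\<close> and
    \<open>b c\<close>.\<close>
  obtain W where W: "W \<subseteq> S'" "card W = 5" "finite W"
    using infinite_arbitrarily_large[of S' 5] \<nu>(2) unfolding S'_def by auto
  obtain f where f: "bij_betw f {..<card W} W" "\<And>i j. i < j \<Longrightarrow> j < card W \<Longrightarrow> d \<bullet> f i < d \<bullet> f j"
    using strict_enumeration[OF W(3) inj_on_subset[OF inj W(1)]] by metis
  define a e b e' c where "a = f 0" and "e = f 1" and "b = f 2" and "e' = f 3" and "c = f 4"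
  have fS: "f i \<in> S'" if "i < 5" for i using f(1) W(1,2) that by (auto simp: bij_betw_def)
  have inS: "a \<in> S'" "e \<in> S'" "b \<in> S'" "e' \<in> S'" "c \<in> S'"
    unfolding a_def e_def b_def e'_def c_def using fS by auto
  have lt: "d \<bullet> a < d \<bullet> e" "d \<bullet> e < d \<bullet> b" "d \<bullet> b < d \<bullet> e'" "d \<bullet> e' < d \<bullet> c"
    unfolding a_def e_def b_def e'_def c_def using f(2) W(2) by auto
  \<comment> \<open>The support line at \<open>y\<close> keeps \<open>x\<close> and \<open>z\<close>
    on one side, and their order along \<open>d\<close> fixes the sign. Collinearity is impossible
    because \<open>y\<close> is extreme.\<close>
  have conv: "0 < orient x y z" if xyz: "x \<in> S'" "y \<in> S'" "z \<in> S'" "d \<bullet> x < d \<bullet> y" "d \<bullet> y < d \<bullet> z" for x y z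
  proof -
    have pos: "0 < \<delta> y \<bullet> (v - u)" if "u \<in> S'" "v \<in> S'" "d \<bullet> u < d \<bullet> v" for u v
    proof -
      have "\<delta> y \<bullet> (v - u) = d \<bullet> (v - u) + (\<delta> y - d) \<bullet> (v - u)" by (simp add: inner_diff_left)
      moreover have "\<bar>(\<delta> y - d) \<bullet> (v - u)\<bar> \<le> 1/8 * norm (v - u)"
        using Cauchy_Schwarz_ineq2[of "\<delta> y - d" "v - u"] dd[OF xyz(2)]
        by (meson less_imp_le mult_right_mono norm_ge_zero order_trans)
      moreover have "norm (v - u) * 7/8 \<le> d \<bullet> (v - u)" using flat[OF that(1,2)] that(3) by (simp add: inner_diff_right)
      moreover have "0 < norm (v - u)" using that(3) by auto
      ultimately show ?thesis by linarith
    qed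
    define X Z where "X = x - y" and "Z = z - y"
    have XZ: "\<delta> y \<bullet> X < 0" "0 < \<delta> y \<bullet> Z" "0 \<le> det2 (\<delta> y) X" "0 \<le> det2 (\<delta> y) Z"
      using pos[of x y] pos[of y z] line[of y x] line[of y z] SC xyz by (auto simp: X_def Z_def inner_diff_right simp del: det2_simps)
    have "(\<delta> y \<bullet> \<delta> y) * det2 X Z = (\<delta> y \<bullet> Z) * det2 X (\<delta> y) + (\<delta> y \<bullet> X) * det2 (\<delta> y) Z"
      by (rule det2_inner_identity)
    moreover have "\<delta> y \<bullet> \<delta> y = 1" using nd\<delta>[OF xyz(2)] by (simp add: power2_norm_eq_inner[symmetric])
    moreover have "(\<delta> y \<bullet> Z) * det2 X (\<delta> y) \<le> 0" using XZ det2_swap[of X "\<delta> y"] by (simp add: mult_nonneg_nonpos)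
    moreover have "(\<delta> y \<bullet> X) * det2 (\<delta> y) Z \<le> 0" using XZ by (simp add: mult_nonpos_nonneg)
    ultimately have "det2 X Z \<le> 0" by simp
    moreover have "orient x y z = - det2 X Z" unfolding X_def Z_def by (simp add: orient_simps algebra_simps)
    moreover have "orient x y z \<noteq> 0"
    proof
      assume "orient x y z = 0"
      then have "orient x z y = 0" using orient_swap_right[of x y z] by simp
      moreover have "x \<noteq> z" using xyz by auto
      ultimately obtain s where s: "y = x + s *\<^sub>R (z - x)" using orient_eq_0_iff by blast
      have ds: "d \<bullet> y - d \<bullet> x = s * (d \<bullet> z - d \<bullet> x)" unfolding s by (simp add: inner_add_right inner_diff_right)
      then have "0 < s * (d \<bullet> z - d \<bullet> x)" using xyz by simp
      then have "0 < s" using xyz by (simp add: zero_less_mult_iff)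
      moreover have "s < 1"
      proof (rule ccontr)
        assume "\<not> s < 1"
        then have "1 * (d \<bullet> z - d \<bullet> x) \<le> s * (d \<bullet> z - d \<bullet> x)" using xyz by (intro mult_right_mono) auto
        then have "d \<bullet> z - d \<bullet> x \<le> d \<bullet> y - d \<bullet> x" unfolding ds by (simp only: mult_1)
        then show False using xyz(5) by linarith
      qed
      ultimately have "y \<in> open_segment x z" unfolding s in_segment using \<open>x \<noteq> z\<close>
        by (auto intro!: exI[of _ s] simp: algebra_simps)
      then show False using SC[OF xyz(2)] SC[OF xyz(1)] SC[OF xyz(3)] unfolding extreme_point_of_def by blast
    qed
    ultimately show ?thesis by simp
  qed
  have dirs1: "0 < det2 (\<delta> x) (z - x)" "0 < det2 (\<delta> z) (x - z)"
    if xyz: "x \<in> S'" "y \<in> S'" "z \<in> S'" "d \<bullet> x < d \<bullet> y" "d \<bullet> y < d \<bullet> z" for x y z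
  proof -
    have "(d \<bullet> (y - x)) * det2 (\<delta> x) (z - x) = (d \<bullet> (z - x)) * det2 (\<delta> x) (y - x) + (d \<bullet> \<delta> x) * orient x y z"
      unfolding orient_def by (rule det2_inner_identity)
    moreover have "0 \<le> (d \<bullet> (z - x)) * det2 (\<delta> x) (y - x)"
      using line[of x y] SC xyz by (intro mult_nonneg_nonneg) (auto simp: inner_diff_right simp del: det2_simps)
    moreover have "0 < (d \<bullet> \<delta> x) * orient x y z" using d\<delta>[OF xyz(1)] conv[OF xyz] by simp
    ultimately have "0 < (d \<bullet> (y - x)) * det2 (\<delta> x) (z - x)" by linarith
    then show "0 < det2 (\<delta> x) (z - x)" using xyz by (simp add: zero_less_mult_iff inner_diff_right del: det2_simps)
    have "orient x y z = det2 (x - z) (y - z)" by (simp add: orient_simps algebra_simps)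
    then have "(d \<bullet> (y - z)) * det2 (x - z) (\<delta> z) = (d \<bullet> \<delta> z) * orient x y z + (d \<bullet> (x - z)) * det2 (y - z) (\<delta> z)"
      by (simp only: det2_inner_identity[of d "y - z" "x - z" "\<delta> z"])
    moreover have "0 \<le> (d \<bullet> (x - z)) * det2 (y - z) (\<delta> z)"
      using line[of z y] SC xyz det2_swap[of "y - z" "\<delta> z"] by (intro mult_nonpos_nonpos) (auto simp: inner_diff_right simp del: det2_simps)
    moreover have "0 < (d \<bullet> \<delta> z) * orient x y z" using d\<delta>[OF xyz(3)] conv[OF xyz] by simp
    ultimately have "0 < (d \<bullet> (y - z)) * det2 (x - z) (\<delta> z)" by linarith
    then have "det2 (x - z) (\<delta> z) < 0" using xyz by (simp add: zero_less_mult_iff inner_diff_right del: det2_simps)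
    then show "0 < det2 (\<delta> z) (x - z)" using det2_swap[of "\<delta> z" "x - z"] by simp
  qed
  have dpos: "0 < d \<bullet> \<delta> x" if "x \<in> S'" for x using d\<delta>[OF that] by simp
  have dirs2: "0 < det2 (\<delta> x) (\<delta> z)"
    if xyz: "x \<in> S'" "y \<in> S'" "z \<in> S'" "d \<bullet> x < d \<bullet> y" "d \<bullet> y < d \<bullet> z" for x y z
  proof (rule det2_trans[of d _ "z - x"])
    show "0 < det2 (z - x) (\<delta> z)" using dirs1(2)[OF xyz] by (simp add: det2_def algebra_simps)
  qed (use dpos xyz dirs1(1)[OF xyz] in \<open>auto simp: inner_diff_right simp del: det2_simps\<close>)
  define K where "K = C \<inter> {x. orient a c x \<le> 0}"
  define L where "L = C \<inter> {x. 0 \<le> orient a c x}"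
  have aeb: "0 < orient a e b" "0 < orient b e' c" "0 < orient a b c" "0 < orient a b e'" "0 < orient a e c" "0 < orient a e' c"
    using conv inS lt by (meson order.strict_trans)+
  have dac: "0 < det2 (\<delta> a) (c - a)" "0 < det2 (\<delta> c) (a - c)" "0 < det2 (\<delta> a) (\<delta> c)"
    using dirs1[of a b c] dirs2[of a b c] inS lt by (auto simp del: det2_simps)
  note cut = cut_chord[OF C(1,2) SC(1)[OF inS(1)] SC(1)[OF inS(5)] dac(1) line[OF inS(1)] dac(2) line[OF inS(5)],
      folded K_def L_def]
  \<comment> \<open>Coordinates of \<open>c - a\<close> with respect to the support directions at
    \<open>a\<close> and \<open>c\<close>, whose lines meet at \<open>q\<close>.\<close>
  define t where "t = det2 (c - a) (\<delta> c) / det2 (\<delta> a) (\<delta> c)"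
  define r where "r = det2 (\<delta> a) (c - a) / det2 (\<delta> a) (\<delta> c)"
  have tr: "0 < t" "0 < r" using dac unfolding t_def r_def by (auto simp: det2_def algebra_simps)
  define q where "q = a + t *\<^sub>R \<delta> a"
  have "det2 (\<delta> a) (\<delta> c) *\<^sub>R (c - a) = det2 (\<delta> a) (\<delta> c) *\<^sub>R (t *\<^sub>R \<delta> a + r *\<^sub>R \<delta> c)"
    using det2_cramer[of "\<delta> a" "\<delta> c" "c - a"] dac(3) by (simp add: t_def r_def scaleR_add_right del: det2_simps)
  then have ca: "c - a = t *\<^sub>R \<delta> a + r *\<^sub>R \<delta> c" using dac(3) by simp
  have q2: "q = c - r *\<^sub>R \<delta> c" unfolding q_def using ca by (simp add: algebra_simps)
  \<comment> \<open>From \<open>t * (7/8) \<le> d \<bullet> (c - a) < 2 * \<eta>\<close> follows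
    \<open>t < 4 * \<eta>\<close>, and \<open>t\<close> is the distance from \<open>a\<close> to
    \<open>q\<close>.\<close>
  have qnorm: "norm q < 1"
  proof -
    have "d \<bullet> (c - a) = t * (d \<bullet> \<delta> a) + r * (d \<bullet> \<delta> c)" unfolding ca by (simp add: inner_add_right)
    moreover have "t * (7/8) \<le> t * (d \<bullet> \<delta> a)" using tr d\<delta>[OF inS(1)] by simp
    moreover have "0 \<le> r * (d \<bullet> \<delta> c)" using tr dpos[OF inS(5)] by simp
    moreover have "d \<bullet> (c - a) \<le> norm (c - a)" using norm_cauchy_schwarz[of d "c - a"] nd by simp
    moreover have "norm (c - a) < 2 * \<eta>" using SC(3)[OF inS(1)] SC(3)[OF inS(5)] dist_triangle2[of c a p]
      by (simp add: dist_norm norm_minus_commute)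
    ultimately have "t < 4 * \<eta>" using \<eta> by linarith
    moreover have "norm (q - a) = t" unfolding q_def using nd\<delta>[OF inS(1)] tr by simp
    moreover have "norm q \<le> norm p + norm (a - p) + norm (q - a)"
      using norm_triangle_ineq[of "p + (a - p)" "q - a"] norm_triangle_ineq[of p "a - p"] by simp
    moreover have "norm (a - p) < \<eta>" using SC(3)[OF inS(1)] by (simp add: dist_norm norm_minus_commute)
    moreover have "norm p = 1 - 20 * \<eta>" by (simp add: \<eta>_def field_simps)
    ultimately show ?thesis using \<eta> by linarith
  qed
  have inK: "a \<in> K" "b \<in> K" "c \<in> K" "e \<in> K" "e' \<in> K"
    using SC inS aeb orient_swap_right[of a c] unfolding K_def by auto
  obtain w where w: "w \<in> convex hull {a,q,c}" "area (convex hull {a,w,c}) \<le> area K"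
    "mw K < dist a w + dist w c + dist c a"
  proof (rule strict_cap[OF cut(3,4) inK dpos[OF inS(1)] dpos[OF inS(3)] dpos[OF inS(5)] _ _ _ _ _ _ aeb(1,2,3) less_imp_le[OF aeb(4)] _ _ q_def q2 tr])
    show "0 < d \<bullet> (b - a)" "0 < d \<bullet> (c - b)" using lt by (auto simp: inner_diff_right)
    show "0 \<le> det2 (\<delta> a) (x - a)" "0 \<le> det2 (\<delta> b) (x - b)" "0 \<le> det2 (\<delta> c) (x - c)" "orient a c x \<le> 0" if "x \<in> K" for x
      using line inS that unfolding K_def by (auto simp del: det2_simps)
    show "0 < det2 (\<delta> a) (\<delta> b)" "0 < det2 (\<delta> b) (\<delta> c)" using dirs2[of a e b] dirs2[of b e' c] inS lt by auto
  qed
  have oq: "orient a q x = t * det2 (\<delta> a) (x - a)" "orient q c x = r * det2 (\<delta> c) (x - c)" for x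
    unfolding q_def by (simp add: orient_simps algebra_simps) (simp add: q_def[symmetric] q2 orient_simps algebra_simps)
  have D: "0 \<le> orient a q c" unfolding oq using tr dac by simp
  have wl: "0 \<le> det2 (\<delta> a) (w - a)" "0 \<le> det2 (\<delta> c) (w - c)" "orient a c w \<le> 0"
    using in_triangleD[OF w(1) D] tr orient_swap[of c a w] unfolding oq by (auto simp: zero_le_mult_iff simp del: det2_simps)
  define C' where "C' = convex hull (insert w L)"
  have lL: "0 \<le> det2 (\<delta> a) (x - a)" "0 \<le> det2 (\<delta> c) (x - c)" "0 \<le> orient a c x" if "x \<in> L" for x
    using line inS that unfolding L_def by (auto simp del: det2_simps)
  have g: "C' = L \<union> convex hull {a,w,c}" "mw C' = mw L + dist a w + dist w c - dist a c" "area C' = area L + \<bar>orient a c w\<bar> / 2"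
    unfolding C'_def
    by (rule triangle_glue[OF cut(5,6,9,10) lL(3) wl(3) dac(1) lL(1) wl(1) dac(2) lL(2) wl(2)]; assumption)+
  have "compact C'" unfolding g(1) using cut(5) by (intro compact_Un finite_imp_compact_convex_hull) auto
  moreover have "convex C'" "C' \<noteq> {}" unfolding C'_def by auto
  moreover have "C' \<subseteq> cball 0 1"
  proof -
    have "a \<in> cball 0 1" "c \<in> cball 0 1" using SC(1) inS C(3) by blast+
    then have "convex hull {a,q,c} \<subseteq> cball 0 1" using qnorm by (intro hull_minimal) auto
    then have "w \<in> cball 0 1" using w(1) by blast
    then show ?thesis unfolding C'_def using C(3) by (intro hull_minimal) (auto simp: L_def)
  qed
  moreover have "area C' \<le> A" 
    using g(3) cut(2) w(2) C(4) orient_swap_right[of a w c] unfolding area_triangle by simp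
  ultimately have "mw C' \<le> mw C" by (rule C(8))
  then show False using g(2) cut(1) w(3) by (simp add: dist_commute)
qed

end

section \<open>Tangents and small motions of an extreme point\<close>

lemma extreme_points_orient:
  fixes C :: "complex set"
  assumes "x extreme_point_of C" "y extreme_point_of C" "z extreme_point_of C" "x \<noteq> y" "y \<noteq> z" "x \<noteq> z"
  shows "orient x y z \<noteq> 0"
proof
  assume "orient x y z = 0"
  then obtain s where s: "z = x + s *\<^sub>R (y - x)" using orient_eq_0_iff assms(4) by blast
  have "s \<noteq> 0" "s \<noteq> 1" using s assms by auto
  then consider "s < 0" | "0 < s" "s < 1" | "1 < s" by linarith
  then show False
  proof cases
    case 1
    have "x = z + (- s / (1 - s)) *\<^sub>R (y - z)"
    proof -
      have "(1 - s) * (- s / (1 - s)) = - s" using 1 by simp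
      then have "(1 - s) *\<^sub>R (z + (- s / (1 - s)) *\<^sub>R (y - z)) = (1 - s) *\<^sub>R z + (- s) *\<^sub>R (y - z)"
        by (simp only: scaleR_add_right scaleR_scaleR)
      also have "\<dots> = (1 - s) *\<^sub>R x" unfolding s by (simp add: algebra_simps)
      finally have "(1 - s) *\<^sub>R x = (1 - s) *\<^sub>R (z + (- s / (1 - s)) *\<^sub>R (y - z))" by (rule sym)
      then show ?thesis using 1 by simp
    qed
    moreover have "0 < - s / (1 - s)" "- s / (1 - s) < 1" using 1 by (auto simp: field_simps)
    ultimately have "x \<in> open_segment z y" unfolding in_segment using assms(5)
      by (intro conjI exI[of _ "- s / (1 - s)"]) (auto simp: algebra_simps)
    then show False using assms unfolding extreme_point_of_def by blast
  next
    case 2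
    then have "z \<in> open_segment x y" unfolding in_segment using assms(4) s
      by (intro conjI exI[of _ s]) (auto simp: algebra_simps)
    then show False using assms unfolding extreme_point_of_def by blast
  next
    case 3
    have "y = x + (1 / s) *\<^sub>R (z - x)" unfolding s using 3 by simp
    then have "y \<in> open_segment x z" unfolding in_segment using assms(6) 3
      by (intro conjI exI[of _ "1 / s"]) (auto simp: algebra_simps)
    then show False using assms unfolding extreme_point_of_def by blast
  qed
qed

lemma sphere_point_extreme:
  fixes C :: "complex set"
  assumes "C \<subseteq> cball 0 1" "x \<in> C" "norm x = 1" shows "x extreme_point_of C"
  unfolding extreme_point_of_def
proof (intro conjI ballI notI)
  fix a b assume "a \<in> C" "b \<in> C" "x \<in> open_segment a b"
  then have "dist 0 x < dist 0 a \<or> dist 0 x < dist 0 b" "norm a \<le> 1" "norm b \<le> 1"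
    using dist_decreases_open_segment[of x a b 0] assms(1) by auto
  then show False using assms(3) by simp
qed (rule assms(2))

text \<open>Seen from \<open>p\<close>, the set lies in an open half-plane; the extreme slopes are
  attained by compactness and give the two tangent points.\<close>

lemma two_tangents:
  fixes Z :: "complex set"
  assumes Z: "compact Z" "Z \<noteq> {}" "p \<notin> convex hull Z" "\<not> collinear (insert p Z)"
  obtains a b where "a \<in> Z" "b \<in> Z" "orient a b p < 0"
    "\<And>z. z \<in> Z \<Longrightarrow> 0 \<le> orient a p z" "\<And>z. z \<in> Z \<Longrightarrow> 0 \<le> orient p b z"
proof -
  have "closed (convex hull Z)" using Z(1) by (simp add: compact_convex_hull compact_imp_closed)
  then obtain e \<beta> where eb: "e \<bullet> p < \<beta>" "\<And>x. x \<in> convex hull Z \<Longrightarrow> e \<bullet> x > \<beta>"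
    using separating_hyperplane_closed_point[of "convex hull Z" p] Z(3) by auto
  have epos: "e \<bullet> (x - p) > 0" if "x \<in> Z" for x
    using eb(1) eb(2)[of x] that by (simp add: inner_diff_right hull_inc)
  define s where "s x = det2 e (x - p) / (e \<bullet> (x - p))" for x
  have id: "(norm e)\<^sup>2 * orient p x y = (e \<bullet> (x-p)) * det2 e (y-p) - det2 e (x-p) * (e \<bullet> (y-p))" for x y
    unfolding cmod_power2 by (simp add: orient_simps inner_complex_def algebra_simps power2_eq_square)
  have e0: "e \<noteq> 0" using epos Z(2) by force
  have orient_s: "(norm e)\<^sup>2 * orient p x y = ((e \<bullet> (x-p)) * (e \<bullet> (y-p))) * (s y - s x)" if "x \<in> Z" "y \<in> Z" for x y
    unfolding id s_def using epos[OF that(1)] epos[OF that(2)] by (simp add: field_simps)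
  have le: "0 \<le> orient p x y \<longleftrightarrow> s x \<le> s y" if "x \<in> Z" "y \<in> Z" for x y
  proof -
    have "0 < (norm e)\<^sup>2" "0 < (e \<bullet> (x-p)) * (e \<bullet> (y-p))" using e0 epos that by auto
    then have "0 \<le> (norm e)\<^sup>2 * orient p x y \<longleftrightarrow> 0 \<le> orient p x y" 
      "0 \<le> ((e \<bullet> (x-p)) * (e \<bullet> (y-p))) * (s y - s x) \<longleftrightarrow> 0 \<le> s y - s x"
      using mult_le_cancel_left_pos[of "(norm e)\<^sup>2" 0 "orient p x y"]
        mult_le_cancel_left_pos[of "(e \<bullet> (x-p)) * (e \<bullet> (y-p))" 0 "s y - s x"] by simp_all
    then show ?thesis using orient_s[OF that] by simp
  qed
  have "continuous_on Z s" unfolding s_def det2_eq_inner using epos by (intro continuous_intros) (metis less_irrefl)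
  then obtain a b where ab: "a \<in> Z" "b \<in> Z" "\<And>z. z \<in> Z \<Longrightarrow> s z \<le> s a" "\<And>z. z \<in> Z \<Longrightarrow> s b \<le> s z"
    using continuous_attains_sup[OF Z(1,2)] continuous_attains_inf[OF Z(1,2)] by metis
  have a: "0 \<le> orient a p z" if "z \<in> Z" for z using le[of z a] ab that orient_cyclic[of a p z] by simp
  have b: "0 \<le> orient p b z" if "z \<in> Z" for z using le[of b z] ab that by simp
  have "orient a b p \<noteq> 0"
  proof
    assume "orient a b p = 0"
    then have "0 \<le> orient p a b" using orient_cyclic[of p a b] by simp
    then have sab: "s a \<le> s b" using le[of a b] ab by simp
    have "orient p a z = 0" if "z \<in> Z" for z
    proof -
      have "s z = s a" using sab ab(3)[of z] ab(4)[of z] that by linarith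
      then show ?thesis using orient_s[OF ab(1) that] e0 by simp
    qed
    moreover have pa: "p \<noteq> a" using epos[OF ab(1)] by auto
    ultimately have "\<exists>r. z = p + r *\<^sub>R (a - p)" if "z \<in> Z" for z using orient_eq_0_iff that by blast
    then have "\<exists>r. z = p + r *\<^sub>R (a - p)" if "z \<in> insert p Z" for z
      using that by (cases "z = p") (auto intro!: exI[of _ "0::real"])
    then have "collinear (insert p Z)" unfolding collinear_alt by blast
    then show False using Z(4) by simp
  qed
  moreover have "orient a b p = - orient a p b" by (rule orient_swap_right)
  ultimately have "orient a b p < 0" using a[OF ab(2)] by linarith
  then show ?thesis using that ab a b by blast
qed

text \<open>At a point \<open>a\<close> of the circle every point of the disk is seen in the
  half-plane with inner normal \<open>- a\<close>, where turning left is transitive. So when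
  \<open>a\<close> is on the circle, moving \<open>q\<close> within the disk beyond the chord can
  never make the line \<open>a q\<close> cut off a point \<open>z\<close>.\<close>

lemma orient_left_circle:
  notes det2_simps(4-7) [simp del]
  assumes "norm a = 1" "norm b \<le> 1" "norm q \<le> 1" "norm z \<le> 1" "a \<noteq> b" "orient a b q \<le> 0" "0 \<le> orient a b z"
  shows "0 \<le> orient a q z"
proof -
  have nn: "0 \<le> (- a) \<bullet> (x - a)" if "norm x \<le> 1" for x
  proof -
    have "a \<bullet> x \<le> norm a * norm x" by (rule norm_cauchy_schwarz)
    moreover have "a \<bullet> a = 1" using assms(1) by (simp add: power2_norm_eq_inner[symmetric])
    ultimately show ?thesis using that assms(1) by (simp add: inner_diff_right)
  qed
  have "(- a) \<bullet> (b - a) \<noteq> 0"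
  proof
    assume "(- a) \<bullet> (b - a) = 0"
    then have "a \<bullet> b = 1" using assms(1) by (simp add: inner_diff_right power2_norm_eq_inner[symmetric])
    moreover have "(norm (a - b))\<^sup>2 = (norm a)\<^sup>2 + (norm b)\<^sup>2 - 2 * (a \<bullet> b)"
      by (simp add: power2_norm_eq_inner inner_diff_left inner_diff_right inner_commute)
    moreover have "(norm b)\<^sup>2 \<le> 1" using assms(2) by (simp add: power_le_one)
    ultimately have "(norm (a - b))\<^sup>2 \<le> 0" using assms(1) by simp
    then show False using assms(5) by simp
  qed
  then have g: "0 < (- a) \<bullet> (b - a)" using nn[OF assms(2)] by linarith
  have "((- a) \<bullet> (b - a)) * det2 (q - a) (z - a)
    = ((- a) \<bullet> (z - a)) * det2 (q - a) (b - a) + ((- a) \<bullet> (q - a)) * det2 (b - a) (z - a)"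
    by (rule det2_inner_identity)
  moreover have "0 \<le> det2 (q - a) (b - a)" using assms(6) det2_swap[of "q - a" "b - a"] by (simp add: orient_def)
  moreover have "0 \<le> det2 (b - a) (z - a)" using assms(7) by (simp add: orient_def)
  ultimately have "0 \<le> ((- a) \<bullet> (b - a)) * det2 (q - a) (z - a)"
    using nn[OF assms(4)] nn[OF assms(3)] by (metis add_nonneg_nonneg mult_nonneg_nonneg)
  then show ?thesis using g unfolding orient_def by (simp only: zero_le_mult_iff) linarith
qed

text \<open>Conjugation reverses orientation and thereby exchanges the roles of the two ends of the
  chord.\<close>

lemma orient_right_circle:
  notes det2_simps(4-7) [simp del]
  assumes "norm b = 1" "norm a \<le> 1" "norm q \<le> 1" "norm z \<le> 1" "a \<noteq> b" "orient a b q \<le> 0" "0 \<le> orient a b z"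
  shows "0 \<le> orient q b z"
proof -
  have "0 \<le> orient (cnj b) (cnj q) (cnj z)"
    by (rule orient_left_circle[of _ "cnj a"]) (use assms in \<open>auto simp: orient_simps algebra_simps\<close>)
  then show ?thesis by (simp add: orient_simps algebra_simps)
qed

text \<open>On a compact set a positive orientation has a positive minimum, and it depends on the
  middle point in a Lipschitz way. The factor \<open>\<sigma>\<close> covers both signs.\<close>

lemma orient_pos_stable:
  fixes Z :: "complex set"
  assumes Z: "compact Z" and pos: "\<And>z. z \<in> Z \<Longrightarrow> 0 < \<sigma> * orient a p z"
  shows "\<exists>\<epsilon>>0. \<forall>q z. dist q p < \<epsilon> \<longrightarrow> z \<in> Z \<longrightarrow> 0 < \<sigma> * orient a q z"
proof (cases "Z = {}")
  case True
  then show ?thesis by (intro exI[of _ 1]) simp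
next
  case False
  have "continuous_on Z (\<lambda>z. \<sigma> * orient a p z)" unfolding orient_def det2_eq_inner by (intro continuous_intros)
  then obtain z0 where z0: "z0 \<in> Z" "\<And>z. z \<in> Z \<Longrightarrow> \<sigma> * orient a p z0 \<le> \<sigma> * orient a p z"
    using continuous_attains_inf[OF Z False] by metis
  define m where "m = \<sigma> * orient a p z0"
  have m: "0 < m" using pos[OF z0(1)] m_def by simp
  obtain B where B: "0 < B" "\<And>z. z \<in> Z \<Longrightarrow> norm z \<le> B"
    using compact_imp_bounded[OF Z] by (metis bounded_pos)
  define R where "R = (\<bar>\<sigma>\<bar> + 1) * (B + norm a)"
  have R: "0 < R" using B(1) unfolding R_def by (simp add: add_pos_nonneg)
  show ?thesis
  proof (intro exI[of _ "m / R"] conjI allI impI)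
    show "0 < m / R" using m R by simp
    fix q z assume q: "dist q p < m / R" and z: "z \<in> Z"
    have "orient a q z = orient a p z + det2 (q - p) (z - a)" by (simp add: orient_simps algebra_simps)
    then have "\<sigma> * orient a q z = \<sigma> * orient a p z + \<sigma> * det2 (q - p) (z - a)" by (simp only: distrib_left)
    moreover have "\<bar>\<sigma> * det2 (q - p) (z - a)\<bar> \<le> norm (q - p) * R"
    proof -
      have "\<bar>det2 (q - p) (z - a)\<bar> \<le> norm (q - p) * norm (z - a)"
        unfolding det2_eq_inner using Cauchy_Schwarz_ineq2[of "\<i> * (q - p)" "z - a"] by (simp add: norm_mult)
      also have "\<dots> \<le> norm (q - p) * (B + norm a)" using B(2)[OF z] norm_triangle_ineq4[of z a] by (intro mult_left_mono) auto
      finally have "\<bar>\<sigma>\<bar> * \<bar>det2 (q - p) (z - a)\<bar> \<le> (\<bar>\<sigma>\<bar> + 1) * (norm (q - p) * (B + norm a))"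
        using B(1) by (intro mult_mono) auto
      then show ?thesis unfolding R_def abs_mult by (simp only: mult.left_commute)
    qed
    moreover have "norm (q - p) * R < m" using q R by (simp add: dist_norm pos_less_divide_eq)
    moreover have "m \<le> \<sigma> * orient a p z" using z0(2)[OF z] m_def by simp
    ultimately show "0 < \<sigma> * orient a q z" by linarith
  qed
qed

context area_param
begin

text \<open>Limit points of extreme points must lie on the circle by
  \<open>optimal_no_interior_limit\<close>, and there every point of \<open>C\<close> is extreme.
  Removing interior points does not affect this.\<close>

lemma optimal_extreme_compact:
  assumes opt: "optimal_body C" and F: "\<And>x. x \<in> F \<Longrightarrow> norm x < 1"
  shows "compact ({x. x extreme_point_of C} - F)"
proof -
  note C = optimal_bodyD[OF opt]
  have "{x. x extreme_point_of C} - F \<subseteq> C" by (auto simp: extreme_point_of_def)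
  then have b: "bounded ({x. x extreme_point_of C} - F)" using bounded_subset C(1) compact_imp_bounded by blast
  have "x \<in> {x. x extreme_point_of C} - F" if lim: "x islimpt ({x. x extreme_point_of C} - F)" for x
  proof -
    have "x islimpt C" using lim by (rule islimpt_subset) (auto simp: extreme_point_of_def)
    then have xC: "x \<in> C" using C(1) by (meson closed_limpt compact_imp_closed)
    have "x islimpt (sphere 0 1) \<or> x islimpt {x. x extreme_point_of C \<and> norm x < 1}"
      unfolding islimpt_Un[symmetric] using lim
    proof (rule islimpt_subset)
      show "{x. x extreme_point_of C} - F \<subseteq> sphere 0 1 \<union> {x. x extreme_point_of C \<and> norm x < 1}"
        using C(3) by (force simp: extreme_point_of_def)
    qed
    then have "norm x = 1"
    proof
      assume "x islimpt sphere 0 1"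
      then have "x \<in> sphere 0 1" using closed_limpt closed_sphere by blast
      then show ?thesis by simp
    next
      assume "x islimpt {x. x extreme_point_of C \<and> norm x < 1}"
      then have "\<not> norm x < 1" using optimal_no_interior_limit[OF opt] by blast
      moreover have "norm x \<le> 1" using xC C(3) by auto
      ultimately show ?thesis by simp
    qed
    moreover have "x \<notin> F" using F[of x] calculation by auto
    ultimately show ?thesis using sphere_point_extreme[OF C(3) xC] by simp
  qed
  then have "closed ({x. x extreme_point_of C} - F)" unfolding closed_limpt by blast
  with b show ?thesis by (simp add: compact_eq_bounded_closed)
qed

text \<open>An interior extreme point \<open>p\<close> is the apex of a triangle over the chord of
  its two tangent points. A short slide parallel to this chord keeps the area, stays convex over the
  rest, and in one direction increases the perimeter.\<close>

lemma optimal_extreme_on_circle: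
  assumes opt: "optimal_body C" and p: "p extreme_point_of C"
  shows "norm p = 1"
proof (rule ccontr)
  note C = optimal_bodyD[OF opt]
  assume "norm p \<noteq> 1"
  moreover have "p \<in> C" using p by (simp add: extreme_point_of_def)
  ultimately have np: "norm p < 1" using C(3) by auto
  define Z where "Z = {x. x extreme_point_of C} - {p}"
  have Zc: "compact Z" unfolding Z_def using np by (intro optimal_extreme_compact[OF opt]) auto
  have ext: "z extreme_point_of C" "z \<noteq> p" "z \<in> C" "norm z \<le> 1" if "z \<in> Z" for z
    using that C(3) unfolding Z_def by (auto simp: extreme_point_of_def)
  have "insert p Z = {x. x extreme_point_of C}" using p by (auto simp: Z_def)
  then have hC: "C = convex hull (insert p Z)" using Krein_Milman_Minkowski[OF C(1,2)] by simp
  have sub: "convex hull Z \<subseteq> C" unfolding hC by (intro hull_mono) auto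
  have "p \<notin> convex hull Z"
  proof
    assume "p \<in> convex hull Z"
    then have "p extreme_point_of (convex hull Z)" using p sub unfolding extreme_point_of_def by blast
    then have "p \<in> Z" by (rule extreme_point_of_convex_hull)
    then show False by (simp add: Z_def)
  qed
  moreover have "\<not> collinear (insert p Z)" using C(6) unfolding hC by (simp add: collinear_aff_dim aff_dim_convex_hull)
  moreover have "Z \<noteq> {}" using calculation(2) by auto
  ultimately obtain a b where ab: "a \<in> Z" "b \<in> Z" "orient a b p < 0"
    "\<And>z. z \<in> Z \<Longrightarrow> 0 \<le> orient a p z" "\<And>z. z \<in> Z \<Longrightarrow> 0 \<le> orient p b z"
    using two_tangents[OF Zc] by metis
  have aneb: "a \<noteq> b" using ab(3) by (auto simp: orient_simps)
  \<comment> \<open>A point beyond the chord would lie in the triangle \<open>b a p\<close> and,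
    being extreme, would be one of its corners.\<close>
  have oZ: "0 \<le> orient a b z" if z: "z \<in> Z" for z
  proof (rule ccontr)
    assume "\<not> 0 \<le> orient a b z"
    then have neg: "0 < orient b a z" using orient_swap[of a b z] by simp
    have "z \<in> convex hull {b,a,p}"
    proof (rule in_triangleI)
      show "0 < orient b a p" using ab(3) orient_swap[of a b p] by simp
      show "0 \<le> orient z a p" using ab(4)[OF z] orient_cyclic[of z a p] by simp
      show "0 \<le> orient b z p" using ab(5)[OF z] orient_cyclic[of p b z] by simp
    qed (use neg in simp)
    moreover have "convex hull {b,a,p} \<subseteq> C" unfolding hC using ab by (intro hull_mono) auto
    ultimately have "z extreme_point_of (convex hull {b,a,p})"
      using ext(1)[OF z] unfolding extreme_point_of_def by blast
    then have "z \<in> {b,a,p}" by (rule extreme_point_of_convex_hull)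
    then have "z = a \<or> z = b" using ext(2)[OF z] by blast
    then show False using neg by (auto simp: orient_simps)
  qed
  \<comment> \<open>If \<open>a\<close> is on the circle, every motion beyond the chord is harmless.
    If not, \<open>a\<close> can be removed from the compact set of extreme points, and the others
    keep a positive distance from the line \<open>a p\<close>.\<close>
  have near: "\<exists>\<epsilon>>0. \<forall>q. dist q p < \<epsilon> \<longrightarrow> norm q \<le> 1 \<longrightarrow> orient a b q \<le> 0 \<longrightarrow> (\<forall>z\<in>Z. 0 \<le> orient a q z)"
  proof (cases "norm a = 1")
    case True
    have "0 \<le> orient a q z" if "norm q \<le> 1" "orient a b q \<le> 0" "z \<in> Z" for q z
      by (rule orient_left_circle[OF True ext(4)[OF ab(2)] that(1) ext(4)[OF that(3)] aneb that(2) oZ[OF that(3)]])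
    then show ?thesis by (intro exI[of _ 1]) simp
  next
    case False
    then have "norm a < 1" using ext(4)[OF ab(1)] by simp
    then have "compact ({x. x extreme_point_of C} - {p,a})" using np by (intro optimal_extreme_compact[OF opt]) auto
    moreover have "0 < 1 * orient a p z" if "z \<in> {x. x extreme_point_of C} - {p,a}" for z
    proof -
      have "z \<in> Z" using that by (simp add: Z_def)
      moreover have "orient a p z \<noteq> 0"
        using extreme_points_orient[OF ext(1)[OF ab(1)] p, of z] that ext(2)[OF ab(1)] by blast
      ultimately show ?thesis using ab(4)[of z] by simp
    qed
    ultimately have "\<exists>\<epsilon>>0. \<forall>q z. dist q p < \<epsilon> \<longrightarrow> z \<in> {x. x extreme_point_of C} - {p,a} \<longrightarrow> 0 < 1 * orient a q z"
      by (rule orient_pos_stable)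
    then obtain \<epsilon> where \<epsilon>: "0 < \<epsilon>" "\<And>q z. dist q p < \<epsilon> \<Longrightarrow> z \<in> {x. x extreme_point_of C} - {p,a} \<Longrightarrow> 0 < 1 * orient a q z"
      by metis
    have "0 \<le> orient a q z" if "dist q p < \<epsilon>" "z \<in> Z" for q z
      using \<epsilon>(2)[of q z] that by (cases "z = a") (auto simp: Z_def orient_simps)
    then show ?thesis using \<epsilon>(1) by blast
  qed
  have near': "\<exists>\<epsilon>>0. \<forall>q. dist q p < \<epsilon> \<longrightarrow> norm q \<le> 1 \<longrightarrow> orient a b q \<le> 0 \<longrightarrow> (\<forall>z\<in>Z. 0 \<le> orient q b z)"
  proof (cases "norm b = 1")
    case True
    have "0 \<le> orient q b z" if "norm q \<le> 1" "orient a b q \<le> 0" "z \<in> Z" for q z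
      by (rule orient_right_circle[OF True ext(4)[OF ab(1)] that(1) ext(4)[OF that(3)] aneb that(2) oZ[OF that(3)]])
    then show ?thesis by (intro exI[of _ 1]) simp
  next
    case False
    then have "norm b < 1" using ext(4)[OF ab(2)] by simp
    then have "compact ({x. x extreme_point_of C} - {p,b})" using np by (intro optimal_extreme_compact[OF opt]) auto
    moreover have "0 < (-1) * orient b p z" if "z \<in> {x. x extreme_point_of C} - {p,b}" for z
    proof -
      have "z \<in> Z" using that by (simp add: Z_def)
      moreover have "orient b p z \<noteq> 0"
        using extreme_points_orient[OF ext(1)[OF ab(2)] p, of z] that ext(2)[OF ab(2)] by blast
      ultimately show ?thesis using ab(5)[of z] orient_swap[of p b z] by simp
    qed
    ultimately have "\<exists>\<epsilon>>0. \<forall>q z. dist q p < \<epsilon> \<longrightarrow> z \<in> {x. x extreme_point_of C} - {p,b} \<longrightarrow> 0 < (-1) * orient b q z"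
      by (rule orient_pos_stable)
    then obtain \<epsilon> where \<epsilon>: "0 < \<epsilon>" "\<And>q z. dist q p < \<epsilon> \<Longrightarrow> z \<in> {x. x extreme_point_of C} - {p,b} \<Longrightarrow> 0 < (-1) * orient b q z"
      by metis
    have "0 \<le> orient q b z" if "dist q p < \<epsilon>" "z \<in> Z" for q z
    proof (cases "z = b")
      case False
      then have "0 < (-1) * orient b q z" using \<epsilon>(2)[of q z] that by (simp add: Z_def)
      then show ?thesis using orient_swap[of q b z] by simp
    qed (simp add: orient_simps)
    then show ?thesis using \<epsilon>(1) by blast
  qed
  from near obtain \<epsilon>1 where \<epsilon>1: "0 < \<epsilon>1" "\<And>q z. dist q p < \<epsilon>1 \<Longrightarrow> norm q \<le> 1 \<Longrightarrow> orient a b q \<le> 0 \<Longrightarrow> z \<in> Z \<Longrightarrow> 0 \<le> orient a q z"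
    by metis
  from near' obtain \<epsilon>2 where \<epsilon>2: "0 < \<epsilon>2" "\<And>q z. dist q p < \<epsilon>2 \<Longrightarrow> norm q \<le> 1 \<Longrightarrow> orient a b q \<le> 0 \<Longrightarrow> z \<in> Z \<Longrightarrow> 0 \<le> orient q b z"
    by metis
  define \<epsilon> where "\<epsilon> = min (1 - norm p) (min \<epsilon>1 \<epsilon>2)"
  have \<epsilon>: "0 < \<epsilon>" "\<epsilon> \<le> 1 - norm p" "\<epsilon> \<le> \<epsilon>1" "\<epsilon> \<le> \<epsilon>2" using np \<epsilon>1(1) \<epsilon>2(1) by (auto simp: \<epsilon>_def)
  define \<tau> where "\<tau> = \<epsilon> / (2 * norm (b - a))"
  have \<tau>: "0 < \<tau>" using \<epsilon>(1) aneb by (simp add: \<tau>_def)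
  define q1 where "q1 = p + \<tau> *\<^sub>R (b - a)"
  define q2 where "q2 = p - \<tau> *\<^sub>R (b - a)"
  have dq: "dist q p < \<epsilon>" if "q \<in> {p, q1, q2}" for q
  proof -
    have "norm (\<tau> *\<^sub>R (b - a)) = \<epsilon> / 2" using \<epsilon>(1) aneb by (simp add: \<tau>_def)
    then show ?thesis using that \<epsilon>(1) by (auto simp: q1_def q2_def dist_norm)
  qed
  have nq: "norm q \<le> 1" if "q \<in> {p, q1, q2}" for q
    using dq[OF that] \<epsilon>(2) norm_triangle_sub[of q p] by (simp add: dist_norm)
  have oq: "orient a b q \<le> 0" if "q \<in> {p, q1, q2}" for q
    using that orient_slide[of a b p \<tau>] orient_slide[of a b p "-\<tau>"] ab(3) by (auto simp: q1_def q2_def)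
  have lines: "0 \<le> orient a q x \<and> 0 \<le> orient q b x" if q: "q \<in> {p, q1, q2}" and x: "x \<in> convex hull Z" for q x
  proof -
    have dq12: "dist q p < \<epsilon>1" "dist q p < \<epsilon>2" using dq[OF q] \<epsilon> by linarith+
    have "convex hull Z \<subseteq> {x. 0 \<le> orient a q x}"
      using \<epsilon>1(2)[OF dq12(1) nq[OF q] oq[OF q]] by (intro hull_minimal convex_orient_ge) auto
    moreover have "convex hull Z \<subseteq> {x. 0 \<le> orient q b x}"
      using \<epsilon>2(2)[OF dq12(2) nq[OF q] oq[OF q]] by (intro hull_minimal convex_orient_ge) auto
    ultimately show ?thesis using x by blast
  qed
  have oX: "0 \<le> orient a b x" if x: "x \<in> convex hull Z" for x
  proof -
    have "convex hull Z \<subseteq> {x. 0 \<le> orient a b x}" using oZ by (intro hull_minimal convex_orient_ge) auto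
    then show ?thesis using x by blast
  qed
  obtain q where q: "q \<in> {q1, q2}"
    "mw (convex hull (insert p (convex hull Z))) < mw (convex hull (insert q (convex hull Z)))"
    "area (convex hull (insert q (convex hull Z))) = area (convex hull (insert p (convex hull Z)))"
    by (rule slide_apex[OF compact_convex_hull[OF Zc] convex_convex_hull hull_inc[OF ab(1)] hull_inc[OF ab(2)]
        oX ab(3) \<tau> \<tau> q1_def q2_def lines])
  have hq: "convex hull (insert q (convex hull Z)) = convex hull (insert q Z)" for q by (rule hull_insert_hull)
  have cc: "compact (convex hull (insert q Z))" using Zc by (intro compact_convex_hull) simp
  have "convex hull (insert q Z) \<subseteq> cball 0 1"
    using nq[of q] q(1) ext(4) by (intro hull_minimal) auto
  then have "mw (convex hull (insert q Z)) \<le> mw C"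
    using q(3) C(4) hC by (intro C(8)[OF cc]) (auto simp: hq)
  then show False using q(2) hC by (simp add: hq)
qed

end

section \<open>Finiteness of the set of extreme points\<close>

lemma cos_lipschitz: "\<bar>cos x - cos y\<bar> \<le> \<bar>x - y\<bar>" for x y :: real
proof -
  have "\<bar>cos x - cos y\<bar> = 2 * \<bar>sin ((x + y) / 2)\<bar> * \<bar>sin ((y - x) / 2)\<bar>"
    by (simp add: cos_diff_cos abs_mult)
  also have "\<dots> \<le> 2 * 1 * \<bar>(y - x) / 2\<bar>"
    by (intro mult_mono abs_sin_x_le_abs_x abs_sin_le_one) auto
  also have "2 * 1 * \<bar>(y - x) / 2\<bar> = \<bar>x - y\<bar>" by (simp add: abs_minus_commute[of x y])
  finally show ?thesis .
qed

lemma sin_step: "\<bar>sin (t + \<delta>) - sin t - \<delta> * cos t\<bar> \<le> \<delta> * \<delta>" for t \<delta> :: real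
proof -
  have "\<exists>\<xi>. \<bar>\<xi> - t\<bar> \<le> \<bar>\<delta>\<bar> \<and> sin (t + \<delta>) - sin t = \<delta> * cos \<xi>"
  proof (cases \<delta> "0::real" rule: linorder_cases)
    case less
    then obtain z where "t + \<delta> < z" "z < t" "sin t - sin (t + \<delta>) = (t - (t + \<delta>)) * cos z"
      using MVT2[of "t + \<delta>" t sin cos] by (auto intro: DERIV_sin)
    then show ?thesis using less by (intro exI[of _ z]) (auto simp: algebra_simps)
  next
    case greater
    then obtain z where "t < z" "z < t + \<delta>" "sin (t + \<delta>) - sin t = (t + \<delta> - t) * cos z"
      using MVT2[of t "t + \<delta>" sin cos] by (auto intro: DERIV_sin)
    then show ?thesis using greater by (intro exI[of _ z]) auto
  qed auto
  then obtain \<xi> where \<xi>: "\<bar>\<xi> - t\<bar> \<le> \<bar>\<delta>\<bar>" "sin (t + \<delta>) - sin t = \<delta> * cos \<xi>" by blast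
  have "\<bar>\<delta> * cos \<xi> - \<delta> * cos t\<bar> = \<bar>\<delta>\<bar> * \<bar>cos \<xi> - cos t\<bar>"
    by (simp add: right_diff_distrib[symmetric] abs_mult)
  also have "\<dots> \<le> \<bar>\<delta>\<bar> * \<bar>\<delta>\<bar>"
    using cos_lipschitz[of \<xi> t] \<xi>(1) by (intro mult_left_mono) auto
  finally show ?thesis using \<xi>(2) by simp
qed

text \<open>
  Opening a side of half-angle \<open>s\<close> at the expense of a side of half-angle \<open>u\<close> gains, to first
  order, area and perimeter in the ratio \<open>4 * (1 + cos u) < 8\<close>, whereas merging short sides costs
  them in a ratio close to \<open>8\<close>. The speed of transfer is chosen between these two rates.
\<close>

lemma transfer_gain:
  fixes u :: real
  assumes u: "0 < u" "u < pi"
  obtains g s0 D where "0 < g" "0 < s0" "s0 \<le> 1" "0 < D"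
    "\<And>s a l. 0 < s \<Longrightarrow> s < s0 \<Longrightarrow> 0 < a \<Longrightarrow> a \<le> 2 * s \<Longrightarrow> 8 * cos (s / 2) ^ 3 * l \<le> a \<Longrightarrow>
      a / D \<le> u \<and> sin (2 * (s + a / D)) - sin (2 * s) + sin (2 * (u - a / D)) - sin (2 * u) \<le> a \<and>
      g * a + l \<le> sin (s + a / D) - sin s + sin (u - a / D) - sin u"
proof -
  define c where "c = cos u"
  have c: "c < 1" "-1 \<le> c" unfolding c_def using cos_monotone_0_pi[of 0 u] u by auto
  \<comment> \<open>\<open>D / (1 - c) = 2 * (3 + c)\<close> is the midpoint of the rates
    \<open>4 * (1 + c)\<close> and \<open>8\<close>. In terms of area, \<open>D\<close> exceeds the
    first-order rate \<open>4 * (1 - c) * (1 + c)\<close> by \<open>2 * (1 - c)\<^sup>2\<close>,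
    which absorbs the second-order error.\<close>
  define D where "D = 2 * (1 - c) * (3 + c)"
  have D: "0 < D" using c by (simp add: D_def)
  define k where "k = 2 / D"
  have k: "0 < k" using D by (simp add: k_def)
  \<comment> \<open>A lower bound for the net perimeter gain per unit of freed area: the gain of the
    transfer minus the cost of merging. It is continuous and positive at \<open>0\<close>.\<close>
  define F where "F s = (1 - c - (1 + 2 * k) * s) / D - 1 / (8 * (1 - s) ^ 3)" for s
  have F0: "F 0 = (1 - c) / (8 * (3 + c))"
  proof -
    have frac: "r / (2 * r * t) = 1 / (2 * t)" "1 / (2 * t) - 1 / 8 = (4 - t) / (8 * t)" if "r \<noteq> 0" "t \<noteq> 0" for r t :: real
      using that by (simp_all add: field_simps)
    have "(1 - c) / D = 1 / (2 * (3 + c))" unfolding D_def by (rule frac(1)) (use c in auto)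
    moreover have "1 / (2 * (3 + c)) - 1 / 8 = (4 - (3 + c)) / (8 * (3 + c))" by (rule frac(2)[of 1]) (use c in auto)
    moreover have "F 0 = (1 - c) / D - 1 / 8" by (simp add: F_def)
    ultimately show ?thesis by simp
  qed
  define g where "g = F 0 / 2"
  have g: "0 < g" "g < F 0" 
  proof -
    have "0 < F 0" unfolding F0 using c by simp
    then show "0 < g" "g < F 0" unfolding g_def by simp_all
  qed
  have right: "(f \<longlongrightarrow> f 0) (at_right 0)" if "isCont f 0" for f :: "real \<Rightarrow> real"
    using that unfolding isCont_def filterlim_at_split by blast
  have "isCont F 0" unfolding F_def by (intro continuous_intros) (use D in auto)
  from right[OF this] have e1: "\<forall>\<^sub>F s in at_right 0. g < F s" using g(2) by (rule order_tendstoD)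
  have "isCont (\<lambda>s. 2 * k * s) 0" by (intro continuous_intros)
  from right[OF this] have "((\<lambda>s. 2 * k * s) \<longlongrightarrow> 0) (at_right 0)" by simp
  moreover have "0 < min ((1 - c)\<^sup>2) u" using c u by simp
  ultimately have e2: "\<forall>\<^sub>F s in at_right 0. 2 * k * s < min ((1 - c)\<^sup>2) u" by (rule order_tendstoD)
  have e3: "\<forall>\<^sub>F s in at_right 0. s < (1::real)" by (intro eventually_at_rightI[of 0 1]) auto
  have "\<forall>\<^sub>F s in at_right 0. g < F s \<and> 2 * k * s < min ((1 - c)\<^sup>2) u \<and> s < 1"
    using e1 e2 e3 by (intro eventually_conj)
  then obtain b where b: "0 < b" "\<And>s. 0 < s \<Longrightarrow> s < b \<Longrightarrow> g < F s \<and> 2 * k * s < min ((1 - c)\<^sup>2) u \<and> s < 1"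
    unfolding eventually_at_right_field by auto
  show ?thesis
  proof (rule that[of g "min b 1" D])
    fix s a l :: real
    assume s: "0 < s" "s < min b 1" and a: "0 < a" "a \<le> 2 * s" and l: "8 * cos (s / 2) ^ 3 * l \<le> a"
    define \<delta> where "\<delta> = a / D"
    have \<delta>: "0 < \<delta>" "\<delta> \<le> k * s" "a = \<delta> * D"
      using a D by (auto simp: \<delta>_def k_def divide_right_mono)
    have small: "g < F s" "2 * k * s < (1 - c)\<^sup>2" "2 * k * s < u" "s < 1" using b(2)[of s] s by auto
    have "\<delta> \<le> u"
    proof -
      have "0 < k * s" using k s by simp
      then show ?thesis using \<delta>(2) small(3) by linarith
    qed
    moreover have "sin (2 * (s + \<delta>)) - sin (2 * s) + sin (2 * (u - \<delta>)) - sin (2 * u) \<le> a"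
    proof -
      have e: "2 * (s + \<delta>) = 2 * s + 2 * \<delta>" "2 * (u - \<delta>) = 2 * u + (- 2 * \<delta>)" by simp_all
      have c2: "cos (2 * u) = 2 * (c * c) - 1" using cos_double_cos[of u] by (simp add: c_def power2_eq_square)
      have "sin (2 * s + 2 * \<delta>) - sin (2 * s) \<le> 2 * \<delta>"
      proof -
        have "sin (2 * s + 2 * \<delta>) - sin (2 * s) = 2 * (sin \<delta> * cos (2 * s + \<delta>))"
          by (simp add: sin_diff_sin add_divide_distrib)
        also have "\<dots> \<le> 2 * \<bar>sin \<delta> * cos (2 * s + \<delta>)\<bar>" by simp
        also have "\<dots> \<le> 2 * (\<bar>\<delta>\<bar> * 1)" unfolding abs_mult
          using abs_sin_x_le_abs_x abs_cos_le_one by (intro mult_mono) auto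
        finally show ?thesis using \<delta>(1) by simp
      qed
      moreover have "sin (2 * u + (- 2 * \<delta>)) - sin (2 * u) \<le> (- 2 * \<delta>) * cos (2 * u) + (- 2 * \<delta>) * (- 2 * \<delta>)"
        using sin_step[of "2 * u" "- 2 * \<delta>"] by linarith
      ultimately have "sin (2 * (s + \<delta>)) - sin (2 * s) + sin (2 * (u - \<delta>)) - sin (2 * u)
        \<le> 2 * \<delta> + (- 2 * \<delta>) * cos (2 * u) + (- 2 * \<delta>) * (- 2 * \<delta>)" unfolding e by linarith
      also have "\<dots> = \<delta> * (4 * (1 - c) * (1 + c) + 4 * \<delta>)"
        unfolding c2 by (simp add: algebra_simps)
      also have "\<dots> \<le> \<delta> * D"
      proof -
        have "2 * \<delta> \<le> (1 - c)\<^sup>2" using \<delta>(2) small(2) by linarith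
        then have "4 * (1 - c) * (1 + c) + 4 * \<delta> \<le> 4 * (1 - c) * (1 + c) + 2 * (1 - c)\<^sup>2" by linarith
        also have "\<dots> = D" by (simp add: D_def power2_eq_square algebra_simps)
        finally show ?thesis using \<delta>(1) by (intro mult_left_mono) auto
      qed
      finally show ?thesis using \<delta>(3) by simp
    qed
    moreover have "g * a + l \<le> sin (s + \<delta>) - sin s + sin (u - \<delta>) - sin u"
    proof -
      have cs: "1 - x \<le> cos x" if "0 \<le> x" for x :: real using cos_lipschitz[of x 0] that by auto
      have "(1 - s) ^ 3 \<le> cos (s / 2) ^ 3" using cs[of "s / 2"] s small(4) by (intro power_mono) auto
      moreover have p3: "0 < (1 - s) ^ 3" using small(4) by simp
      ultimately have "0 < cos (s / 2) ^ 3" by linarith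
      have "l \<le> a / (8 * (1 - s) ^ 3)"
      proof (cases "0 \<le> l")
        case True
        then have "8 * (1 - s) ^ 3 * l \<le> 8 * cos (s / 2) ^ 3 * l" using \<open>(1 - s) ^ 3 \<le> cos (s / 2) ^ 3\<close>
          by (intro mult_right_mono) auto
        then show ?thesis using l p3 by (simp add: pos_le_divide_eq mult.commute)
      next
        case False
        moreover have "0 \<le> a / (8 * (1 - s) ^ 3)" using a p3 by simp
        ultimately show ?thesis by linarith
      qed
      moreover have "g * a \<le> F s * a" using small(1) a(1) by (intro mult_right_mono) auto
      moreover have "F s * a = \<delta> * (1 - c - (1 + 2 * k) * s) - a / (8 * (1 - s) ^ 3)"
      proof -
        have "(X / D - 1 / Y) * a = \<delta> * X - a / Y" for X Y unfolding \<delta>_def by (simp add: left_diff_distrib)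
        then show ?thesis unfolding F_def .
      qed
      moreover have "\<delta> * (1 - c - (1 + 2 * k) * s) \<le> \<delta> * (1 - c - s - 2 * \<delta>)"
      proof (rule mult_left_mono)
        have "(1 + 2 * k) * s = s + 2 * (k * s)" by (simp add: algebra_simps)
        then show "1 - c - (1 + 2 * k) * s \<le> 1 - c - s - 2 * \<delta>" using \<delta>(2) by linarith
      qed (use \<delta>(1) in simp)
      moreover have "\<delta> * (1 - s) - \<delta> * \<delta> \<le> sin (s + \<delta>) - sin s"
      proof -
        have "\<delta> * (1 - s) \<le> \<delta> * cos s" using cs[of s] s \<delta>(1) by (intro mult_left_mono) auto
        then show ?thesis using sin_step[of s \<delta>] by linarith
      qed
      moreover have "- \<delta> * c - \<delta> * \<delta> \<le> sin (u - \<delta>) - sin u"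
        using sin_step[of u "- \<delta>"] unfolding c_def by (simp add: abs_le_iff)
      moreover have "\<delta> * (1 - s) - \<delta> * \<delta> + (- \<delta> * c - \<delta> * \<delta>) = \<delta> * (1 - c - s - 2 * \<delta>)"
        by (simp add: algebra_simps)
      ultimately show ?thesis by linarith
    qed
    ultimately show "a / D \<le> u \<and> sin (2 * (s + a / D)) - sin (2 * s) + sin (2 * (u - a / D)) - sin (2 * u) \<le> a \<and>
      g * a + l \<le> sin (s + a / D) - sin s + sin (u - a / D) - sin u" unfolding \<delta>_def by blast
  qed (use g b D in auto)
qed

section \<open>Merging short sides\<close>

lemma subadditive_sum:
  fixes h :: "real \<Rightarrow> real"
  assumes "finite I" and h: "h 0 = 0" "\<And>y z. 0 \<le> y \<Longrightarrow> 0 \<le> z \<Longrightarrow> y + z \<le> s \<Longrightarrow> h (y + z) \<le> h y + h z"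
    and x: "\<And>i. i \<in> I \<Longrightarrow> 0 \<le> x i" "(\<Sum>i\<in>I. x i) \<le> s"
  shows "h (\<Sum>i\<in>I. x i) \<le> (\<Sum>i\<in>I. h (x i))"
  using assms(1) x
proof (induction I rule: finite_induct)
  case (insert j I)
  have "0 \<le> x j" "0 \<le> (\<Sum>i\<in>I. x i)" "x j + (\<Sum>i\<in>I. x i) \<le> s"
    using insert by (auto intro: sum_nonneg)
  moreover from this have "(\<Sum>i\<in>I. x i) \<le> s" by linarith
  moreover from this have "h (\<Sum>i\<in>I. x i) \<le> (\<Sum>i\<in>I. h (x i))"
    using insert.prems insert.hyps by (intro insert.IH) auto
  ultimately show ?case using h(2)[of "x j" "\<Sum>i\<in>I. x i"] insert(1,2) by simp
qed (simp add: h)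

lemma sin_merge: "sin y + sin z - sin (y + z) = 4 * sin (y / 2) * sin (z / 2) * sin ((y + z) / 2)" for y z :: real
proof -
  have "sin y + sin z = 2 * sin ((y + z) / 2) * cos ((y - z) / 2)" by (rule sin_plus_sin)
  moreover have "2 * ((y + z) / 2) = y + z" by simp
  then have "sin (y + z) = 2 * sin ((y + z) / 2) * cos ((y + z) / 2)" using sin_double[of "(y + z) / 2"] by (simp only:)
  ultimately have "sin y + sin z - sin (y + z) = 2 * sin ((y + z) / 2) * (cos ((y - z) / 2) - cos ((y + z) / 2))"
    by (simp add: right_diff_distrib)
  also have "cos ((y - z) / 2) - cos ((y + z) / 2) = 2 * sin (y / 2) * sin (z / 2)"
    by (simp add: diff_divide_distrib add_divide_distrib cos_diff cos_add)
  finally show ?thesis by simp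
qed

lemma sin_double_merge: "sin (2 * y) + sin (2 * z) - sin (2 * (y + z)) = 4 * sin y * sin z * sin (y + z)" for y z :: real
proof -
  have e: "2 * y + 2 * z = 2 * (y + z)" "2 * (y + z) / 2 = y + z" "2 * y / 2 = y" "2 * z / 2 = z" by simp_all
  show ?thesis using sin_merge[of "2 * y" "2 * z"] unfolding e .
qed

text \<open>Merging gaps \<open>y\<close> and \<open>z\<close> loses \<open>32 * (K * S)\<close> of
  area and \<open>4 * S\<close> of perimeter, where \<open>K\<close> is a product of three cosines,
  each at least \<open>cos (s / 2)\<close>. Written as subadditivity, the bound extends to many gaps
  by \<open>subadditive_sum\<close>.\<close>

lemma merge_ratio:
  assumes yz: "0 \<le> y" "0 \<le> z" "y + z \<le> s" and s: "s \<le> pi"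
  shows "sin (2 * (y + z)) - 8 * cos (s / 2) ^ 3 * sin (y + z)
    \<le> (sin (2 * y) - 8 * cos (s / 2) ^ 3 * sin y) + (sin (2 * z) - 8 * cos (s / 2) ^ 3 * sin z)"
proof -
  define S where "S = sin (y / 2) * sin (z / 2) * sin ((y + z) / 2)"
  define K where "K = cos (y / 2) * cos (z / 2) * cos ((y + z) / 2)"
  have "0 \<le> sin (y / 2)" "0 \<le> sin (z / 2)" "0 \<le> sin ((y + z) / 2)"
    using yz s by (auto intro!: sin_ge_zero)
  then have S: "0 \<le> S" by (simp add: S_def)
  have c: "0 \<le> cos (s / 2)" using yz s by (intro cos_ge_zero) auto
  have "cos (s / 2) \<le> cos (y / 2)" "cos (s / 2) \<le> cos (z / 2)" "cos (s / 2) \<le> cos ((y + z) / 2)"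
    using yz s by (auto intro!: cos_monotone_0_pi_le)
  then have "cos (s / 2) * cos (s / 2) * cos (s / 2) \<le> K"
    unfolding K_def using c by (intro mult_mono) (auto intro: order_trans)
  then have "cos (s / 2) ^ 3 * S \<le> K * S" using S by (intro mult_right_mono) (simp_all add: power3_eq_cube)
  moreover have "sin (2 * y) + sin (2 * z) - sin (2 * (y + z)) = 32 * (K * S)"
  proof -
    have d: "sin t = 2 * sin (t / 2) * cos (t / 2)" for t :: real using sin_double[of "t / 2"] by simp
    show ?thesis unfolding sin_double_merge d[of y] d[of z] d[of "y + z"] by (simp add: K_def S_def mult_ac)
  qed
  moreover have "sin y + sin z - sin (y + z) = 4 * S" using sin_merge[of y z] by (simp add: S_def mult_ac)
  then have "8 * cos (s / 2) ^ 3 * (sin y + sin z - sin (y + z)) = 32 * (cos (s / 2) ^ 3 * S)" by simp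
  ultimately have "8 * cos (s / 2) ^ 3 * (sin y + sin z - sin (y + z)) \<le> sin (2 * y) + sin (2 * z) - sin (2 * (y + z))"
    by linarith
  then show ?thesis by (simp add: algebra_simps)
qed

lemma merge_area:
  fixes y z :: real
  assumes "0 \<le> y" "0 \<le> z" "y + z \<le> pi"
  shows "sin (2 * (y + z)) \<le> sin (2 * y) + sin (2 * z)"
proof -
  have "0 \<le> sin y" "0 \<le> sin z" "0 \<le> sin (y + z)" using assms by (auto intro!: sin_ge_zero)
  then have "0 \<le> 4 * sin y * sin z * sin (y + z)" by simp
  then show ?thesis using sin_double_merge[of y z] by linarith
qed

context area_param
begin

text \<open>The competitor collects all gaps of \<open>I\<close> in the single index
  \<open>i\<close>, adds \<open>\<delta>\<close> taken from the gap \<open>l\<close>, and leaves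
  zeros in the rest of \<open>I\<close>.\<close>

lemma transfer_bound:
  assumes x: "feas n A x" and I: "I \<subseteq> {..<n}" "i \<in> I" "l < n" "l \<notin> I"
    and s: "(\<Sum>j\<in>I. x j) = s" and \<delta>: "0 \<le> \<delta>" "\<delta> \<le> x l"
    and ar: "sin (2 * (s + \<delta>)) - sin (2 * s) + sin (2 * (x l - \<delta>)) - sin (2 * x l) \<le> (\<Sum>j\<in>I. sin (2 * x j)) - sin (2 * s)"
  shows "(\<Sum>j<n. sin (x j)) - (\<Sum>j\<in>I. sin (x j)) + sin (s + \<delta>) + sin (x l - \<delta>) - sin (x l) \<le> V"
proof -
  define y where "y j = (if j = l then x l - \<delta> else if j = i then s + \<delta> else if j \<in> I then 0 else x j)" for j
  define R where "R = {..<n} - I - {l}"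
  have finI: "finite I" using I(1) finite_subset by blast
  have split: "(\<Sum>j<n. f j) = f l + (\<Sum>j\<in>I. f j) + (\<Sum>j\<in>R. f j)" for f :: "nat \<Rightarrow> real"
  proof -
    have "{..<n} = insert l (I \<union> R)" "l \<notin> I \<union> R" "I \<inter> R = {}" "finite R" using I by (auto simp: R_def)
    then show ?thesis using finI by (simp add: sum.union_disjoint)
  qed
  have sum_y: "(\<Sum>j<n. h (y j)) = (\<Sum>j<n. h (x j)) - (\<Sum>j\<in>I. h (x j)) + h (s + \<delta>) + h (x l - \<delta>) - h (x l)"
    if "h 0 = 0" for h :: "real \<Rightarrow> real"
  proof -
    have "(\<Sum>j\<in>I. h (y j)) = h (y i) + (\<Sum>j\<in>I - {i}. h (y j))" using finI I(2) by (rule sum.remove)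
    also have "(\<Sum>j\<in>I - {i}. h (y j)) = 0" using I(4) that by (intro sum.neutral) (auto simp: y_def)
    also have "y i = s + \<delta>" using I by (auto simp: y_def)
    finally have "(\<Sum>j\<in>I. h (y j)) = h (s + \<delta>)" by simp
    moreover have "(\<Sum>j\<in>R. h (y j)) = (\<Sum>j\<in>R. h (x j))"
      using I(2) by (intro sum.cong) (auto simp: y_def R_def)
    moreover have "y l = x l - \<delta>" by (simp add: y_def)
    ultimately show ?thesis unfolding split[of "\<lambda>j. h (y j)"] split[of "\<lambda>j. h (x j)"] by simp
  qed
  have x0: "0 \<le> x j" if "j < n" for j using x that by (simp add: feas_def)
  have "0 \<le> s" unfolding s[symmetric] using x0 I(1) by (intro sum_nonneg) auto
  then have "feas n A y" unfolding feas_def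
    using x0 \<delta> I x sum_y[of "\<lambda>t. t"] sum_y[of "\<lambda>t. sin (2 * t)"] ar s
    by (auto simp: y_def feas_def)
  then have "(\<Sum>j<n. sin (y j)) \<le> V" by (rule feas_le_V)
  then show ?thesis using sum_y[of sin] by simp
qed

end

lemma area_disk: "area (cball 0 1) = pi"
proof -
  have "area (cball 0 1) = measure lborel (cball (0::complex) 1)"
    unfolding area_def by (rule measure_completion) simp
  then show ?thesis using content_cball[of 1 "0::complex"] by (simp add: unit_ball_vol_2)
qed

lemma noncollinear_orient:
  assumes "\<not> collinear V"
  obtains a b c where "a \<in> V" "b \<in> V" "c \<in> V" "orient a b c \<noteq> 0"
proof (rule ccontr)
  note main = that
  assume none: "\<not> thesis"
  have "\<not> (\<exists>a. V \<subseteq> {a})" using assms collinear_subset collinear_sing by metis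
  then obtain a b where ab: "a \<in> V" "b \<in> V" "a \<noteq> b" by blast
  have "\<exists>r. c = a + r *\<^sub>R (b - a)" if "c \<in> V" for c
  proof -
    have "orient a b c = 0" using none main[of a b c] ab that by blast
    then show ?thesis using orient_eq_0_iff ab(3) by blast
  qed
  then have "collinear V" unfolding collinear_alt by blast
  then show False using assms by simp
qed

text \<open>Cut the circle at a missing point, then rotate so that the parameters run from
  \<open>0\<close> to their maximum \<open>L\<close>. The arc without points is then a side of
  half-angle \<open>pi - L\<close>.\<close>

lemma circle_gap_param:
  assumes E: "compact E" "E \<subseteq> sphere 0 1" "E \<noteq> sphere 0 1" "E \<noteq> {}"
  obtains p \<Theta> L where "norm p = 1" "compact \<Theta>" "0 \<in> \<Theta>" "L \<in> \<Theta>" "\<Theta> \<subseteq> {0..L}" "L < pi"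
    "E = (\<lambda>t. p * cis (2 * t)) ` \<Theta>"
proof -
  have "\<not> sphere 0 1 \<subseteq> E" using E(2,3) by blast
  then obtain w where "w \<in> sphere 0 1" and wE: "w \<notin> E" by blast
  then have w: "norm w = 1" "w \<notin> E" by simp_all
  define T where "T = {0..pi} \<inter> (\<lambda>t. w * cis (2 * t)) -` E"
  have "closed ((\<lambda>t. w * cis (2 * t)) -` E)"
    by (intro closed_vimage compact_imp_closed E(1) continuous_intros)
  then have "closed T" unfolding T_def by (intro closed_Int closed_atLeastAtMost)
  then have cT: "compact T" unfolding compact_eq_bounded_closed using bounded_subset[of "{0..pi}" T] by (auto simp: T_def)
  have ET: "E = (\<lambda>t. w * cis (2 * t)) ` T"
  proof
    show "E \<subseteq> (\<lambda>t. w * cis (2 * t)) ` T"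
    proof
      fix v assume v: "v \<in> E"
      then have "norm v = 1" using E(2) by auto
      then obtain t where t: "0 \<le> t" "t < pi" "v = w * cis (2 * t)" using circle_param[OF w(1)] by metis
      have "w * cis (2 * t) \<in> E" using v unfolding t(3) .
      then have "t \<in> T" unfolding T_def using t(1,2) by simp
      then show "v \<in> (\<lambda>t. w * cis (2 * t)) ` T" using t(3) by (rule rev_image_eqI)
    qed
  qed (auto simp: T_def)
  have T: "0 < t" "t < pi" if "t \<in> T" for t
  proof -
    have "t \<noteq> 0" "t \<noteq> pi" using that w(2) by (auto simp: T_def)
    then show "0 < t" "t < pi" using that by (auto simp: T_def)
  qed
  have "T \<noteq> {}" using E(4) ET by auto
  then obtain t1 t2 where t: "t1 \<in> T" "t2 \<in> T" "\<And>t. t \<in> T \<Longrightarrow> t1 \<le> t" "\<And>t. t \<in> T \<Longrightarrow> t \<le> t2"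
    using compact_attains_inf[OF cT] compact_attains_sup[OF cT] by metis
  show ?thesis
  proof (rule that[of "w * cis (2 * t1)" "(\<lambda>t. t - t1) ` T" "t2 - t1"])
    show "compact ((\<lambda>t. t - t1) ` T)" using cT by (intro compact_continuous_image continuous_intros)
    show "t2 - t1 < pi" using T(1)[OF t(1)] T(2)[OF t(2)] by simp
    show "E = (\<lambda>t. w * cis (2 * t1) * cis (2 * t)) ` (\<lambda>t. t - t1) ` T"
      unfolding ET image_image by (intro image_cong refl) (simp add: mult.assoc cis_mult)
  qed (use w t in \<open>auto simp: norm_mult\<close>)
qed

context area_param
begin

text \<open>
  Short sides cluster at a limit point of the vertices, while some side subtends the fixed angle
  \<open>2 * u\<close>; merging the short sides and shrinking the fixed one is a gain bounded away from \<open>0\<close>.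
\<close>

lemma infinite_vertices_deficit:
  assumes p: "norm p = 1" and \<Theta>: "compact \<Theta>" "0 \<in> \<Theta>" "L \<in> \<Theta>" "\<Theta> \<subseteq> {0..L}" "L < pi" "infinite \<Theta>"
    and area: "area (convex hull ((\<lambda>t. p * cis (2 * t)) ` \<Theta>)) \<le> A"
  obtains g \<Theta>0 where "0 < g" "finite \<Theta>0" "\<Theta>0 \<subseteq> \<Theta>"
    "\<And>\<Theta>'. finite \<Theta>' \<Longrightarrow> \<Theta>0 \<subseteq> \<Theta>' \<Longrightarrow> \<Theta>' \<subseteq> \<Theta> \<Longrightarrow> mw (convex hull ((\<lambda>t. p * cis (2 * t)) ` \<Theta>')) \<le> 2 * V - g"
proof -
  define f where "f t = p * cis (2 * t)" for t
  define u where "u = pi - L"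
  have L0: "0 < L"
  proof (rule ccontr)
    assume "\<not> 0 < L"
    then have "\<Theta> \<subseteq> {0}" using \<Theta>(4) by auto
    then show False using \<Theta>(6) finite_subset by blast
  qed
  have u: "0 < u" "u < pi" using \<Theta>(5) L0 by (auto simp: u_def)
  obtain g s0 D where g: "0 < g" "0 < s0" "s0 \<le> 1" "0 < D"
    and gain: "\<And>s a l. 0 < s \<Longrightarrow> s < s0 \<Longrightarrow> 0 < a \<Longrightarrow> a \<le> 2 * s \<Longrightarrow> 8 * cos (s / 2) ^ 3 * l \<le> a \<Longrightarrow>
      a / D \<le> u \<and> sin (2 * (s + a / D)) - sin (2 * s) + sin (2 * (u - a / D)) - sin (2 * u) \<le> a \<and>
      g * a + l \<le> sin (s + a / D) - sin s + sin (u - a / D) - sin u"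
    using transfer_gain[OF u] by blast
  obtain z where "z islimpt \<Theta>" using Heine_Borel_imp_Bolzano_Weierstrass[OF \<Theta>(1,6)] by blast
  then have "infinite (\<Theta> \<inter> ball z (s0 / 2))" using g(2) unfolding islimpt_eq_infinite_ball by simp
  \<comment> \<open>Three vertices close to the limit point: they are kept in every approximation
    and guarantee that merging frees some area.\<close>
  then obtain W where W: "finite W" "card W = 3" "W \<subseteq> \<Theta> \<inter> ball z (s0 / 2)"
    using infinite_arbitrarily_large by metis
  obtain c where c: "bij_betw c {..<card W} W" "\<And>i j. i < j \<Longrightarrow> j < card W \<Longrightarrow> c i < c j"
    using strict_enumeration[OF W(1), of "\<lambda>t. t"] by auto
  have cW: "c 0 \<in> W" "c 1 \<in> W" "c 2 \<in> W" using c(1) W(2) by (auto simp: bij_betw_def)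
  have c\<Theta>: "c 0 \<in> \<Theta>" "c 1 \<in> \<Theta>" "c 2 \<in> \<Theta>" using cW W(3) by auto
  have clt: "c 0 < c 1" "c 1 < c 2" using c(2)[of 0 1] c(2)[of 1 2] W(2) by auto
  define s where "s = c 2 - c 0"
  have "dist z (c 0) < s0 / 2" "dist z (c 2) < s0 / 2" using cW W(3) by auto
  then have "s < s0" unfolding s_def dist_real_def by linarith
  moreover have "0 < s" unfolding s_def using clt by linarith
  ultimately have s: "0 < s" "s < s0" by simp_all
  define s1 s2 where "s1 = c 1 - c 0" and "s2 = c 2 - c 1"
  have s12: "0 < s1" "0 < s2" "s1 + s2 = s" using clt by (auto simp: s1_def s2_def s_def)
  have s1pi: "s < 1" "1 < pi / 2" using s g(3) pi_gt3 by auto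
  \<comment> \<open>The area term freed by merging the gaps \<open>s1\<close> and \<open>s2\<close>.
    Any finer subdivision frees at least as much, so \<open>a0\<close> serves for all
    \<open>\<Theta>'\<close> at once.\<close>
  define a0 where "a0 = sin (2 * s1) + sin (2 * s2) - sin (2 * s)"
  have a0: "0 < a0"
  proof -
    have "0 < sin s1" "0 < sin s2" "0 < sin s" using s12 s s1pi by (auto intro!: sin_gt_zero)
    then have "0 < 4 * sin s1 * sin s2 * sin s" by simp
    then show ?thesis using sin_double_merge[of s1 s2] s12(3) by (simp add: a0_def)
  qed
  show ?thesis
  proof (rule that[of "2 * (g * a0)" "{0, L, c 0, c 1, c 2}"])
    show "0 < 2 * (g * a0)" using g(1) a0 by simp
    show "{0, L, c 0, c 1, c 2} \<subseteq> \<Theta>" using \<Theta> c\<Theta> by auto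
    fix \<Theta>' assume fin: "finite \<Theta>'" and in\<Theta>': "{0, L, c 0, c 1, c 2} \<subseteq> \<Theta>'" and sub: "\<Theta>' \<subseteq> \<Theta>"
    define n where "n = card \<Theta>'"
    have "card {c 0, c 1, c 2} = 3" using clt by simp
    then have "3 \<le> card \<Theta>'" using card_mono[OF fin, of "{c 0, c 1, c 2}"] in\<Theta>' by simp
    have sb: "\<Theta>' \<subseteq> {0..<pi}" using sub \<Theta>(4,5) by force
    have z0: "0 \<in> \<Theta>'" using in\<Theta>' by simp
    obtain \<tau> where bij: "bij_betw \<tau> {..<card \<Theta>'} \<Theta>'" and \<tau>: "\<tau> 0 = 0" "\<tau> (card \<Theta>') = pi"
      "\<And>i j. i < j \<Longrightarrow> j \<le> card \<Theta>' \<Longrightarrow> \<tau> i < \<tau> j"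
      and ig: "inscribed_gaps p (card \<Theta>') (\<lambda>i. \<tau> (Suc i) - \<tau> i)"
      and hull: "convex hull ((\<lambda>t. p * cis (2 * t)) ` \<Theta>') = inscribed_gaps.poly p (card \<Theta>') (\<lambda>i. \<tau> (Suc i) - \<tau> i)"
      by (rule inscribed_gaps_enumeration[OF fin z0 sb \<open>3 \<le> card \<Theta>'\<close> p]) blast
    note bij = bij[folded n_def] and \<tau> = \<tau>[folded n_def]
    note ig = ig[folded n_def] and hull = hull[folded n_def f_def]
    define x where "x i = \<tau> (Suc i) - \<tau> i" for i
    note ig = ig[folded x_def] and hull = hull[folded x_def]
    have n3: "3 \<le> n" using \<open>3 \<le> card \<Theta>'\<close> by (simp add: n_def)
    have mono: "i < j" if "\<tau> i < \<tau> j" "i < n" "j < n" for i j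
      using that \<tau>(3)[of j i] by (cases i j rule: linorder_cases) auto
    have ex: "\<exists>i<n. \<tau> i = t" if "t \<in> \<Theta>'" for t using bij that by (auto simp: bij_betw_def image_iff)
    have le: "\<tau> i \<le> L" if "i < n" for i using bij that sub \<Theta>(4) by (force simp: bij_betw_def)
    obtain l0 where l0: "l0 < n" "\<tau> l0 = L" using ex[of L] in\<Theta>' by auto
    have "\<not> l0 < n - 1" using \<tau>(3)[of l0 "n - 1"] le[of "n - 1"] l0 n3 by auto
    then have l0n: "Suc l0 = n" using l0(1) by linarith
    \<comment> \<open>\<open>L\<close> is the largest parameter, so its gap runs up to
      \<open>pi\<close> and is the same for every \<open>\<Theta>'\<close>.\<close>
    have xl: "x l0 = u" unfolding x_def l0n using \<tau>(2) l0(2) by (simp add: u_def)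
    obtain i0 where i0: "i0 < n" "\<tau> i0 = c 0" using ex[of "c 0"] in\<Theta>' by auto
    obtain i1 where i1: "i1 < n" "\<tau> i1 = c 1" using ex[of "c 1"] in\<Theta>' by auto
    obtain i2 where i2: "i2 < n" "\<tau> i2 = c 2" using ex[of "c 2"] in\<Theta>' by auto
    have i: "i0 < i1" "i1 < i2" using mono[of i0 i1] mono[of i1 i2] i0 i1 i2 clt by auto
    have i2l: "i2 \<le> l0" using i2(1) l0n by linarith
    have tel: "(\<Sum>j\<in>{i..<k}. x j) = \<tau> k - \<tau> i" if "i \<le> k" for i k
      unfolding x_def using that by (rule sum_Suc_diff')
    define I where "I = {i0..<i2}"
    have sumI: "(\<Sum>j\<in>I. x j) = s" unfolding I_def using tel[of i0 i2] i i0 i2 by (simp add: s_def)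
    have x0: "0 \<le> x j" if "j < n" for j using inscribed_gaps.xpos[OF ig that] by simp
    have x0I: "0 \<le> x j" if "j \<in> I" for j using that x0 i2(1) by (auto simp: I_def)
    have sub1: "sin (2 * s1) \<le> (\<Sum>j\<in>{i0..<i1}. sin (2 * x j))"
    proof -
      have "(\<Sum>j\<in>{i0..<i1}. x j) = s1" using tel[of i0 i1] i i0 i1 by (simp add: s1_def)
      then show ?thesis
        using subadditive_sum[of "{i0..<i1}" "\<lambda>t. sin (2 * t)" pi x] merge_area x0I i s12 s1pi by (auto simp: I_def)
    qed
    have sub2: "sin (2 * s2) \<le> (\<Sum>j\<in>{i1..<i2}. sin (2 * x j))"
    proof -
      have "(\<Sum>j\<in>{i1..<i2}. x j) = s2" using tel[of i1 i2] i i1 i2 by (simp add: s2_def)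
      then show ?thesis
        using subadditive_sum[of "{i1..<i2}" "\<lambda>t. sin (2 * t)" pi x] merge_area x0I i s12 s1pi by (auto simp: I_def)
    qed
    define a where "a = (\<Sum>j\<in>I. sin (2 * x j)) - sin (2 * s)"
    define l where "l = (\<Sum>j\<in>I. sin (x j)) - sin s"
    have "(\<Sum>j\<in>I. sin (2 * x j)) = (\<Sum>j\<in>{i0..<i1}. sin (2 * x j)) + (\<Sum>j\<in>{i1..<i2}. sin (2 * x j))"
      unfolding I_def using i by (intro sum.atLeastLessThan_concat[symmetric]) auto
    then have a0a: "a0 \<le> a" using sub1 sub2 by (simp add: a_def a0_def)
    have a2s: "a \<le> 2 * s"
    proof -
      have "(\<Sum>j\<in>I. sin (2 * x j)) \<le> (\<Sum>j\<in>I. 2 * x j)" using x0I by (intro sum_mono sin_x_le_x) auto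
      also have "\<dots> = 2 * s" using sumI by (simp add: sum_distrib_left[symmetric])
      finally have "(\<Sum>j\<in>I. sin (2 * x j)) \<le> 2 * s" .
      moreover have "0 \<le> sin (2 * s)" using s s1pi by (intro sin_ge_zero) auto
      ultimately show ?thesis by (simp add: a_def)
    qed
    have "8 * cos (s / 2) ^ 3 * l \<le> a"
    proof -
      have "(\<lambda>t. sin (2 * t) - 8 * cos (s / 2) ^ 3 * sin t) (\<Sum>j\<in>I. x j)
        \<le> (\<Sum>j\<in>I. sin (2 * x j) - 8 * cos (s / 2) ^ 3 * sin (x j))"
        by (rule subadditive_sum[of _ _ s]) (use merge_ratio[of _ _ s] x0I sumI s1pi in \<open>auto simp: I_def\<close>)
      then show ?thesis unfolding sumI a_def l_def
        by (simp add: sum_subtractf sum_distrib_left[symmetric] right_diff_distrib)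
    qed
    then have G: "a / D \<le> u" "sin (2 * (s + a / D)) - sin (2 * s) + sin (2 * (u - a / D)) - sin (2 * u) \<le> a"
      "g * a + l \<le> sin (s + a / D) - sin s + sin (u - a / D) - sin u"
      using gain[OF s _ a2s] a0a a0 by auto
    have "area (inscribed_gaps.poly p n x) \<le> A"
    proof -
      have cf: "continuous_on S f" for S unfolding f_def by (intro continuous_intros)
      have "area (convex hull (f ` \<Theta>')) \<le> area (convex hull (f ` \<Theta>))"
        using \<Theta>(1) fin sub compact_continuous_image[OF cf \<Theta>(1)]
        by (intro area_mono compact_convex_hull hull_mono) (auto intro: finite_imp_compact)
      then show ?thesis using area unfolding hull f_def by simp
    qed
    then have feas: "feas n A x" using gaps_feas[OF ig] by blast
    have "(\<Sum>j<n. sin (x j)) - (\<Sum>j\<in>I. sin (x j)) + sin (s + a / D) + sin (x l0 - a / D) - sin (x l0) \<le> V"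
    proof (rule transfer_bound[OF feas _ _ l0(1) _ sumI])
      show "I \<subseteq> {..<n}" "i0 \<in> I" "l0 \<notin> I" using i i2 i2l by (auto simp: I_def)
      show "0 \<le> a / D" using a0a a0 g(4) by simp
    qed (use G(1,2) xl in \<open>auto simp: a_def\<close>)
    then have "(\<Sum>j<n. sin (x j)) + g * a \<le> V" using G(3) xl by (simp add: l_def)
    moreover have "g * a0 \<le> g * a" using a0a g(1) by simp
    ultimately have "2 * (\<Sum>j<n. sin (x j)) \<le> 2 * V - 2 * (g * a0)" by linarith
    then have "mw (convex hull (f ` \<Theta>')) \<le> 2 * V - 2 * (g * a0)"
      unfolding hull inscribed_gaps.mw_poly[OF ig] .
    then show "mw (convex hull ((\<lambda>t. p * cis (2 * t)) ` \<Theta>')) \<le> 2 * V - 2 * (g * a0)" unfolding f_def .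
  qed simp
qed

text \<open>Approximations from within \<open>E\<close> that contain the image of
  \<open>\<Theta>0\<close> fall short of \<open>2 * V\<close> by \<open>g\<close>, yet they come
  within \<open>g / 2\<close> of \<open>mw C\<close>.\<close>

lemma optimal_finite_extreme:
  assumes opt: "optimal_body C" shows "finite {x. x extreme_point_of C}"
proof (rule ccontr)
  note C = optimal_bodyD[OF opt]
  define E where "E = {x. x extreme_point_of C}"
  assume "infinite {x. x extreme_point_of C}"
  then have inf: "infinite E" by (simp add: E_def)
  have E: "compact E" "E \<subseteq> sphere 0 1"
    using optimal_extreme_compact[OF opt, of "{}"] optimal_extreme_on_circle[OF opt] by (auto simp: E_def)
  have hE: "C = convex hull E" unfolding E_def by (rule Krein_Milman_Minkowski[OF C(1,2)])
  \<comment> \<open>Otherwise \<open>C\<close> would be the whole disk, of area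
    \<open>pi > A\<close>.\<close>
  have "E \<noteq> sphere 0 1"
  proof
    assume "E = sphere 0 1"
    then have "sphere 0 1 \<subseteq> C" unfolding hE using hull_subset[of E convex] by simp
    moreover have "convex hull (sphere (0::complex) 1) = cball 0 1"
      using Krein_Milman_frontier[OF convex_cball compact_cball, of "0::complex" 1] by simp
    ultimately have "cball 0 1 \<subseteq> C" using hull_minimal[of "sphere 0 1" C convex] C(2) by simp
    then have "pi \<le> area C" using area_mono[OF compact_cball C(1) \<open>cball 0 1 \<subseteq> C\<close>] area_disk by simp
    then show False using C(4) Api by simp
  qed
  moreover have "E \<noteq> {}" using inf by auto
  ultimately obtain p \<Theta> L where p: "norm p = 1" and \<Theta>: "compact \<Theta>" "0 \<in> \<Theta>" "L \<in> \<Theta>" "\<Theta> \<subseteq> {0..L}" "L < pi"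
    and E\<Theta>: "E = (\<lambda>t. p * cis (2 * t)) ` \<Theta>"
    using circle_gap_param[OF E] by metis
  have "infinite \<Theta>" using inf E\<Theta> by auto
  moreover have "area (convex hull ((\<lambda>t. p * cis (2 * t)) ` \<Theta>)) \<le> A" using C(4) hE E\<Theta> by simp
  ultimately obtain g \<Theta>0 where g: "0 < g" "finite \<Theta>0" "\<Theta>0 \<subseteq> \<Theta>"
    and def: "\<And>\<Theta>'. finite \<Theta>' \<Longrightarrow> \<Theta>0 \<subseteq> \<Theta>' \<Longrightarrow> \<Theta>' \<subseteq> \<Theta> \<Longrightarrow> mw (convex hull ((\<lambda>t. p * cis (2 * t)) ` \<Theta>')) \<le> 2 * V - g"
    using infinite_vertices_deficit[OF p \<Theta>] by metis
  define f where "f t = p * cis (2 * t)" for t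
  have "finite (f ` \<Theta>0)" "f ` \<Theta>0 \<subseteq> E" "0 < g / 2" using g E\<Theta> by (auto simp: f_def)
  then obtain V' where V': "finite V'" "f ` \<Theta>0 \<subseteq> V'" "V' \<subseteq> E" "mw (convex hull E) \<le> mw (convex hull V') + g / 2"
    using mw_finite_approx[OF E(1) \<open>E \<noteq> {}\<close>] by metis
  have "V' \<subseteq> f ` \<Theta>" using V'(3) E\<Theta> by (simp add: f_def)
  then obtain \<Theta>1 where \<Theta>1: "\<Theta>1 \<subseteq> \<Theta>" "finite \<Theta>1" "V' = f ` \<Theta>1"
    using finite_subset_image[OF V'(1)] by metis
  have "mw (convex hull (f ` (\<Theta>1 \<union> \<Theta>0))) \<le> 2 * V - g"
    unfolding f_def by (rule def) (use \<Theta>1 g in auto)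
  moreover have "f ` (\<Theta>1 \<union> \<Theta>0) = V'" using \<Theta>1(3) V'(2) by auto
  ultimately show False using V'(4) C(5) hE g(1) by simp
qed

text \<open>Finitely many extreme points on the circle make \<open>C\<close> an inscribed polygon.
  Its gaps, padded with zeros, attain the optimal value, so they form the multiset
  \<open>best m\<close>; comparing sizes gives exactly \<open>m\<close> vertices.\<close>

lemma optimal_body_gaps:
  assumes opt: "optimal_body C"
  obtains p x where "inscribed_gaps p m x" "C = inscribed_gaps.poly p m x"
    "image_mset x (mset_set {..<m}) = best m"
proof -
  note C = optimal_bodyD[OF opt]
  define E where "E = {x. x extreme_point_of C}"
  have E: "finite E" "E \<subseteq> sphere 0 1"
    using optimal_finite_extreme[OF opt] optimal_extreme_on_circle[OF opt] by (auto simp: E_def)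
  have hE: "C = convex hull E" unfolding E_def by (rule Krein_Milman_Minkowski[OF C(1,2)])
  have "\<not> collinear E" using C(6) unfolding hE by (simp add: collinear_aff_dim aff_dim_convex_hull)
  then obtain a b c where "a \<in> E" "b \<in> E" "c \<in> E" "orient a b c \<noteq> 0" by (rule noncollinear_orient)
  then have "convex_polygon C" unfolding hE by (rule convex_polygonI[OF E(1)])
  then have "inscribed_in_disk C" using E(2) by (simp add: inscribed_in_disk_def vertices_def E_def)
  then obtain p x where ig: "inscribed_gaps p (card (vertices C)) x" "C = inscribed_gaps.poly p (card (vertices C)) x"
    by (rule inscribed_obtain_gaps)
  define k where "k = card (vertices C)"
  note ig = ig[folded k_def]
  have feas: "feas k A x" using gaps_feas[OF ig(1)] C(4) ig(2) by simp
  have "(\<Sum>i<k. sin (x i)) = V"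
    using C(5) inscribed_gaps.mw_poly[OF ig(1)] ig(2) feas_le_V[OF feas] by simp
  define n where "n = max m k"
  define y where "y i = (if i < k then x i else 0)" for i
  have n: "3 \<le> n" "m \<le> n" "k \<le> n" using m_props(1) by (auto simp: n_def)
  have y: "feas n A y" "(\<Sum>i<n. sin (y i)) = best_val n"
    using feas_pad[OF feas n(3)] best_val_large[OF n(2)] \<open>(\<Sum>i<k. sin (x i)) = V\<close> by (simp_all add: y_def[abs_def])
  have "positive_gaps n y = best m" using feas_le_best(2)[OF n(1) y] best_large[OF n(2)] by simp
  moreover have "{i. i < n \<and> 0 < y i} = {..<k}"
    using inscribed_gaps.xpos[OF ig(1)] n(3) by (auto simp: y_def)
  moreover have "image_mset y (mset_set {..<k}) = image_mset x (mset_set {..<k})"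
    by (intro image_mset_cong) (auto simp: y_def)
  ultimately have im: "image_mset x (mset_set {..<k}) = best m" by (simp add: positive_gaps_def)
  then have "size (image_mset x (mset_set {..<k})) = size (best m)" by simp
  then have "k = m" using m_props(1) by (simp add: best_def)
  then show ?thesis using that ig im by simp
qed

section \<open>Solutions of problem (II)\<close>

lemma convex_class_closure:
  assumes "convex_class A S"
  shows "compact (closure S)" "convex (closure S)" "closure S \<subseteq> cball 0 1" "area (closure S) = A"
    "perimeter S \<le> mw (closure S)"
proof -
  have S: "convex S" "S \<subseteq> cball 0 1" "area S = A" using assms by (auto simp: convex_class_def)
  have bS: "bounded S" using S(2) bounded_cball bounded_subset by blast
  show cc: "compact (closure S)" "convex (closure S)" using bS S(1) by (auto simp: convex_closure)
  show "closure S \<subseteq> cball 0 1" using S(2) by (simp add: closure_minimal)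
  show ar: "area (closure S) = A"
    using measure_closure[OF bS negligible_convex_frontier[OF S(1)]] S(3) by (simp add: area_def)
  define E where "E = {x. x extreme_point_of (closure S)}"
  have hE: "closure S = convex hull E" unfolding E_def by (rule Krein_Milman_Minkowski[OF cc])
  have "\<not> collinear (closure S)" using collinear_area_0[OF cc] ar A0 by auto
  then have "\<not> collinear E" unfolding hE by (simp add: collinear_aff_dim aff_dim_convex_hull)
  then obtain a b c where abc: "a \<in> E" "b \<in> E" "c \<in> E" "orient a b c \<noteq> 0" by (rule noncollinear_orient)
  \<comment> \<open>Since the interior of the closure is the interior of \<open>S\<close>, extreme
    points of the closure lie on the frontier. Three noncollinear ones yield an inscribed triangle,
    so the supremum in \<open>perimeter\<close> is not over the empty set.\<close>
  have "E \<subseteq> frontier S"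
    using extreme_point_not_in_interior[of _ "closure S"] convex_interior_closure[OF S(1)]
    unfolding E_def frontier_def by (auto simp: extreme_point_of_def)
  then have "vertices (convex hull {a,b,c}) \<subseteq> frontier S" using vertices_hull_subset[of "{a,b,c}"] abc by auto
  moreover have "convex_polygon (convex hull {a,b,c})" using abc(4) by (intro convex_polygonI[of "{a,b,c}" a b c]) simp_all
  ultimately show "perimeter S \<le> mw (closure S)" using perimeter_le_mw_closure[OF S(1) bS] by blast
qed

lemma perimeter_convex_class:
  assumes "convex_class A S" shows "perimeter S \<le> 2 * V"
proof -
  note S = convex_class_closure[OF assms]
  have "closure S \<noteq> {}" using S(4) A0 by (auto simp: area_def)
  then show ?thesis using convex_bound[OF S(1,2) _ S(3)] S(4,5) by simp
qed

lemma solution_II_best_poly: "solution_II A best_poly"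
proof -
  have "convex best_poly" using convex_polygon_vertices(2)[OF best_poly_props(1)] by (metis convex_convex_hull)
  then have "convex_class A best_poly" using best_poly_props by (simp add: convex_class_def)
  then show ?thesis using perimeter_convex_class best_poly_props(5)
    by (force simp: solution_II_def is_arg_max_def not_less)
qed

lemma solution_II_optimal_body:
  assumes "solution_II A S" shows "optimal_body (closure S)"
proof -
  have cS: "convex_class A S" using assms by (simp add: solution_II_def is_arg_max_def)
  note S = convex_class_closure[OF cS]
  have "convex_class A best_poly" using solution_II_best_poly by (simp add: solution_II_def is_arg_max_def)
  then have "\<not> perimeter best_poly > perimeter S" using assms by (auto simp: solution_II_def is_arg_max_def)
  then have "2 * V \<le> perimeter S" using best_poly_props(5) by simp
  then show ?thesis using S by (simp add: optimal_body_def)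
qed

lemma solution_II_characterization:
  assumes "solution_II A S"
  shows "\<exists>(m::nat) (\<theta>::nat \<Rightarrow> real).
           inscribed_in_disk (closure S) \<and>
           card (sides (closure S)) = m \<and>
           (real m - 1) * sin (2 * pi / (real m - 1)) < 2 * A \<and>
           2 * A \<le> real m * sin (2 * pi / real m) \<and>
           central_angles (closure S) = image_mset \<theta> (mset_set {1..m}) \<and>
           0 < \<theta> 1 \<and> \<theta> 1 \<le> \<theta> 2 \<and> (\<forall>i\<in>{2..m}. \<theta> i = \<theta> 2) \<and>
           \<theta> 1 \<le> 2 * pi / real m \<and>
           sin (\<theta> 1) + (real m - 1) * sin ((2 * pi - \<theta> 1) / (real m - 1)) = 2 * A"
proof -
  obtain p x where ig: "inscribed_gaps p m x" "closure S = inscribed_gaps.poly p m x"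
    and x: "image_mset x (mset_set {..<m}) = best m"
    using optimal_body_gaps[OF solution_II_optimal_body[OF assms]] by metis
  interpret ig: inscribed_gaps p m x by (rule ig(1))
  define \<theta> where "\<theta> i = (if i = 1 then 2 * t0 else 2 * u0)" for i :: nat
  have "\<theta> 1 = 2 * t0" by (simp add: \<theta>_def)
  have m1: "real (m - 1) = real m - 1" using m_props(1) by (simp add: of_nat_diff)
  \<comment> \<open>Every gap occurs in \<open>best m\<close> and is thus at most
    \<open>u0 \<le> pi / 2\<close>, the range in which central angles are twice the gaps.\<close>
  have "x i \<in># best m" if "i < m" for i unfolding x[symmetric] using that by auto
  then have "x i \<le> pi / 2" if "i < m" for i
    using that u0_props(1,2) by (fastforce simp: best_def split: if_splits)
  then have "central_angles (closure S) = image_mset (\<lambda>t. 2 * t) (image_mset x (mset_set {..<m}))"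
    unfolding ig(2) by (subst ig.central_angles_poly) (simp_all add: image_mset.compositionality comp_def)
  also have "\<dots> = add_mset (2 * t0) (replicate_mset (m - 1) (2 * u0))" unfolding x by (simp add: best_def)
  also have "\<dots> = image_mset \<theta> (mset_set {1..m})"
  proof -
    have "{1..m} = insert 1 {2..m}" using m_props(1) by auto
    then have "image_mset \<theta> (mset_set {1..m}) = add_mset (\<theta> 1) (image_mset \<theta> (mset_set {2..m}))" by simp
    also have "image_mset \<theta> (mset_set {2..m}) = image_mset (\<lambda>_. 2 * u0) (mset_set {2..m})"
      by (intro image_mset_cong) (auto simp: \<theta>_def)
    also have "\<dots> = replicate_mset (m - 1) (2 * u0)" by (simp add: image_mset_const_eq)
    finally show ?thesis by (simp only: \<open>\<theta> 1 = 2 * t0\<close>)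
  qed
  finally have "central_angles (closure S) = image_mset \<theta> (mset_set {1..m})" .
  moreover have "(2 * pi - 2 * t0) / (real m - 1) = 2 * u0" by (simp add: u0_def field_simps)
  ultimately show ?thesis
    using ig.inscribed_poly ig.card_sides ig(2) m_props t0_props u0_props
    by (intro exI[of _ m] exI[of _ \<theta>]) (auto simp: \<theta>_def reg_def m1)
qed

end

theorem theorem6:
  fixes A :: real
  assumes "0 < A" and "A < pi"
  shows
    "(\<forall>n\<ge>3. (\<exists>P. solution_I n A P) \<and>
        (\<forall>P Q. solution_I n A P \<longrightarrow> solution_I n A Q \<longrightarrow> side_lengths P = side_lengths Q)) \<and>
     (\<exists>m\<ge>3. \<forall>n\<ge>m. \<forall>n'\<ge>m. \<forall>P Q. solution_I n A P \<longrightarrow> solution_I n' A Q \<longrightarrow>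
        side_lengths P = side_lengths Q) \<and>
     (\<exists>S. solution_II A S) \<and>
     (\<forall>S. solution_II A S \<longrightarrow>
        (\<exists>(m::nat) (\<theta>::nat \<Rightarrow> real).
           inscribed_in_disk (closure S) \<and>
           card (sides (closure S)) = m \<and>
           (real m - 1) * sin (2 * pi / (real m - 1)) < 2 * A \<and>
           2 * A \<le> real m * sin (2 * pi / real m) \<and>
           central_angles (closure S) = image_mset \<theta> (mset_set {1..m}) \<and>
           0 < \<theta> 1 \<and> \<theta> 1 \<le> \<theta> 2 \<and> (\<forall>i\<in>{2..m}. \<theta> i = \<theta> 2) \<and>
           \<theta> 1 \<le> 2 * pi / real m \<and>
           sin (\<theta> 1) + (real m - 1) * sin ((2 * pi - \<theta> 1) / (real m - 1)) = 2 * A))"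
proof -
  interpret area_param A by unfold_locales (rule assms)+
  have "side_lengths P = side_lengths Q" if "3 \<le> n" "solution_I n A P" "solution_I n A Q" for n P Q
    using that solution_I_side_lengths by simp
  moreover have "side_lengths P = side_lengths Q"
    if "m \<le> n" "m \<le> n'" "solution_I n A P" "solution_I n' A Q" for n n' P Q
    using that solution_I_side_lengths[of n P] solution_I_side_lengths[of n' Q] m_props(1)
      best_large[of n] best_large[of n'] by simp
  ultimately show ?thesis
    using solution_I_exists solution_II_best_poly solution_II_characterization m_props(1) by blast
qed

end
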